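(* Let $A$ be a nonnegative linear operator on a Banach space $X$. Let $\lambda>0$ and $u\in X$. The following are equivalent. (1) $A^su=\lambda^su$ for some $0<s<2$. (2) $A^su=\lambda^su$ for all $s>0$. If, in addition, $A$ is one-to-one, then (1) and (2) are also equivalent to each of the following two statements. (3) $A^{-s}u=\lambda^{-s}u$ for some $0<s<2$. (4) $A^{-s}u=\lambda^{-s}u$ for all $s>0$.
   Context: $X$ is a Banach space and $I$ its identity operator. A linear operator $A:D(A)\subset X\to X$, with range $R(A)$, is nonnegative if for every $\mu>0$ the operator $\mu I+A:D(A)\to X$ is bijective with bounded inverse, and $\sup_{\mu>0}\|\mu(\mu I+A)^{-1}\|<\infty$. We write $0\in\rho(A)$ if $A:D(A)\to X$ is bijective with bounded inverse, and $0\in\sigma(A)$ otherwise. If $A$ is nonnegative and one-to-one, then $A^{-1}$ (with domain $R(A)$) is also nonnegative. Positive fractional powers $A^s$, $s>0$, of a nonnegative operator $A$: (a) If $A$ is bounded, $A^s=J^s$, where (integrals are Bochner integrals): for $0<s<1$, $D(J^s)=D(A)$ and $J^su=\frac{\sin(s\pi)}{\pi}\int_0^\infty\mu^{s-1}(\mu I+A)^{-1}Au\,d\mu$; for $s=1$, $D(J^s)=D(A^2)$ and $J^su=\frac{\sin(s\pi)}{\pi}\int_0^\infty\mu^{s-1}\big[(\mu I+A)^{-1}-\frac{\mu}{\mu^2+1}I\big]Au\,d\mu+\sin(s\pi/2)Au$; for $n<s<n+1$, $n\in\{1,2,\dots\}$, $D(J^s)=D(A^{n+1})$ and $J^su=J^{s-n}A^nu$;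 for $s=n+1$, $n\in\{1,2,\dots\}$, $D(J^s)=D(A^{n+2})$ and $J^su=J^{s-n}A^nu$. (b) If $A$ is unbounded and $0\in\rho(A)$, $A^s=[(A^{-1})^s]^{-1}$. (c) If $A$ is unbounded and $0\in\sigma(A)$, $A^su=\lim_{\varepsilon\to0^+}(A+\varepsilon I)^su$, with $D(A^s)$ the set of all $u$ that belong to $D((A+\varepsilon I)^s)$ for all $\varepsilon>0$ close to zero and for which the limit exists in $X$. Negative fractional powers: if $A$ is nonnegative and one-to-one, $A^{-s}:=(A^{-1})^s$ for $s>0$; it equals the inverse $(A^s)^{-1}$ of $A^s$. An equation $A^{\pm s}u=\lambda^{\pm s}u$ includes the assertion that $u\in D(A^{\pm s})$. *)

theory Defs
  imports "HOL-Analysis.Analysis"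
begin

text \<open>
  The scalars are real.  All notions below involve real scalars only, so complex Banach spaces and
  complex-linear operators are covered by regarding them as real ones.
\<close>

section \<open>Bochner integral in arbitrary Banach spaces\<close>

text \<open>
  The library integral is restricted to second countable (i.e. separable) spaces, because it is based
  on Borel measurability.  We use the usual definition with strong measurability instead.
\<close>

definition strongly_measurable :: "'m measure \<Rightarrow> ('m \<Rightarrow> 'a::banach) \<Rightarrow> bool" where
  "strongly_measurable M f \<longleftrightarrow>
     (\<exists>h. (\<forall>i. simple_function M (h i)) \<and> (AE x in M. (\<lambda>i::nat. h i x) \<longlonglongrightarrow> f x))"

definition has_strong_bochner_integral ::
    "'m measure \<Rightarrow> ('m \<Rightarrow> 'a::banach) \<Rightarrow> 'a \<Rightarrow> bool" where
  "has_strong_bochner_integral M f y \<longleftrightarrow>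
     strongly_measurable M f \<and>
     (\<exists>h. (\<forall>i::nat. Bochner_Integration.simple_bochner_integrable M (h i)) \<and>
          (\<lambda>i. \<integral>\<^sup>+x. norm (f x - h i x) \<partial>M) \<longlonglongrightarrow> 0 \<and>
          (\<lambda>i. Bochner_Integration.simple_bochner_integral M (h i)) \<longlonglongrightarrow> y)"

definition strong_bochner_integral :: "'m measure \<Rightarrow> ('m \<Rightarrow> 'a::banach) \<Rightarrow> 'a" where
  "strong_bochner_integral M f = (THE y. has_strong_bochner_integral M f y)"

lemma has_strong_bochner_integral_iff_has_bochner_integral:
  fixes f :: "'m \<Rightarrow> 'a::{banach, second_countable_topology}"
  assumes f: "f \<in> borel_measurable M"
  shows "has_strong_bochner_integral M f y \<longleftrightarrow> has_bochner_integral M f y"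
proof -
  obtain h where h: "\<And>i. simple_function M (h i)"
      "\<And>x. x \<in> space M \<Longrightarrow> (\<lambda>i. h i x) \<longlonglongrightarrow> f x"
    using borel_measurable_implies_sequence_metric[OF f, of 0] by blast
  have "AE x in M. (\<lambda>i. h i x) \<longlonglongrightarrow> f x"
    by (rule AE_I2) (rule h(2))
  with h(1) have "strongly_measurable M f"
    unfolding strongly_measurable_def by blast
  with f show ?thesis
    unfolding has_strong_bochner_integral_def has_bochner_integral.simps by blast
qed

definition halfline_integral :: "(real \<Rightarrow> 'a::banach) \<Rightarrow> 'a" where
  "halfline_integral f = strong_bochner_integral lborel (\<lambda>t. indicator {0<..} t *\<^sub>R f t)"

section \<open>Partially defined operators\<close>

text \<open>The values of \<open>app T\<close> outside \<open>domn T\<close> are irrelevant.\<close>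

datatype 'a operator = Operator (domn: "'a set") (app: "'a \<Rightarrow> 'a")

definition maps_to :: "'a operator \<Rightarrow> 'a \<Rightarrow> 'a \<Rightarrow> bool" where
  "maps_to T u v \<longleftrightarrow> u \<in> domn T \<and> app T u = v"

definition op_range :: "'a operator \<Rightarrow> 'a set" where
  "op_range T = app T ` domn T"

definition one_to_one :: "'a operator \<Rightarrow> bool" where
  "one_to_one T \<longleftrightarrow> inj_on (app T) (domn T)"

definition op_inverse :: "'a operator \<Rightarrow> 'a operator" where
  "op_inverse T = Operator (op_range T) (inv_into (domn T) (app T))"

definition op_shift :: "real \<Rightarrow> 'a::banach operator \<Rightarrow> 'a operator" where
  "op_shift \<mu> T = Operator (domn T) (\<lambda>u. \<mu> *\<^sub>R u + app T u)"

definition op_comp :: "'a operator \<Rightarrow> 'a operator \<Rightarrow> 'a operator" where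
  "op_comp S T = Operator {u \<in> domn T. app T u \<in> domn S} (app S \<circ> app T)"

primrec op_power :: "'a operator \<Rightarrow> nat \<Rightarrow> 'a operator" where
  "op_power T 0 = Operator UNIV id"
| "op_power T (Suc n) = op_comp T (op_power T n)"

definition linear_operator :: "'a::banach operator \<Rightarrow> bool" where
  "linear_operator T \<longleftrightarrow> subspace (domn T) \<and>
     (\<forall>u\<in>domn T. \<forall>v\<in>domn T. app T (u + v) = app T u + app T v) \<and>
     (\<forall>c. \<forall>u\<in>domn T. app T (c *\<^sub>R u) = c *\<^sub>R app T u)"

definition bounded_operator :: "'a::banach operator \<Rightarrow> bool" where
  "bounded_operator T \<longleftrightarrow> (\<exists>C. \<forall>u\<in>domn T. norm (app T u) \<le> C * norm u)"

definition boundedly_invertible :: "'a::banach operator \<Rightarrow> bool" where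
  "boundedly_invertible T \<longleftrightarrow>
     bij_betw (app T) (domn T) UNIV \<and> bounded_operator (op_inverse T)"

definition resolvent :: "'a::banach operator \<Rightarrow> real \<Rightarrow> 'a \<Rightarrow> 'a" where
  "resolvent T \<mu> = app (op_inverse (op_shift \<mu> T))"

definition nonnegative_operator :: "'a::banach operator \<Rightarrow> bool" where
  "nonnegative_operator T \<longleftrightarrow> linear_operator T \<and>
     (\<forall>\<mu>>0. boundedly_invertible (op_shift \<mu> T)) \<and>
     bdd_above ((\<lambda>\<mu>. onorm (\<lambda>x. \<mu> *\<^sub>R resolvent T \<mu> x)) ` {0<..})"

section \<open>Fractional powers\<close>

definition J_low :: "'a::banach operator \<Rightarrow> real \<Rightarrow> 'a \<Rightarrow> 'a" where
  "J_low A s u =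
     (if s < 1 then
        (sin (s * pi) / pi) *\<^sub>R
          halfline_integral (\<lambda>\<mu>. \<mu> powr (s - 1) *\<^sub>R resolvent A \<mu> (app A u))
      else
        (sin (s * pi) / pi) *\<^sub>R
          halfline_integral (\<lambda>\<mu>. \<mu> powr (s - 1) *\<^sub>R
            (resolvent A \<mu> (app A u) - (\<mu> / (\<mu>\<^sup>2 + 1)) *\<^sub>R app A u))
        + sin (s * pi / 2) *\<^sub>R app A u)"

text \<open>
  The natural number \<open>n\<close> below is the one with \<open>n < s \<le> n + 1\<close>, so that \<open>0 < s - n \<le> 1\<close>;
  \<open>n = 0\<close> gives the two base cases, since then \<open>op_power A n\<close> is the identity.
\<close>

definition J_power :: "'a::banach operator \<Rightarrow> real \<Rightarrow> 'a operator" where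
  "J_power A s =
     (let n = nat (\<lceil>s\<rceil> - 1) in
      Operator
        (if s < real n + 1 then domn (op_power A (n + 1)) else domn (op_power A (n + 2)))
        (\<lambda>u. J_low A (s - real n) (app (op_power A n) u)))"

text \<open>
  The power of \<open>A\<close> when \<open>A\<close> is bounded or \<open>0 \<in> \<rho>(A)\<close>.  For a nonnegative \<open>A\<close> this applies to every
  \<open>A + \<epsilon>I\<close> with \<open>\<epsilon> > 0\<close>.
\<close>

definition regular_power :: "'a::banach operator \<Rightarrow> real \<Rightarrow> 'a operator" where
  "regular_power A s =
     (if bounded_operator A then J_power A s
      else op_inverse (J_power (op_inverse A) s))"

definition frac_power :: "'a::banach operator \<Rightarrow> real \<Rightarrow> 'a operator" where
  "frac_power A s =
     (if bounded_operator A \<or> boundedly_invertible A then regular_power A s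
      else Operator
        {u. (\<forall>\<^sub>F \<epsilon> in at_right 0. u \<in> domn (regular_power (op_shift \<epsilon> A) s)) \<and>
            (\<exists>v. ((\<lambda>\<epsilon>. app (regular_power (op_shift \<epsilon> A) s) u) \<longlongrightarrow> v) (at_right 0))}
        (\<lambda>u. Lim (at_right 0) (\<lambda>\<epsilon>. app (regular_power (op_shift \<epsilon> A) s) u)))"

definition neg_frac_power :: "'a::banach operator \<Rightarrow> real \<Rightarrow> 'a operator" where
  "neg_frac_power A s = frac_power (op_inverse A) s"

end

theory Submission
  imports Defs
begin

text \<open>
  Every statement is equivalent to \<open>A u = \<lambda> u\<close>.  An eigenvector of \<open>A\<close> is one of all resolvents, so
  that its powers are given by the scalar integral of \<open>r\<^sup>b\<^sup>-\<^sup>1 / (r + \<lambda>)\<close>.  For the converse, work with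
  the bounded operators \<open>A\<^sup>b (1 + A)\<^sup>-\<^sup>1\<close>, \<open>0 < b < 1\<close>.  Their semigroup law follows by letting \<open>m\<close>
  tend to \<open>0\<close> in the law for \<open>(m + A)\<^sup>-\<^sup>b\<close>, and there both sides solve the same linear differential
  equation in \<open>m\<close> and agree asymptotically for large \<open>m\<close>.  If \<open>A\<^sup>s u = \<lambda>\<^sup>s u\<close>, then the (regularised)
  orbit \<open>a \<mapsto> \<lambda>\<^sup>-\<^sup>a A\<^sup>a u\<close> is periodic with period \<open>s < 2\<close>.  On its \<open>k\<close>-th Fourier coefficient \<open>A\<^sup>b\<close> acts
  as multiplication by \<open>\<lambda>\<^sup>b exp (i b \<theta>)\<close> with \<open>\<theta> = 2 pi k / s > pi\<close>, whereas the integral formula allows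
  only arguments whose sine has the same sign for all \<open>b \<le> 1\<close>.  Hence the coefficients with \<open>k > 0\<close> vanish,
  the orbit is constant, and \<open>A u = \<lambda> u\<close>.
\<close>

section \<open>Integrals over the positive half-line\<close>

text \<open>\<open>A\<close> may be unbounded, not densely defined and not injective, and its powers
  come with different formulas and domains. Hence every power is multiplied by enough copies of the
  injective operator \<open>R 1 = (1 + A)\<^sup>-\<^sup>1\<close> to become bounded; identities are
  proved for bounded operators, and the copies are cancelled at the end. The integral for
  \<open>A\<^sup>b (1 + A)\<^sup>-\<^sup>1\<close> is available for \<open>b < 1\<close>, so an
  exponent \<open>s < 2\<close> is treated as two factors \<open>s / 2\<close>. All cases of the
  definition are connected with the one equation \<open>apow (s / 2) (apow (s / 2) u) = lam powr s
  *\<^sub>R R 1 (R 1 u)\<close>, directly, through the inverse, or through a limit of shifts.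
  Scalars are real, so a Fourier coefficient is a pair, its cosine and sine parts, packed into a
  real-linear map from the complex numbers. The last obstacle is the kernel of \<open>A\<close>:
  constancy of the orbit only shows that a power of \<open>A\<close> kills the defect of the
  equation \<open>A u = lam u\<close>. But the defect satisfies the same power equation as
  \<open>u\<close>, and for a vector killed by a power of \<open>A\<close> that equation forces it
  to be 0.\<close>

definition window :: "nat \<Rightarrow> real set" where
  "window n = {1 / (real n + 1)..real n + 1}"

text \<open>Stands in for Bochner integrability: continuity gives strong measurability even when the
  space is not separable, and the scalar majorant gives absolute convergence. Only the open
  half-line is mentioned, so singularities at 0 are allowed.\<close>

definition dominated :: "(real \<Rightarrow> 'b::real_normed_vector) \<Rightarrow> (real \<Rightarrow> real) \<Rightarrow> bool" where
  "dominated f g \<longleftrightarrow> continuous_on {0<..} f \<and> continuous_on {0<..} g \<and>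
     g integrable_on {0<..} \<and> (\<forall>r>0. norm (f r) \<le> g r)"

text \<open>An improper integral over compact windows, where continuity suffices for integrability;
  \<open>halfline_integral_eq\<close> identifies it with the Bochner integral.\<close>

definition half_integral :: "(real \<Rightarrow> 'b::real_normed_vector) \<Rightarrow> 'b" where
  "half_integral f = lim (\<lambda>n. integral (window n) f)"

lemma window_pos: "x \<in> window n \<Longrightarrow> 0 < x"
  unfolding window_def by (auto intro: less_le_trans[of _ "1 / (real n + 1)"])

lemma window_subset: "window n \<subseteq> {0<..}"
  using window_pos by auto

lemma window_mono: "n \<le> m \<Longrightarrow> window n \<subseteq> window m"
  unfolding window_def by (auto intro!: divide_left_mono elim!: order_trans[rotated])

lemma eventually_in_window:
  assumes "0 < x"
  shows "\<forall>\<^sub>F n in sequentially. x \<in> window n"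
proof -
  obtain N :: nat where N: "max x (1 / x) \<le> real N"
    using real_arch_simple by blast
  have "x \<in> window n" if "N \<le> n" for n
  proof -
    have "1 / x \<le> real n + 1" "x \<le> real n + 1"
      using N that by auto
    then show ?thesis
      using assms by (auto simp: window_def field_simps)
  qed
  then show ?thesis
    using eventually_sequentially by blast
qed

lemma integrable_on_window:
  fixes f :: "real \<Rightarrow> 'b::banach"
  assumes "continuous_on {0<..} f"
  shows "f integrable_on window n"
  using assms continuous_on_subset[OF _ window_subset]
  unfolding window_def by (blast intro: integrable_continuous_real)

lemma dominated_nonneg: "dominated f g \<Longrightarrow> 0 < r \<Longrightarrow> 0 \<le> g r"
  unfolding dominated_def using norm_ge_zero order_trans by blast

lemma integral_window_tendsto:
  fixes g :: "real \<Rightarrow> real"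
  assumes "continuous_on {0<..} g" "g integrable_on {0<..}" "\<And>r. 0 < r \<Longrightarrow> 0 \<le> g r"
  shows "(\<lambda>n. integral (window n) g) \<longlonglongrightarrow> integral {0<..} g"
proof -
  have eq: "{0<..} \<inter> window n = window n" for n
    using window_subset by auto
  have "(\<lambda>n. integral {0<..} (\<lambda>x. if x \<in> window n then g x else 0)) \<longlonglongrightarrow> integral {0<..} g"
  proof (rule dominated_convergence(2)[where h = g])
    show "(\<lambda>x. if x \<in> window n then g x else 0) integrable_on {0<..}" for n
      unfolding integrable_restrict_Int Int_commute[of "window n"] eq
      by (rule integrable_on_window) fact
    show "norm (if x \<in> window n then g x else 0) \<le> g x" if "x \<in> {0<..}" for n x
      using assms(3)[of x] that by auto
    show "(\<lambda>n. if x \<in> window n then g x else 0) \<longlonglongrightarrow> g x" if "x \<in> {0<..}" for x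
    proof (rule tendsto_eventually)
      show "\<forall>\<^sub>F n in sequentially. (if x \<in> window n then g x else 0) = g x"
        by (rule eventually_mono[OF eventually_in_window]) (use that in auto)
    qed
  qed fact+
  then show ?thesis
    unfolding integral_restrict_Int Int_commute[of "window _"] eq .
qed

text \<open>The Cauchy estimate behind convergence: the integrals of the majorant over the windows
  converge, so their increments are small.\<close>

lemma integral_window_diff:
  fixes f :: "real \<Rightarrow> 'b::banach"
  assumes "dominated f g" "n \<le> m"
  shows "norm (integral (window m) f - integral (window n) f)
    \<le> integral (window m) g - integral (window n) g"
proof -
  \<comment> \<open>As one integral over the larger window, with the integrand set to 0 on the
    smaller one, the difference is accessible to the pointwise bound by \<open>g\<close>.\<close>
  have split: "integral (window m) h - integral (window n) h =
      integral (window m) (\<lambda>x. if x \<in> window n then 0 else h x)"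
    and int: "(\<lambda>x. if x \<in> window n then 0 else h x) integrable_on window m"
    if h: "continuous_on {0<..} h" for h :: "real \<Rightarrow> 'c::banach"
  proof -
    have eq: "window n \<inter> window m = window n"
      using window_mono[OF assms(2)] by auto
    have i: "(\<lambda>x. if x \<in> window n then h x else 0) integrable_on window m"
      unfolding integrable_restrict_Int eq by (rule integrable_on_window) fact
    have e: "(\<lambda>x. if x \<in> window n then 0 else h x) = (\<lambda>x. h x - (if x \<in> window n then h x else 0))"
      by auto
    show "(\<lambda>x. if x \<in> window n then 0 else h x) integrable_on window m"
      unfolding e by (intro integrable_diff i integrable_on_window h)
    have "integral (window n) h = integral (window m) (\<lambda>x. if x \<in> window n then h x else 0)"
      unfolding integral_restrict_Int eq ..
    then show "integral (window m) h - integral (window n) h =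
        integral (window m) (\<lambda>x. if x \<in> window n then 0 else h x)"
      unfolding e by (simp add: integral_diff i integrable_on_window h)
  qed
  have c: "continuous_on {0<..} f" "continuous_on {0<..} g"
    using assms by (auto simp: dominated_def)
  show ?thesis
    unfolding split[OF c(1)] split[OF c(2)]
    by (rule integral_norm_bound_integral[OF int[OF c(1)] int[OF c(2)]])
      (use assms window_pos in \<open>auto simp: dominated_def\<close>)
qed

lemma integral_window_le:
  assumes "dominated f g"
  shows "integral (window n) g \<le> integral {0<..} g"
proof (rule incseq_le)
  have *: "dominated g g"
    using assms dominated_nonneg[OF assms] by (auto simp: dominated_def)
  show "incseq (\<lambda>n. integral (window n) g)"
  proof (rule monoI)
    fix n m :: nat assume "n \<le> m"
    then show "integral (window n) g \<le> integral (window m) g"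
      using order_trans[OF norm_ge_zero integral_window_diff[OF *]] by simp
  qed
  show "(\<lambda>n. integral (window n) g) \<longlonglongrightarrow> integral {0<..} g"
    using integral_window_tendsto[of g] * dominated_nonneg[OF assms] by (auto simp: dominated_def)
qed

lemma half_integral_tendsto:
  fixes f :: "real \<Rightarrow> 'b::banach"
  assumes "dominated f g"
  shows "(\<lambda>n. integral (window n) f) \<longlonglongrightarrow> half_integral f"
proof -
  have g: "(\<lambda>n. integral (window n) g) \<longlonglongrightarrow> integral {0<..} g"
    using integral_window_tendsto[of g] dominated_nonneg[OF assms] assms by (auto simp: dominated_def)
  have "Cauchy (\<lambda>n. integral (window n) f)"
  proof (rule metric_CauchyI)
    fix e :: real assume "0 < e"
    then obtain N where N: "\<forall>n\<ge>N. \<bar>integral (window n) g - integral {0<..} g\<bar> < e"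
      using LIMSEQ_D[OF g] by auto
    have *: "norm (integral (window n) f - integral (window m) f) < e" if "N \<le> m" "m \<le> n" for m n
    proof -
      have "norm (integral (window n) f - integral (window m) f)
        \<le> integral (window n) g - integral (window m) g"
        using integral_window_diff[OF assms that(2)] .
      also have "\<dots> \<le> integral {0<..} g - integral (window m) g"
        using integral_window_le[OF assms, of n] by simp
      also have "\<dots> < e"
        using N that by (auto simp: abs_less_iff)
      finally show ?thesis .
    qed
    show "\<exists>M. \<forall>m\<ge>M. \<forall>n\<ge>M. dist (integral (window m) f) (integral (window n) f) < e"
    proof (intro exI[of _ N] allI impI)
      fix m n assume "N \<le> m" "N \<le> n"
      then show "dist (integral (window m) f) (integral (window n) f) < e"
        using *[of m n] *[of n m] by (cases "m \<le> n") (auto simp: dist_norm norm_minus_commute)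
    qed
  qed
  then show ?thesis
    unfolding half_integral_def convergent_LIMSEQ_iff[symmetric] by (rule Cauchy_convergent)
qed

lemma half_integral_eqI:
  fixes f :: "real \<Rightarrow> 'b::banach"
  assumes "(\<lambda>n. integral (window n) f) \<longlonglongrightarrow> y"
  shows "half_integral f = y"
  unfolding half_integral_def using assms by (rule limI)

lemma norm_half_integral_le:
  fixes f :: "real \<Rightarrow> 'b::banach"
  assumes "dominated f g"
  shows "norm (half_integral f) \<le> integral {0<..} g"
proof (rule LIMSEQ_le_const2)
  show "(\<lambda>n. norm (integral (window n) f)) \<longlonglongrightarrow> norm (half_integral f)"
    by (intro tendsto_norm half_integral_tendsto) fact
  have "norm (integral (window n) f) \<le> integral {0<..} g" for n
  proof -
    have "norm (integral (window n) f) \<le> integral (window n) g"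
      using assms window_pos
      by (intro integral_norm_bound_integral integrable_on_window) (auto simp: dominated_def)
    then show ?thesis
      using integral_window_le[OF assms, of n] by simp
  qed
  then show "\<exists>N. \<forall>n\<ge>N. norm (integral (window n) f) \<le> integral {0<..} g"
    by blast
qed

lemma half_integral_cong:
  "(\<And>r. 0 < r \<Longrightarrow> f r = h r) \<Longrightarrow> half_integral f = half_integral h"
  unfolding half_integral_def
  by (intro arg_cong[where f = lim] ext Henstock_Kurzweil_Integration.integral_cong)
    (use window_pos in blast)

lemma dominated_cong:
  "(\<And>r. 0 < r \<Longrightarrow> f r = h r) \<Longrightarrow> dominated f g \<longleftrightarrow> dominated h g"
  unfolding dominated_def using continuous_on_cong[of "{0<..}" "{0<..}" f h] by auto

lemma dominated_linear:
  assumes "dominated f g" "bounded_linear T"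
  shows "\<exists>K>0. dominated (\<lambda>r. T (f r)) (\<lambda>r. K * g r)"
proof -
  obtain K where K: "0 < K" "\<And>x. norm (T x) \<le> norm x * K"
    using bounded_linear.pos_bounded[OF assms(2)] by blast
  have "norm (T (f r)) \<le> K * g r" if "0 < r" for r
  proof -
    have "norm (f r) * K \<le> g r * K"
      using assms(1) K(1) that by (intro mult_right_mono) (auto simp: dominated_def)
    with K(2)[of "f r"] show ?thesis
      by (simp add: mult.commute)
  qed
  then have "dominated (\<lambda>r. T (f r)) (\<lambda>r. K * g r)"
    using assms by (auto simp: dominated_def intro!: continuous_intros
        bounded_linear.continuous_on[OF assms(2)] integrable_on_mult_right)
  with K(1) show ?thesis
    by blast
qed

lemma half_integral_linear:
  fixes f :: "real \<Rightarrow> 'b::banach" and T :: "'b \<Rightarrow> 'c::banach"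
  assumes "dominated f g" "bounded_linear T"
  shows "half_integral (\<lambda>r. T (f r)) = T (half_integral f)"
proof (rule half_integral_eqI)
  have "integral (window n) (\<lambda>r. T (f r)) = T (integral (window n) f)" for n
    using integral_linear[OF integrable_on_window assms(2), of f n] assms(1)
    by (auto simp: dominated_def comp_def)
  then show "(\<lambda>n. integral (window n) (\<lambda>r. T (f r))) \<longlonglongrightarrow> T (half_integral f)"
    using bounded_linear.tendsto[OF assms(2) half_integral_tendsto[OF assms(1)]] by simp
qed

lemma half_integral_diff:
  fixes f h :: "real \<Rightarrow> 'b::banach"
  assumes "dominated f g" "dominated h k"
  shows "half_integral (\<lambda>r. f r - h r) = half_integral f - half_integral h"
proof (rule half_integral_eqI)
  have "integral (window n) (\<lambda>r. f r - h r) = integral (window n) f - integral (window n) h" for n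
    using assms by (intro integral_diff integrable_on_window) (auto simp: dominated_def)
  then show "(\<lambda>n. integral (window n) (\<lambda>r. f r - h r)) \<longlonglongrightarrow> half_integral f - half_integral h"
    using tendsto_diff[OF half_integral_tendsto[OF assms(1)] half_integral_tendsto[OF assms(2)]]
    by simp
qed

lemma half_integral_real:
  fixes f :: "real \<Rightarrow> real"
  assumes "dominated f f"
  shows "half_integral f = integral {0<..} f"
  using integral_window_tendsto[of f] assms dominated_nonneg[OF assms]
  by (intro half_integral_eqI) (auto simp: dominated_def)

text \<open>Scalar dominated convergence for \<open>norm (F n r - f r)\<close> is enough, because
  the integral of this norm bounds the difference of the integrals.\<close>

lemma half_integral_dominated_convergence:
  fixes f :: "real \<Rightarrow> 'b::banach"
  assumes "\<And>n. dominated (F n) g" "dominated f g"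
    and lim: "\<And>r. 0 < r \<Longrightarrow> (\<lambda>n. F n r) \<longlonglongrightarrow> f r"
  shows "(\<lambda>n. half_integral (F n)) \<longlonglongrightarrow> half_integral f"
proof -
  have g: "continuous_on {0<..} g" "g integrable_on {0<..}" "\<And>r. 0 < r \<Longrightarrow> 0 \<le> g r"
    using assms(2) dominated_nonneg[OF assms(2)] by (auto simp: dominated_def)
  have cont: "continuous_on {0<..} (\<lambda>r. norm (F n r - f r))" for n
    using assms by (auto simp: dominated_def intro!: continuous_intros)
  have bnd: "norm (F n r - f r) \<le> 2 * g r" if "0 < r" for n r
  proof -
    have "norm (F n r) \<le> g r" "norm (f r) \<le> g r"
      using assms that by (auto simp: dominated_def)
    then show ?thesis
      using norm_triangle_ineq4[of "F n r" "f r"] by linarith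
  qed
  have int: "(\<lambda>r. norm (F n r - f r)) integrable_on {0<..}" for n
  proof (rule measurable_bounded_by_integrable_imp_integrable)
    show "(\<lambda>r. norm (F n r - f r)) \<in> borel_measurable (lebesgue_on {0<..})"
      by (rule continuous_imp_measurable_on_sets_lebesgue[OF cont]) auto
    show "(\<lambda>r. 2 * g r) integrable_on {0<..}"
      using g(2) by auto
  qed (use bnd in auto)
  \<comment> \<open>The norm of the difference is its own majorant; the coarser \<open>2 * g\<close>
    serves for integrability and for the scalar limit.\<close>
  have dom: "dominated (\<lambda>r. F n r - f r) (\<lambda>r. norm (F n r - f r))" for n
    using assms int[of n] cont[of n] by (auto simp: dominated_def intro!: continuous_intros)
  have "(\<lambda>n. integral {0<..} (\<lambda>r. norm (F n r - f r))) \<longlonglongrightarrow> integral {0<..} (\<lambda>r::real. 0::real)"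
  proof (rule dominated_convergence(2)[where h = "\<lambda>r. 2 * g r"])
    show "(\<lambda>r. 2 * g r) integrable_on {0<..}"
      using g(2) by auto
    show "(\<lambda>n. norm (F n r - f r)) \<longlonglongrightarrow> 0" if "r \<in> {0<..}" for r
      using lim[of r] that by (intro tendsto_norm_zero) (auto simp: LIM_zero_iff)
  qed (use bnd int in auto)
  then have "(\<lambda>n. integral {0<..} (\<lambda>r. norm (F n r - f r))) \<longlonglongrightarrow> 0"
    by simp
  moreover have "norm (half_integral (F n) - half_integral f) \<le> integral {0<..} (\<lambda>r. norm (F n r - f r))" for n
    unfolding half_integral_diff[OF assms(1) assms(2), symmetric]
    by (rule norm_half_integral_le[OF dom])
  ultimately have "(\<lambda>n. half_integral (F n) - half_integral f) \<longlonglongrightarrow> 0"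
    by (rule Lim_null_comparison[OF always_eventually[OF allI], rotated])
  then show ?thesis
    by (rule LIM_zero_cancel)
qed

text \<open>The fundamental theorem on each window, with boundary values that vanish at both ends;
  this is the form in which integration by parts is used.\<close>

lemma half_integral_derivative:
  fixes F :: "real \<Rightarrow> 'b::banach"
  assumes F: "\<And>r. 0 < r \<Longrightarrow> (F has_vector_derivative f r) (at r)"
    and lim: "(F \<longlongrightarrow> 0) (at_right 0)" "(F \<longlongrightarrow> 0) at_top"
  shows "half_integral f = 0"
proof (rule half_integral_eqI)
  have "integral (window n) f = F (real n + 1) - F (inverse (real (Suc n)))" for n
    unfolding window_def
  proof (rule integral_unique, unfold inverse_eq_divide of_nat_Suc add.commute[of 1],
      rule fundamental_theorem_of_calculus)
    show "1 / (real n + 1) \<le> real n + 1"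
      by (auto simp: field_simps)
    show "(F has_vector_derivative f x) (at x within {1 / (real n + 1)..real n + 1})"
      if "x \<in> {1 / (real n + 1)..real n + 1}" for x
      using F[of x] window_pos[of x n] that
      by (auto simp: window_def intro: has_vector_derivative_at_within)
  qed
  moreover have "filterlim (\<lambda>n. real n + 1) at_top sequentially"
    by (rule filterlim_at_top_mono[OF filterlim_real_sequentially]) auto
  moreover have "filterlim (\<lambda>n. inverse (real (Suc n))) (at_right 0) sequentially"
    using LIMSEQ_inverse_real_of_nat by (auto simp: filterlim_at intro!: always_eventually)
  ultimately show "(\<lambda>n. integral (window n) f) \<longlonglongrightarrow> 0"
    using tendsto_diff[OF filterlim_compose[OF lim(2)] filterlim_compose[OF lim(1)]] by simp
qed

text \<open>The map \<open>r \<mapsto> 1 / r\<close> preserves every window.\<close>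

lemma half_integral_inverse:
  fixes f :: "real \<Rightarrow> 'b::banach"
  assumes "continuous_on {0<..} f"
  shows "half_integral (\<lambda>r. (1 / r\<^sup>2) *\<^sub>R f (1 / r)) = half_integral f"
proof -
  have "integral (window n) (\<lambda>r. (1 / r\<^sup>2) *\<^sub>R f (1 / r)) = integral (window n) f" for n
  proof -
    define a b where "a = 1 / (real n + 1)" and "b = real n + 1"
    have ab: "0 < a" "a \<le> b" "1 / a = b" "1 / b = a"
      by (auto simp: a_def b_def field_simps)
    have w: "window n = {a..b}"
      by (simp add: window_def a_def b_def)
    have cont: "continuous_on {a..b} f"
      using assms ab by (auto intro: continuous_on_subset)
    define H where "H x = integral {a..x} f" for x
    have H: "(H has_vector_derivative f x) (at x within {a..b})" if "x \<in> {a..b}" for x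
      unfolding H_def by (rule integral_has_vector_derivative[OF cont that])
    have "((\<lambda>r. - H (1 / r)) has_vector_derivative (1 / r\<^sup>2) *\<^sub>R f (1 / r)) (at r within {a..b})"
      if r: "r \<in> {a..b}" for r
    proof -
      have r0: "0 < r"
        using r ab by auto
      have inv: "((\<lambda>r. 1 / r) has_vector_derivative - (1 / r\<^sup>2)) (at r within {a..b})"
        using r0 unfolding has_real_derivative_iff_has_vector_derivative[symmetric]
        by (auto intro!: derivative_eq_intros simp: power2_eq_square)
      have im: "(\<lambda>r. 1 / r) ` {a..b} \<subseteq> {a..b}"
        using ab divide_left_mono[of _ b 1] divide_left_mono[of a _ 1] by force
      have "1 / r \<in> {a..b}"
        using im r by blast
      then have "(H has_vector_derivative f (1 / r)) (at (1 / r) within (\<lambda>r. 1 / r) ` {a..b})"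
        by (intro has_vector_derivative_within_subset[OF H im])
      from vector_diff_chain_within[OF inv this]
      have "((\<lambda>r. H (1 / r)) has_vector_derivative - (1 / r\<^sup>2) *\<^sub>R f (1 / r)) (at r within {a..b})"
        by (simp add: comp_def)
      from has_vector_derivative_minus[OF this] show ?thesis
        by simp
    qed
    then have "((\<lambda>r. (1 / r\<^sup>2) *\<^sub>R f (1 / r)) has_integral - H (1 / b) - - H (1 / a)) {a..b}"
      by (intro fundamental_theorem_of_calculus ab)
    then show ?thesis
      unfolding w ab by (auto simp: H_def dest: integral_unique)
  qed
  then show ?thesis
    by (simp add: half_integral_def)
qed

section \<open>Comparison with the Bochner integral\<close>

lemma simple_bochner_integral_has_integral:
  fixes s :: "real \<Rightarrow> 'b::banach"
  assumes "Bochner_Integration.simple_bochner_integrable lborel s"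
  shows "(s has_integral Bochner_Integration.simple_bochner_integral lborel s) UNIV"
proof -
  have sf: "simple_function lborel s" and fin: "emeasure lborel {x. s x \<noteq> 0} \<noteq> \<infinity>"
    using assms by (auto simp: simple_bochner_integrable.simps)
  have fr: "finite (range s)"
    using sf by (simp add: simple_function_def)
  have "((\<lambda>x. (if s x = y then 1 else 0) *\<^sub>R y) has_integral measure lborel {x. s x = y} *\<^sub>R y) UNIV"
    if "y \<in> range s" for y
  proof (cases "y = 0")
    case False
    have ms: "{x. s x = z} \<in> sets borel" for z
      using simple_functionD(2)[OF sf, of "{z}"] by (auto simp: vimage_def)
    have "{x. s x \<noteq> 0} \<in> sets borel"
      using sets.compl_sets[of _ borel, OF ms[of 0]] by (simp add: Collect_neg_eq Compl_eq_Diff_UNIV)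
    then have "emeasure lborel {x. s x = y} \<le> emeasure lborel {x. s x \<noteq> 0}"
      using False ms by (intro emeasure_mono) auto
    with fin have "emeasure lborel {x. s x = y} < \<infinity>"
      by (auto simp: less_top intro: le_less_trans)
    with ms have "((\<lambda>x. 1) has_integral measure lborel {x. s x = y}) {x. s x = y}"
      by (rule has_integral_measure_lborel)
    then have "((\<lambda>x. if x \<in> {x. s x = y} then 1 else 0) has_integral measure lborel {x. s x = y}) UNIV"
      by (simp only: has_integral_restrict_UNIV)
    then have "((\<lambda>x. if s x = y then 1 else 0) has_integral measure lborel {x. s x = y}) UNIV"
      by simp
    then show ?thesis
      by (rule has_integral_scaleR_left)
  qed auto
  then have "((\<lambda>x. \<Sum>y\<in>range s. (if s x = y then 1 else 0) *\<^sub>R y) has_integral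
      (\<Sum>y\<in>range s. measure lborel {x. s x = y} *\<^sub>R y)) UNIV"
    using fr by (intro has_integral_sum) auto
  moreover have "(\<Sum>y\<in>range s. (if s x = y then 1 else 0) *\<^sub>R y) = s x" for x
  proof -
    have "(\<Sum>y\<in>range s. (if s x = y then 1 else 0) *\<^sub>R y) = (\<Sum>y\<in>range s. if s x = y then y else 0)"
      by (intro sum.cong) auto
    then show ?thesis
      using fr by (simp add: sum.delta)
  qed
  ultimately show ?thesis
    by (simp add: simple_bochner_integral_def)
qed

lemma uniform_step_function:
  fixes f :: "real \<Rightarrow> 'b::banach"
  assumes "continuous_on {a..b} f" "0 < e"
  obtains s where "Bochner_Integration.simple_bochner_integrable lborel s"
    "\<And>x. x \<in> {a..b} \<Longrightarrow> norm (f x - s x) < e" "\<And>x. x \<notin> {a..b} \<Longrightarrow> s x = 0"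
proof -
  have "uniformly_continuous_on {a..b} f"
    using assms(1) by (rule compact_uniformly_continuous) simp
  then obtain d where d: "0 < d"
      "\<And>x y. \<lbrakk>x \<in> {a..b}; y \<in> {a..b}; dist y x < d\<rbrakk> \<Longrightarrow> dist (f y) (f x) < e"
    using assms(2) unfolding uniformly_continuous_on_def by metis
  \<comment> \<open>The grid cell of \<open>x\<close> for the mesh \<open>d\<close> from uniform
    continuity, with -1 for points outside the interval. Measurability and finite range are checked
    for the integer-valued \<open>q\<close> and pass to \<open>s\<close> by composition.\<close>
  define q where "q x = (if x \<in> {a..b} then \<lfloor>(x - a) / d\<rfloor> else - 1)" for x
  define s where "s x = (if q x < 0 then 0 else f (a + d * of_int (q x)))" for x
  have q: "q x \<in> {-1..\<lfloor>(b - a) / d\<rfloor>} \<union> {-1}" for x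
  proof (cases "x \<in> {a..b}")
    case True
    then have "0 \<le> (x - a) / d" "(x - a) / d \<le> (b - a) / d"
      using d(1) by (auto simp: divide_right_mono)
    then show ?thesis
      using True by (auto simp: q_def intro: floor_mono order_trans[of _ 0])
  qed (auto simp: q_def)
  have "q \<in> measurable borel (count_space UNIV)"
    unfolding q_def by measurable
  then have "q -` {k} \<inter> space lborel \<in> sets lborel" for k
    using measurable_sets[of q borel "count_space UNIV" "{k}"] by simp
  moreover have "finite (q ` space lborel)"
    by (rule finite_subset[of _ "{-1..\<lfloor>(b - a) / d\<rfloor>} \<union> {-1}"]) (use q in blast, simp)
  ultimately have sq: "simple_function lborel q"
    by (simp add: simple_function_def)
  have "simple_function lborel ((\<lambda>k. if k < 0 then 0 else f (a + d * of_int k)) \<circ> q)"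
    using sq by (rule simple_function_compose)
  then have ss: "simple_function lborel s"
    by (simp add: s_def[abs_def] comp_def)
  have out: "s x = 0" if "x \<notin> {a..b}" for x
    using that by (auto simp: s_def q_def)
  have "emeasure lborel {x. s x \<noteq> 0} \<le> emeasure lborel {a..b}"
    by (rule emeasure_mono) (use out in blast, simp)
  also have "\<dots> < \<infinity>"
    by (simp add: emeasure_lborel_Icc_eq)
  finally have "Bochner_Integration.simple_bochner_integrable lborel s"
    using ss by (intro simple_bochner_integrable.intros) auto
  moreover have "norm (f x - s x) < e" if x: "x \<in> {a..b}" for x
  proof -
    define k where "k = \<lfloor>(x - a) / d\<rfloor>"
    have k: "0 \<le> k" "of_int k \<le> (x - a) / d" "(x - a) / d < of_int k + 1"
      using x d(1) by (auto simp: k_def)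
    have "d * of_int k \<le> x - a" "x - a < d * of_int k + d"
      using k(2,3) d(1) by (auto simp: field_simps)
    moreover have "0 \<le> d * of_int k"
      using d(1) k(1) by simp
    ultimately have "a + d * of_int k \<in> {a..b}" "dist (a + d * of_int k) x < d"
      using x by (auto simp: dist_real_def)
    from d(2)[OF x this] show ?thesis
      using x k(1) by (auto simp: s_def q_def k_def dist_norm norm_minus_commute)
  qed
  ultimately show thesis
    using out that by blast
qed

text \<open>Differences of Borel functions may fail to be measurable in a nonseparable space. Here
  \<open>s\<close> takes finitely many values, and for a fixed value \<open>y\<close> the norm of
  \<open>F x - y\<close> is a continuous function of \<open>F x\<close>.\<close>

lemma norm_diff_simple_measurable:
  fixes F :: "real \<Rightarrow> 'b::real_normed_vector"
  assumes F: "F \<in> borel_measurable borel" and s: "simple_function lborel s"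
  shows "(\<lambda>x. norm (F x - s x)) \<in> borel_measurable borel"
proof -
  have "(\<lambda>x. norm (F x - y)) \<in> borel_measurable borel" for y
  proof -
    have "(\<lambda>z. norm (z - y)) \<in> borel_measurable borel"
      by (intro borel_measurable_continuous_onI continuous_intros)
    from measurable_compose[OF F this] show ?thesis
      by simp
  qed
  moreover have "s \<in> measurable borel (count_space (range s))"
    using s by (auto simp: measurable_count_space_eq2 simple_function_def)
  ultimately show ?thesis
    using s by (intro measurable_compose_countable'[of "range s" "\<lambda>y x. norm (F x - y)" borel borel s])
      (auto simp: simple_function_def intro: countable_finite)
qed

text \<open>The triangle inequality through \<open>F\<close>. It forces any two approximating
  sequences to the same limit, which makes the \<open>THE\<close> in the definition of the integral
  meaningful.\<close>

lemma simple_bochner_integral_dist: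
  fixes F :: "real \<Rightarrow> 'b::banach"
  assumes F: "F \<in> borel_measurable borel"
    and s: "Bochner_Integration.simple_bochner_integrable lborel s"
    and t: "Bochner_Integration.simple_bochner_integrable lborel t"
  shows "ennreal (norm (Bochner_Integration.simple_bochner_integral lborel s -
        Bochner_Integration.simple_bochner_integral lborel t))
    \<le> (\<integral>\<^sup>+x. norm (F x - s x) \<partial>lborel) + (\<integral>\<^sup>+x. norm (F x - t x) \<partial>lborel)"
proof -
  have m: "(\<lambda>x. norm (F x - s x)) \<in> borel_measurable lborel"
      "(\<lambda>x. norm (F x - t x)) \<in> borel_measurable lborel"
    using norm_diff_simple_measurable[OF F] s t by (auto simp: simple_bochner_integrable.simps)
  have "ennreal (norm (Bochner_Integration.simple_bochner_integral lborel s - Bochner_Integration.simple_bochner_integral lborel t)) =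
      norm (Bochner_Integration.simple_bochner_integral lborel (\<lambda>x. s x - t x))"
    using s t by (subst simple_bochner_integral_diff) auto
  also have "\<dots> \<le> Bochner_Integration.simple_bochner_integral lborel (\<lambda>x. norm (s x - t x))"
    using simple_bochner_integrable_compose2[of "(-)" lborel s t] s t
    by (auto intro!: simple_bochner_integral_norm_bound)
  also have "\<dots> = (\<integral>\<^sup>+x. norm (s x - t x) \<partial>lborel)"
    using simple_bochner_integrable_compose2[of "\<lambda>x y. norm (x - y)" lborel s t] s t
    by (auto intro!: simple_bochner_integral_eq_nn_integral)
  also have "\<dots> \<le> (\<integral>\<^sup>+x. ennreal (norm (F x - s x)) + ennreal (norm (F x - t x)) \<partial>lborel)"
  proof (rule nn_integral_mono)
    fix x :: real
    have "norm (s x - t x) \<le> norm (F x - s x) + norm (F x - t x)"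
      using norm_triangle_ineq4[of "F x - t x" "F x - s x"] by simp
    then show "ennreal (norm (s x - t x)) \<le> ennreal (norm (F x - s x)) + ennreal (norm (F x - t x))"
      by (simp flip: ennreal_plus)
  qed
  also have "\<dots> = (\<integral>\<^sup>+x. norm (F x - s x) \<partial>lborel) + (\<integral>\<^sup>+x. norm (F x - t x) \<partial>lborel)"
    using m by (intro nn_integral_add) auto
  finally show ?thesis .
qed

text \<open>Existence: step functions on growing windows approximate \<open>f\<close>, and the error
  outside a window is a tail of \<open>g\<close>. Uniqueness: an arbitrary approximating sequence is
  compared with this one.\<close>

theorem has_strong_bochner_integral_half_integral:
  fixes f :: "real \<Rightarrow> 'b::banach"
  assumes dom: "dominated f g"
  defines "F \<equiv> \<lambda>t. indicator {0<..} t *\<^sub>R f t"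
  shows "has_strong_bochner_integral lborel F y \<longleftrightarrow> y = half_integral f"
proof -
  have cf: "continuous_on {0<..} f" and cg: "continuous_on {0<..} g" and ig: "g integrable_on {0<..}"
    and bd: "\<And>r. 0 < r \<Longrightarrow> norm (f r) \<le> g r"
    using dom by (auto simp: dominated_def)
  note g0 = dominated_nonneg[OF dom]
  have "(\<lambda>t. if t \<in> {0<..} then f t else 0) \<in> borel_measurable borel"
    by (rule borel_measurable_continuous_on_if) (use cf in auto)
  also have "(\<lambda>t. if t \<in> {0<..} then f t else 0) = F"
    by (auto simp: F_def fun_eq_iff)
  finally have Fm: "F \<in> borel_measurable borel" .
  \<comment> \<open>A window has length below \<open>n + 1\<close>, so the uniform error
    \<open>1 / (n + 1)\<^sup>2\<close> contributes at most \<open>1 / (n + 1)\<close> to the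
    integral.\<close>
  have "\<exists>s. Bochner_Integration.simple_bochner_integrable lborel s \<and>
      (\<forall>x\<in>window n. norm (f x - s x) < 1 / (real n + 1)\<^sup>2) \<and> (\<forall>x. x \<notin> window n \<longrightarrow> s x = 0)" for n
    using uniform_step_function[OF continuous_on_subset[OF cf window_subset[of n, unfolded window_def]],
        of "1 / (real n + 1)\<^sup>2"] by (metis divide_pos_pos of_nat_0_le_iff window_def zero_less_one
        zero_less_power add_nonneg_pos)
  then obtain s where s: "\<And>n. Bochner_Integration.simple_bochner_integrable lborel (s n)"
      "\<And>n x. x \<in> window n \<Longrightarrow> norm (f x - s n x) < 1 / (real n + 1)\<^sup>2"
      "\<And>n x. x \<notin> window n \<Longrightarrow> s n x = 0"
    by metis
  have len: "integral (window n) (\<lambda>x. 1 / (real n + 1)\<^sup>2) \<le> 1 / (real n + 1)" for n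
  proof -
    have "(real n + 1 - 1 / (real n + 1)) * (1 / (real n + 1)\<^sup>2) \<le> (real n + 1) * (1 / (real n + 1)\<^sup>2)"
      by (intro mult_right_mono) auto
    also have "\<dots> = 1 / (real n + 1)"
      by (simp add: power2_eq_square)
    finally show ?thesis
      by (simp add: window_def divide_le_eq)
  qed
  have inv0: "(\<lambda>n. 1 / (real n + 1)) \<longlonglongrightarrow> 0"
    using LIMSEQ_inverse_real_of_nat by (simp add: inverse_eq_divide add.commute)
  have sint: "(\<lambda>n. Bochner_Integration.simple_bochner_integral lborel (s n)) \<longlonglongrightarrow> half_integral f"
  proof -
    have "norm (Bochner_Integration.simple_bochner_integral lborel (s n) - integral (window n) f)
        \<le> 1 / (real n + 1)" for n
    proof -
      have "(s n has_integral Bochner_Integration.simple_bochner_integral lborel (s n)) UNIV"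
        by (rule simple_bochner_integral_has_integral) fact
      then have "(s n has_integral Bochner_Integration.simple_bochner_integral lborel (s n)) (window n)"
      proof (subst has_integral_restrict_UNIV[symmetric], goal_cases)
        case 1
        moreover have "(\<lambda>x. if x \<in> window n then s n x else 0) = s n"
          using s(3) by auto
        ultimately show ?case
          by simp
      qed
      then have si: "s n integrable_on window n"
          "integral (window n) (s n) = Bochner_Integration.simple_bochner_integral lborel (s n)"
        by auto
      have "norm (integral (window n) (\<lambda>x. s n x - f x)) \<le> integral (window n) (\<lambda>x. 1 / (real n + 1)\<^sup>2)"
        using s(2) by (intro integral_norm_bound_integral integrable_diff si integrable_on_window cf)
          (auto simp: window_def norm_minus_commute intro: less_imp_le)
      then show ?thesis
        using len[of n] by (simp add: integral_diff si integrable_on_window cf)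
    qed
    then have "(\<lambda>n. Bochner_Integration.simple_bochner_integral lborel (s n) - integral (window n) f) \<longlonglongrightarrow> 0"
      by (rule Lim_null_comparison[OF always_eventually[OF allI] inv0])
    from tendsto_add[OF this half_integral_tendsto[OF dom]] show ?thesis
      by simp
  qed
  have serr: "(\<lambda>n. \<integral>\<^sup>+x. norm (F x - s n x) \<partial>lborel) \<longlonglongrightarrow> 0"
  proof -
    \<comment> \<open>Pointwise bound of the error: the uniform precision on the window,
      \<open>g\<close> on the rest of the half-line.\<close>
    define b where "b n x = (if x \<in> window n then 1 / (real n + 1)\<^sup>2 else 0) +
        (if x \<in> {0<..} then g x else 0) - (if x \<in> window n then g x else 0)" for n x
    have "(\<integral>\<^sup>+x. norm (F x - s n x) \<partial>lborel) \<le>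
        ennreal (1 / (real n + 1) + (integral {0<..} g - integral (window n) g))" for n
    proof -
      have "(\<integral>\<^sup>+x. norm (F x - s n x) \<partial>lborel) \<le> (\<integral>\<^sup>+x. b n x \<partial>lborel)"
      proof (intro nn_integral_mono ennreal_leI)
        fix x :: real
        show "norm (F x - s n x) \<le> b n x"
          using s(2)[of x n] s(3)[of x n] bd[of x] window_pos[of x n]
          by (auto simp: F_def b_def)
      qed
      also have "(\<integral>\<^sup>+x. b n x \<partial>lborel) =
          ennreal (integral (window n) (\<lambda>x. 1 / (real n + 1)\<^sup>2) + integral {0<..} g - integral (window n) g)"
      proof (rule nn_integral_has_integral_lborel)
        have "window n \<in> sets borel"
          by (simp add: window_def)
        moreover have "continuous_on (window n) g"
          by (rule continuous_on_subset[OF cg window_subset])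
        ultimately show "b n \<in> borel_measurable borel"
          unfolding b_def using cg
          by (intro borel_measurable_add borel_measurable_diff borel_measurable_continuous_on_if) auto
        show "0 \<le> b n x" for x
          using g0[of x] window_pos[of x n] by (auto simp: b_def)
        show "(b n has_integral integral (window n) (\<lambda>x. 1 / (real n + 1)\<^sup>2) +
            integral {0<..} g - integral (window n) g) UNIV"
          unfolding b_def using integrable_on_window[OF cg] ig
          by (intro has_integral_add has_integral_diff)
            (auto simp only: has_integral_restrict_UNIV intro!: integrable_integral,
              auto simp: window_def)
      qed
      also have "\<dots> \<le> ennreal (1 / (real n + 1) + (integral {0<..} g - integral (window n) g))"
        using len[of n] by (intro ennreal_leI) simp
      finally show ?thesis .
    qed
    note le = this
    have "(\<lambda>n. ennreal (1 / (real n + 1) + (integral {0<..} g - integral (window n) g))) \<longlonglongrightarrow>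
        ennreal (0 + (integral {0<..} g - integral {0<..} g))"
      by (intro tendsto_ennrealI tendsto_add inv0 tendsto_diff tendsto_const
          integral_window_tendsto cg ig g0)
    then have lim: "(\<lambda>n. ennreal (1 / (real n + 1) + (integral {0<..} g - integral (window n) g))) \<longlonglongrightarrow> 0"
      by simp
    show ?thesis
      by (rule tendsto_sandwich[OF _ _ tendsto_const[of 0] lim]) (use le in simp_all)
  qed
  have "strongly_measurable lborel F"
    unfolding strongly_measurable_def
  proof (intro exI conjI allI AE_I2)
    show "simple_function lborel (s n)" for n
      using s(1)[of n] by (auto simp: simple_bochner_integrable.simps)
    show "(\<lambda>n. s n x) \<longlonglongrightarrow> F x" for x
    proof (cases "0 < x")
      case True
      have "\<forall>\<^sub>F n in sequentially. norm (s n x - f x) \<le> 1 / (real n + 1)"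
        using eventually_in_window[OF True]
      proof eventually_elim
        case (elim n)
        have "1 / (real n + 1)\<^sup>2 \<le> 1 / (real n + 1)"
          by (simp add: divide_simps power2_eq_square)
        then show ?case
          using s(2)[OF elim] by (simp add: norm_minus_commute)
      qed
      then have "(\<lambda>n. s n x - f x) \<longlonglongrightarrow> 0"
        using inv0 by (rule Lim_null_comparison)
      then show ?thesis
        using True by (simp add: LIM_zero_iff F_def)
    next
      case False
      then have "s n x = 0" for n
        using s(3) window_pos by blast
      then show ?thesis
        using False by (simp add: F_def)
    qed
  qed
  then have "has_strong_bochner_integral lborel F (half_integral f)"
    unfolding has_strong_bochner_integral_def using s(1) serr sint by blast
  moreover have "y = half_integral f" if y: "has_strong_bochner_integral lborel F y"
  proof -
    obtain h where h: "\<And>i. Bochner_Integration.simple_bochner_integrable lborel (h i)"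
        "(\<lambda>i. \<integral>\<^sup>+x. norm (F x - h i x) \<partial>lborel) \<longlonglongrightarrow> 0"
        "(\<lambda>i. Bochner_Integration.simple_bochner_integral lborel (h i)) \<longlonglongrightarrow> y"
      using y unfolding has_strong_bochner_integral_def by blast
    have lim: "(\<lambda>i. (\<integral>\<^sup>+x. norm (F x - h i x) \<partial>lborel) + (\<integral>\<^sup>+x. norm (F x - s i x) \<partial>lborel)) \<longlonglongrightarrow> 0"
      using tendsto_add[OF h(2) serr] by simp
    have "(\<lambda>i. ennreal (norm (Bochner_Integration.simple_bochner_integral lborel (h i) -
        Bochner_Integration.simple_bochner_integral lborel (s i)))) \<longlonglongrightarrow> 0"
      by (rule tendsto_sandwich[OF _ _ tendsto_const[of 0] lim])
        (use simple_bochner_integral_dist[OF Fm h(1) s(1)] in simp_all)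
    then have "(\<lambda>i. norm (Bochner_Integration.simple_bochner_integral lborel (h i) -
        Bochner_Integration.simple_bochner_integral lborel (s i))) \<longlonglongrightarrow> 0"
      by (simp flip: ennreal_0)
    moreover have "(\<lambda>i. norm (Bochner_Integration.simple_bochner_integral lborel (h i) -
        Bochner_Integration.simple_bochner_integral lborel (s i))) \<longlonglongrightarrow> norm (y - half_integral f)"
      by (intro tendsto_norm tendsto_diff h sint)
    ultimately show ?thesis
      using LIMSEQ_unique by fastforce
  qed
  ultimately show ?thesis
    by blast
qed

corollary halfline_integral_eq:
  assumes "dominated f g"
  shows "halfline_integral f = half_integral f"
  unfolding halfline_integral_def strong_bochner_integral_def
    has_strong_bochner_integral_half_integral[OF assms] by simp

section \<open>The Stieltjes kernel\<close>

lemma Beta_reflection_real: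
  fixes b :: real
  assumes "0 < b" "b < 1"
  shows "Beta b (1 - b) = pi / sin (pi * b)"
proof -
  have "complex_of_real (Gamma b * Gamma (1 - b)) = Gamma (complex_of_real b) * Gamma (1 - complex_of_real b)"
    by (simp flip: Gamma_complex_of_real)
  also have "\<dots> = complex_of_real (pi / sin (pi * b))"
    using Gamma_reflection_complex[of "complex_of_real b"] by (simp add: sin_of_real flip: of_real_mult)
  finally have "Gamma b * Gamma (1 - b) = pi / sin (pi * b)"
    using of_real_eq_iff by blast
  then show ?thesis
    by (simp add: Beta_def)
qed

text \<open>The substitution \<open>t = r / (r + m)\<close> leads to the Beta integral with
  parameters \<open>b\<close> and \<open>1 - b\<close>, which the reflection formula
  evaluates.\<close>

lemma has_integral_stieltjes_kernel:
  fixes b m :: real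
  assumes b: "0 < b" "b < 1" and m: "0 < m"
  shows "((\<lambda>r. r powr (b - 1) / (r + m)) has_integral pi / sin (pi * b) * m powr (b - 1)) {0<..}"
proof -
  define f where "f t = t powr (b - 1) * (1 - t) powr (- b)" for t :: real
  define h where "h r = r / (r + m)" for r :: real
  have "(f has_integral Beta b (1 - b)) {0..1}"
    using has_integral_Beta_real[of b "1 - b"] b by (simp add: f_def[abs_def])
  then have "(f has_integral Beta b (1 - b)) {0<..<1}"
    by (simp add: has_integral_Icc_iff_Ioo)
  then have "f absolutely_integrable_on {0<..<1} \<and> integral {0<..<1} f = Beta b (1 - b)"
    by (auto simp: f_def intro!: nonnegative_absolutely_integrable_1)
  also have "{0<..<1} = h ` {0<..}"
  proof (intro equalityI subsetI)
    fix t :: real assume "t \<in> {0<..<1}"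
    then have "t = h (m * t / (1 - t))" "0 < m * t / (1 - t)"
      using m by (auto simp: h_def field_simps)
    then show "t \<in> h ` {0<..}"
      by blast
  qed (use m in \<open>auto simp: h_def\<close>)
  finally have "(\<lambda>r. \<bar>m / (r + m)\<^sup>2\<bar> * f (h r)) absolutely_integrable_on {0<..} \<and>
      integral {0<..} (\<lambda>r. \<bar>m / (r + m)\<^sup>2\<bar> * f (h r)) = Beta b (1 - b)"
  proof (subst has_absolute_integral_change_of_variables_1'[where g = h and f = f and g' = "\<lambda>r. m / (r + m)\<^sup>2"])
    show "(h has_field_derivative m / (r + m)\<^sup>2) (at r within {0<..})" if "r \<in> {0<..}" for r
      unfolding h_def using m that
      by (auto intro!: derivative_eq_intros simp: power2_eq_square field_simps)
    show "inj_on h {0<..}"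
      using m by (intro inj_onI) (auto simp: h_def field_simps)
  qed auto
  then have "((\<lambda>r. \<bar>m / (r + m)\<^sup>2\<bar> * f (h r)) has_integral Beta b (1 - b)) {0<..}"
    by (metis has_integral_integral set_lebesgue_integral_eq_integral(1))
  then have "((\<lambda>r. m powr (b - 1) * (\<bar>m / (r + m)\<^sup>2\<bar> * f (h r))) has_integral
      m powr (b - 1) * Beta b (1 - b)) {0<..}"
    by (rule has_integral_mult_right)
  moreover have "m powr (b - 1) * (\<bar>m / (r + m)\<^sup>2\<bar> * f (h r)) = r powr (b - 1) / (r + m)"
    if "r \<in> {0<..}" for r
  proof -
    have r: "0 < r" "0 < r + m"
      using that m by auto
    have "1 - h r = m / (r + m)"
      using r by (simp add: h_def field_simps)
    then have "f (h r) = r powr (b - 1) / (r + m) powr (b - 1) * (m powr (- b) / (r + m) powr (- b))"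
      using r m by (simp add: f_def h_def powr_divide)
    also have "\<dots> = r powr (b - 1) * m powr (- b) / ((r + m) powr (b - 1) * (r + m) powr (- b))"
      by simp
    also have "(r + m) powr (b - 1) * (r + m) powr (- b) = 1 / (r + m)"
      using r powr_add[of "r + m" "b - 1" "- b"] by (simp add: powr_minus_divide)
    finally have "m powr (b - 1) * (\<bar>m / (r + m)\<^sup>2\<bar> * f (h r)) =
        (m powr (b - 1) * m powr (- b) * m) * (r powr (b - 1) / (r + m))"
      using r m by (simp add: power2_eq_square)
    also have "m powr (b - 1) * m powr (- b) * m = 1"
      unfolding powr_add[symmetric] using m by (simp add: powr_minus_divide)
    finally show ?thesis
      by simp
  qed
  ultimately have "((\<lambda>r. r powr (b - 1) / (r + m)) has_integral m powr (b - 1) * Beta b (1 - b)) {0<..}"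
    by (rule has_integral_eq[rotated])
  then show ?thesis
    using b by (simp add: Beta_reflection_real mult.commute)
qed

lemma continuous_on_stieltjes_kernel:
  "0 < m \<Longrightarrow> continuous_on {0<..} (\<lambda>r::real. r powr (b - 1) / (r + m))"
  by (intro continuous_intros) auto

text \<open>The kernel is integrable at 0 because \<open>b > 0\<close> and decays like
  \<open>r powr (b - 2)\<close> because \<open>b < 1\<close>; most majorants below have this
  shape.\<close>

lemma dominatedI:
  fixes f :: "real \<Rightarrow> 'b::real_normed_vector"
  assumes b: "0 < b" "b < 1" and m: "0 < m" and "continuous_on {0<..} f"
    and "\<And>r. 0 < r \<Longrightarrow> norm (f r) \<le> K * (r powr (b - 1) / (r + m))"
  shows "dominated f (\<lambda>r. K * (r powr (b - 1) / (r + m)))"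
  unfolding dominated_def
proof (intro conjI allI impI)
  show "continuous_on {0<..} (\<lambda>r. K * (r powr (b - 1) / (r + m)))"
    by (intro continuous_on_mult_left continuous_on_stieltjes_kernel m)
  show "(\<lambda>r. K * (r powr (b - 1) / (r + m))) integrable_on {0<..}"
    by (intro integrable_on_mult_right has_integral_integrable[OF has_integral_stieltjes_kernel[OF b m]])
qed (use assms in auto)

text \<open>The factor \<open>sin (pi * b) / pi\<close> normalises the kernel, so the constant
  \<open>K\<close> passes through unchanged.\<close>

lemma norm_half_integral_stieltjes:
  fixes f :: "real \<Rightarrow> 'b::banach"
  assumes b: "0 < b" "b < 1" and m: "0 < m" and "continuous_on {0<..} f"
    and "\<And>r. 0 < r \<Longrightarrow> norm (f r) \<le> K * (r powr (b - 1) / (r + m))"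
  shows "sin (pi * b) / pi * norm (half_integral f) \<le> K * m powr (b - 1)"
proof -
  have s: "0 < sin (pi * b)"
    using b by (intro sin_gt_zero) auto
  have "norm (half_integral f) \<le> integral {0<..} (\<lambda>r. K * (r powr (b - 1) / (r + m)))"
    by (rule norm_half_integral_le[OF dominatedI]) fact+
  also have "\<dots> = K * (pi / sin (pi * b) * m powr (b - 1))"
    by (rule integral_unique[OF has_integral_mult_right[OF has_integral_stieltjes_kernel[OF b m]]])
  finally have "sin (pi * b) / pi * norm (half_integral f)
      \<le> sin (pi * b) / pi * (K * (pi / sin (pi * b) * m powr (b - 1)))"
    using s by (intro mult_left_mono) auto
  then show ?thesis
    using s by simp
qed

lemma half_integral_stieltjes_kernel:
  fixes x :: "'b::banach"
  assumes b: "0 < b" "b < 1" and m: "0 < m"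
  shows "(sin (pi * b) / pi) *\<^sub>R half_integral (\<lambda>r. (r powr (b - 1) / (r + m)) *\<^sub>R x) = m powr (b - 1) *\<^sub>R x"
proof -
  have s: "0 < sin (pi * b)"
    using b by (intro sin_gt_zero) auto
  have dom: "dominated (\<lambda>r. r powr (b - 1) / (r + m)) (\<lambda>r. r powr (b - 1) / (r + m))"
    using dominatedI[OF b m continuous_on_stieltjes_kernel[OF m, of b], of 1] m by simp
  have "half_integral (\<lambda>r. (r powr (b - 1) / (r + m)) *\<^sub>R x) =
      half_integral (\<lambda>r. r powr (b - 1) / (r + m)) *\<^sub>R x"
    by (rule half_integral_linear[OF dom bounded_linear_scaleR_left])
  also have "half_integral (\<lambda>r. r powr (b - 1) / (r + m)) = pi / sin (pi * b) * m powr (b - 1)"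
    unfolding half_integral_real[OF dom]
    by (rule integral_unique[OF has_integral_stieltjes_kernel[OF b m]])
  finally show ?thesis
    using s by simp
qed

section \<open>Resolvent families\<close>

text \<open>Sequential form of the difference quotient, made for
  \<open>half_integral_dominated_convergence\<close>.\<close>

lemma has_vector_derivative_seqI:
  fixes f :: "real \<Rightarrow> 'b::real_normed_vector"
  assumes "\<And>y. \<lbrakk>y \<longlonglongrightarrow> x; \<And>n. y n \<noteq> x\<rbrakk> \<Longrightarrow> (\<lambda>n. (f (y n) - f x) /\<^sub>R (y n - x)) \<longlonglongrightarrow> D"
  shows "(f has_vector_derivative D) (at x)"
proof -
  have "((\<lambda>y. (f y - f x) /\<^sub>R (y - x)) \<longlongrightarrow> D) (at x)"
    unfolding tendsto_at_iff_sequentially using assms by (auto simp: comp_def)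
  then have "((\<lambda>y. (f y - f x) /\<^sub>R (y - x) - D) \<longlongrightarrow> 0) (at x)"
    by (simp add: LIM_zero)
  then have "((\<lambda>y. norm ((f y - f x) /\<^sub>R (y - x) - D)) \<longlongrightarrow> 0) (at x)"
    by (rule tendsto_norm_zero)
  also have "?this \<longleftrightarrow> ((\<lambda>y. norm ((f y - f x - (y - x) *\<^sub>R D) /\<^sub>R norm (y - x))) \<longlongrightarrow> 0) (at x)"
  proof (intro filterlim_cong refl)
    show "\<forall>\<^sub>F y in at x. norm ((f y - f x) /\<^sub>R (y - x) - D) =
        norm ((f y - f x - (y - x) *\<^sub>R D) /\<^sub>R norm (y - x))"
    proof (rule eventually_at_filter[THEN iffD2], intro always_eventually allI impI)
      fix y assume "y \<noteq> x"
      then have "(f y - f x) /\<^sub>R (y - x) - D = (f y - f x - (y - x) *\<^sub>R D) /\<^sub>R (y - x)"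
        by (simp add: scaleR_diff_right)
      then show "norm ((f y - f x) /\<^sub>R (y - x) - D) =
          norm ((f y - f x - (y - x) *\<^sub>R D) /\<^sub>R norm (y - x))"
        by simp
    qed
  qed
  finally show ?thesis
    unfolding has_vector_derivative_def has_derivative_at_within
    by (auto intro: bounded_linear_scaleR_left tendsto_norm_zero_cancel)
qed

interpretation blinfun_compose: bounded_bilinear "(o\<^sub>L)"
  by (rule bounded_bilinear_blinfun_compose)

lemma blinfun_compose_assoc: "(f o\<^sub>L g) o\<^sub>L h = f o\<^sub>L (g o\<^sub>L h)"
  by (rule blinfun_eqI) simp

lemma blinfun_compose_id [simp]: "f o\<^sub>L id_blinfun = f" "id_blinfun o\<^sub>L f = f"
  by (rule blinfun_eqI, simp)+

text \<open>Axioms for \<open>R t = (t + A)\<^sup>-\<^sup>1\<close> in which only bounded operators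
  occur. Injectivity is what later cancels the regularising factors.\<close>

locale resolvent_family =
  fixes R :: "real \<Rightarrow> 'a::banach \<Rightarrow>\<^sub>L 'a" and M :: real
  assumes resolvent_eq: "\<lbrakk>0 < s; 0 < t\<rbrakk> \<Longrightarrow> R s - R t = (t - s) *\<^sub>R (R s o\<^sub>L R t)"
    and norm_resolvent: "0 < t \<Longrightarrow> norm (R t) \<le> M / t"
    and resolvent_inj: "\<lbrakk>0 < t; R t x = 0\<rbrakk> \<Longrightarrow> x = 0"
begin

lemma M_nonneg: "0 \<le> M"
  using order_trans[OF norm_ge_zero norm_resolvent[of 1]] by simp

lemma resolvent_eq_apply:
  "\<lbrakk>0 < s; 0 < t\<rbrakk> \<Longrightarrow> R s x - R t x = (t - s) *\<^sub>R R s (R t x)"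
  using resolvent_eq[of s t] by (metis blinfun.diff_left blinfun.scaleR_left blinfun_apply_blinfun_compose)

lemma resolvent_commute:
  assumes "0 < s" "0 < t"
  shows "R s (R t x) = R t (R s x)"
proof (cases "s = t")
  case False
  have "(t - s) *\<^sub>R R s (R t x) = (t - s) *\<^sub>R R t (R s x)"
    using resolvent_eq_apply[OF assms, of x] resolvent_eq_apply[OF assms(2,1), of x]
    by (metis minus_diff_eq scaleR_minus_left)
  then show ?thesis
    using False by simp
qed simp

lemma norm_resolvent_compose:
  assumes "0 < s" "0 < t"
  shows "norm (R s o\<^sub>L R t) \<le> M / s * (M / t)"
  by (intro order_trans[OF norm_blinfun_compose] mult_mono norm_resolvent assms)
    (use assms M_nonneg in auto)

lemma continuous_on_resolvent: "continuous_on {0<..} R"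
  unfolding continuous_on_sequentially
proof (intro allI ballI impI, elim conjE)
  fix y :: "nat \<Rightarrow> real" and t
  assume t: "t \<in> {0<..}" and y: "\<forall>n. y n \<in> {0<..}" "y \<longlonglongrightarrow> t"
  have "norm (R (y n) - R t) \<le> \<bar>t - y n\<bar> * (M / y n * (M / t))" for n
    using mult_left_mono[OF norm_resolvent_compose[of "y n" t] abs_ge_zero[of "t - y n"]]
      resolvent_eq[of "y n" t] t y(1) by simp
  note le = this
  have "(\<lambda>n. \<bar>t - y n\<bar> * (M / y n * (M / t))) \<longlonglongrightarrow> \<bar>t - t\<bar> * (M / t * (M / t))"
    using t by (intro tendsto_intros y(2)) auto
  then have lim: "(\<lambda>n. \<bar>t - y n\<bar> * (M / y n * (M / t))) \<longlonglongrightarrow> 0"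
    by simp
  have "(\<lambda>n. R (y n) - R t) \<longlonglongrightarrow> 0"
    by (rule Lim_null_comparison[OF always_eventually[OF allI[OF le]] lim])
  then show "(R \<circ> y) \<longlonglongrightarrow> R t"
    by (simp add: LIM_zero_iff comp_def)
qed

lemma continuous_on_resolvent':
  "continuous_on S f \<Longrightarrow> (\<And>x. x \<in> S \<Longrightarrow> 0 < f x) \<Longrightarrow> continuous_on S (\<lambda>x. R (f x))"
  by (rule continuous_on_compose2[OF continuous_on_resolvent]) auto

lemma resolvent_tendsto:
  assumes "y \<longlonglongrightarrow> t" "0 < t"
  shows "(\<lambda>n. R (y n)) \<longlonglongrightarrow> R t"
  using assms continuous_on_resolvent
  by (intro isCont_tendsto_compose[of t R]) (auto simp: continuous_on_eq_continuous_at)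

lemma resolvent_has_vector_derivative:
  assumes "0 < t"
  shows "(R has_vector_derivative - (R t o\<^sub>L R t)) (at t)"
proof (rule has_vector_derivative_seqI)
  fix y assume y: "y \<longlonglongrightarrow> t" "\<And>n. y n \<noteq> t"
  have "(\<lambda>n. - (R (y n) o\<^sub>L R t)) \<longlonglongrightarrow> - (R t o\<^sub>L R t)"
    by (intro tendsto_minus blinfun_compose.tendsto resolvent_tendsto assms y tendsto_const)
  moreover have "\<forall>\<^sub>F n in sequentially. - (R (y n) o\<^sub>L R t) = (R (y n) - R t) /\<^sub>R (y n - t)"
    using order_tendstoD(1)[OF y(1) assms]
  proof eventually_elim
    case (elim n)
    have "(R (y n) - R t) /\<^sub>R (y n - t) = ((t - y n) / (y n - t)) *\<^sub>R (R (y n) o\<^sub>L R t)"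
      using resolvent_eq[OF elim assms] by (simp add: divide_inverse mult.commute)
    also have "(t - y n) / (y n - t) = - 1"
      using y(2)[of n] by (simp add: field_simps)
    finally show ?case
      by simp
  qed
  ultimately show "(\<lambda>n. (R (y n) - R t) /\<^sub>R (y n - t)) \<longlonglongrightarrow> - (R t o\<^sub>L R t)"
    using tendsto_cong by fast
qed

section \<open>Negative powers of the shifted operator and their derivative\<close>

text \<open>For the family of an operator \<open>A\<close>, \<open>rpow b m\<close> is the negative power \<open>(m + A) powr (b - 1)\<close>.\<close>

definition rpow :: "real \<Rightarrow> real \<Rightarrow> 'a \<Rightarrow>\<^sub>L 'a" where
  "rpow b m = (sin (pi * b) / pi) *\<^sub>R half_integral (\<lambda>r. r powr (b - 1) *\<^sub>R R (r + m))"

lemma continuous_on_rpow_integrand: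
  "0 < m \<Longrightarrow> continuous_on {0<..} (\<lambda>r. r powr (b - 1) *\<^sub>R R (r + m))"
  by (intro continuous_intros continuous_on_resolvent') auto

lemma norm_rpow_integrand:
  "\<lbrakk>0 < m; 0 < r\<rbrakk> \<Longrightarrow> norm (r powr (b - 1) *\<^sub>R R (r + m)) \<le> M * (r powr (b - 1) / (r + m))"
  using mult_left_mono[OF norm_resolvent[of "r + m"], of "r powr (b - 1)"] by (simp add: mult.commute)

lemma dominated_rpow:
  assumes "0 < b" "b < 1" "0 < m"
  shows "dominated (\<lambda>r. r powr (b - 1) *\<^sub>R R (r + m)) (\<lambda>r. M * (r powr (b - 1) / (r + m)))"
  using assms by (intro dominatedI continuous_on_rpow_integrand norm_rpow_integrand)

lemma norm_rpow:
  assumes "0 < b" "b < 1" "0 < m"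
  shows "norm (rpow b m) \<le> M * m powr (b - 1)"
proof -
  have "0 < sin (pi * b)"
    using assms by (intro sin_gt_zero) auto
  then show ?thesis
    using norm_half_integral_stieltjes[OF assms continuous_on_rpow_integrand norm_rpow_integrand] assms
    by (simp add: rpow_def)
qed

lemma rpow_commute:
  assumes b: "0 < b" "b < 1" "0 < m" and T: "\<And>t. 0 < t \<Longrightarrow> T o\<^sub>L R t = R t o\<^sub>L T"
  shows "T o\<^sub>L rpow b m = rpow b m o\<^sub>L T"
proof -
  have "T o\<^sub>L half_integral (\<lambda>r. r powr (b - 1) *\<^sub>R R (r + m)) =
      half_integral (\<lambda>r. T o\<^sub>L (r powr (b - 1) *\<^sub>R R (r + m)))"
    by (rule half_integral_linear[OF dominated_rpow blinfun_compose.bounded_linear_right, symmetric])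
      (use b in auto)
  also have "\<dots> = half_integral (\<lambda>r. (r powr (b - 1) *\<^sub>R R (r + m)) o\<^sub>L T)"
    using b by (intro half_integral_cong) (simp add: T blinfun_compose.scaleR_left blinfun_compose.scaleR_right)
  also have "\<dots> = half_integral (\<lambda>r. r powr (b - 1) *\<^sub>R R (r + m)) o\<^sub>L T"
    by (rule half_integral_linear[OF dominated_rpow blinfun_compose.bounded_linear_left])
      (use b in auto)
  finally show ?thesis
    by (simp add: rpow_def blinfun_compose.scaleR_left blinfun_compose.scaleR_right)
qed

lemma resolvent_commute_compose: "\<lbrakk>0 < s; 0 < t\<rbrakk> \<Longrightarrow> R s o\<^sub>L R t = R t o\<^sub>L R s"
  by (rule blinfun_eqI) (simp add: resolvent_commute)

lemma resolvent_rpow: "\<lbrakk>0 < b; b < 1; 0 < m; 0 < t\<rbrakk> \<Longrightarrow> R t o\<^sub>L rpow b m = rpow b m o\<^sub>L R t"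
  by (intro rpow_commute resolvent_commute_compose)

text \<open>Differentiation under the integral sign. By the resolvent identity the difference
  quotient is exactly minus the weighted integral of \<open>R (r + y n) o\<^sub>L R (r + m)\<close>,
  so only a limit under the integral is left.\<close>

lemma rpow_has_vector_derivative_integral:
  assumes b: "0 < b" "b < 1" and m: "0 < m"
  shows "(rpow b has_vector_derivative
    - ((sin (pi * b) / pi) *\<^sub>R half_integral (\<lambda>r. r powr (b - 1) *\<^sub>R (R (r + m) o\<^sub>L R (r + m))))) (at m)"
proof (rule has_vector_derivative_seqI)
  fix y assume y: "y \<longlonglongrightarrow> m" "\<And>n. y n \<noteq> m"
  define f where "f z = (\<lambda>r. r powr (b - 1) *\<^sub>R (R (r + z) o\<^sub>L R (r + m)))" for z
  define g where "g = (\<lambda>r. (2 * M\<^sup>2 / m) * (r powr (b - 1) / (r + m)))"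
  \<comment> \<open>For \<open>z > m / 2\<close> the first resolvent is bounded by
    \<open>2 * M / m\<close>, which gives one majorant for all such \<open>z\<close>; the second
    supplies the decay in \<open>r\<close>.\<close>
  have dom: "dominated (f z) g" if z: "m / 2 < z" for z
    unfolding g_def
  proof (rule dominatedI[OF b m])
    show "continuous_on {0<..} (f z)"
      unfolding f_def using m z
      by (intro continuous_intros continuous_on_resolvent' blinfun_compose.continuous_on) auto
    fix r :: real assume r: "0 < r"
    have "norm (R (r + z) o\<^sub>L R (r + m)) \<le> M / (r + z) * (M / (r + m))"
      using r z m by (intro norm_resolvent_compose) auto
    also have "M / (r + z) \<le> M / (m / 2)"
      using r z m M_nonneg by (intro divide_left_mono) auto
    then have "M / (r + z) * (M / (r + m)) \<le> M / (m / 2) * (M / (r + m))"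
      using M_nonneg r m by (intro mult_right_mono) auto
    finally have "r powr (b - 1) * norm (R (r + z) o\<^sub>L R (r + m)) \<le> r powr (b - 1) * (M / (m / 2) * (M / (r + m)))"
      by (rule mult_left_mono) simp
    then have "norm (f z r) \<le> r powr (b - 1) * (M / (m / 2) * (M / (r + m)))"
      by (simp add: f_def)
    then show "norm (f z r) \<le> 2 * M\<^sup>2 / m * (r powr (b - 1) / (r + m))"
      by (simp add: power2_eq_square field_simps)
  qed
  have "m / 2 < m"
    using m by simp
  then obtain K where K: "\<And>n. K \<le> n \<Longrightarrow> m / 2 < y n"
    using order_tendstoD(1)[OF y(1) \<open>m / 2 < m\<close>] unfolding eventually_sequentially by blast
  \<comment> \<open>The index is shifted by \<open>K\<close> so that every term, not just almost
    every term, exceeds \<open>m / 2\<close> and has the common majorant.\<close>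
  have "(\<lambda>n. half_integral (f (y (n + K)))) \<longlonglongrightarrow> half_integral (f m)"
  proof (rule half_integral_dominated_convergence)
    show "dominated (f (y (n + K))) g" for n
      by (rule dom[OF K]) simp
    show "dominated (f m) g"
      by (rule dom[OF \<open>m / 2 < m\<close>])
    show "(\<lambda>n. f (y (n + K)) r) \<longlonglongrightarrow> f m r" if "0 < r" for r
    proof -
      have "(\<lambda>n. R (r + y (n + K))) \<longlonglongrightarrow> R (r + m)"
        using that m
        by (intro resolvent_tendsto tendsto_add LIMSEQ_ignore_initial_segment[OF y(1)] tendsto_const) auto
      then show ?thesis
        unfolding f_def by (intro tendsto_scaleR blinfun_compose.tendsto tendsto_const)
    qed
  qed
  then have "(\<lambda>n. half_integral (f (y n))) \<longlonglongrightarrow> half_integral (f m)"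
    by (rule LIMSEQ_offset)
  then have lim: "(\<lambda>n. - ((sin (pi * b) / pi) *\<^sub>R half_integral (f (y n)))) \<longlonglongrightarrow>
      - ((sin (pi * b) / pi) *\<^sub>R half_integral (f m))"
    by (intro tendsto_intros)
  have "\<forall>\<^sub>F n in sequentially. - ((sin (pi * b) / pi) *\<^sub>R half_integral (f (y n))) =
      (rpow b (y n) - rpow b m) /\<^sub>R (y n - m)"
    using order_tendstoD(1)[OF y(1) \<open>m / 2 < m\<close>]
  proof eventually_elim
    case (elim n)
    then have yn: "0 < y n"
      using m by linarith
    have "half_integral (\<lambda>r. r powr (b - 1) *\<^sub>R R (r + y n)) - half_integral (\<lambda>r. r powr (b - 1) *\<^sub>R R (r + m)) =
        half_integral (\<lambda>r. r powr (b - 1) *\<^sub>R R (r + y n) - r powr (b - 1) *\<^sub>R R (r + m))"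
      by (rule half_integral_diff[OF dominated_rpow dominated_rpow, symmetric]) (use b m yn in auto)
    also have "\<dots> = half_integral (\<lambda>r. (m - y n) *\<^sub>R f (y n) r)"
    proof (rule half_integral_cong)
      fix r :: real assume "0 < r"
      then show "r powr (b - 1) *\<^sub>R R (r + y n) - r powr (b - 1) *\<^sub>R R (r + m) = (m - y n) *\<^sub>R f (y n) r"
        using resolvent_eq[of "r + y n" "r + m"] yn m
        by (simp add: f_def mult.commute flip: scaleR_diff_right)
    qed
    also have "\<dots> = (m - y n) *\<^sub>R half_integral (f (y n))"
      by (rule half_integral_linear[OF dom[OF elim] bounded_linear_scaleR_right])
    finally have "(rpow b (y n) - rpow b m) /\<^sub>R (y n - m) =
        ((m - y n) / (y n - m)) *\<^sub>R ((sin (pi * b) / pi) *\<^sub>R half_integral (f (y n)))"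
      by (simp add: rpow_def divide_inverse mult_ac flip: scaleR_diff_right)
    also have "(m - y n) / (y n - m) = - 1"
      using y(2)[of n] by (simp add: field_simps)
    finally show ?case
      by simp
  qed
  with lim show "(\<lambda>n. (rpow b (y n) - rpow b m) /\<^sub>R (y n - m)) \<longlonglongrightarrow>
    - ((sin (pi * b) / pi) *\<^sub>R half_integral (\<lambda>r. r powr (b - 1) *\<^sub>R (R (r + m) o\<^sub>L R (r + m))))"
    unfolding f_def[of m] using tendsto_cong by fast
qed

text \<open>Integration by parts, combined with
  \<open>R m - R (r + m) = r *\<^sub>R (R m o\<^sub>L R (r + m))\<close>, which absorbs the
  derivative of \<open>r powr (b - 1)\<close>.\<close>

lemma half_integral_resolvent_square:
  assumes b: "0 < b" "b < 1" and m: "0 < m"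
  shows "half_integral (\<lambda>r. r powr (b - 1) *\<^sub>R (R (r + m) o\<^sub>L R (r + m))) =
    (1 - b) *\<^sub>R (R m o\<^sub>L half_integral (\<lambda>r. r powr (b - 1) *\<^sub>R R (r + m)))"
proof -
  define f where "f = (\<lambda>r. r powr (b - 1) *\<^sub>R (R (r + m) o\<^sub>L R (r + m)))"
  define h where "h = (\<lambda>r. (1 - b) *\<^sub>R (R m o\<^sub>L (r powr (b - 1) *\<^sub>R R (r + m))))"
  \<comment> \<open>The antiderivative of \<open>R (r + m) o\<^sub>L R (r + m)\<close> is normalised
    to vanish at \<open>r = 0\<close>; this compensates the singularity of
    \<open>r powr (b - 1)\<close> there.\<close>
  define F where "F = (\<lambda>r. r powr (b - 1) *\<^sub>R (R m - R (r + m)))"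
  have domf: "dominated f (\<lambda>r. (M\<^sup>2 / m) * (r powr (b - 1) / (r + m)))"
  proof (rule dominatedI[OF b m])
    show "continuous_on {0<..} f"
      unfolding f_def using m
      by (intro continuous_intros continuous_on_resolvent' blinfun_compose.continuous_on) auto
    fix r :: real assume r: "0 < r"
    have "norm (R (r + m) o\<^sub>L R (r + m)) \<le> M / (r + m) * (M / (r + m))"
      using r m by (intro norm_resolvent_compose) auto
    also have "M / (r + m) \<le> M / m"
      using r m M_nonneg by (intro divide_left_mono) auto
    then have "M / (r + m) * (M / (r + m)) \<le> M / m * (M / (r + m))"
      using M_nonneg r m by (intro mult_right_mono) auto
    finally have "r powr (b - 1) * norm (R (r + m) o\<^sub>L R (r + m)) \<le> r powr (b - 1) * (M / m * (M / (r + m)))"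
      by (rule mult_left_mono) simp
    then have "norm (f r) \<le> r powr (b - 1) * (M / m * (M / (r + m)))"
      by (simp add: f_def)
    then show "norm (f r) \<le> M\<^sup>2 / m * (r powr (b - 1) / (r + m))"
      by (simp add: power2_eq_square field_simps)
  qed
  have lin: "bounded_linear (\<lambda>x. (1 - b) *\<^sub>R (R m o\<^sub>L x))"
    by (intro bounded_linear_const_scaleR blinfun_compose.bounded_linear_right)
  have F_eq: "F r = r powr b *\<^sub>R (R m o\<^sub>L R (r + m))" if "0 < r" for r
    using resolvent_eq[of m "r + m"] that m powr_mult_base[of r "b - 1"]
    by (simp add: F_def mult.commute)
  have "half_integral (\<lambda>r. f r - h r) = 0"
  proof (rule half_integral_derivative[where F = F])
    fix r :: real assume r: "0 < r"
    have "((\<lambda>r. r + m) has_vector_derivative 1) (at r)"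
      unfolding has_real_derivative_iff_has_vector_derivative[symmetric]
      by (auto intro!: derivative_eq_intros)
    then have "((\<lambda>r. R (r + m)) has_vector_derivative - (R (r + m) o\<^sub>L R (r + m))) (at r)"
      using vector_diff_chain_at[of "\<lambda>r. r + m" 1 r R "- (R (r + m) o\<^sub>L R (r + m))"]
        resolvent_has_vector_derivative[of "r + m"] r m
      by (simp add: comp_def)
    moreover have "((\<lambda>r. r powr (b - 1)) has_real_derivative (b - 1) * r powr (b - 1 - 1)) (at r)"
      by (rule has_real_derivative_powr[OF r])
    ultimately have "(F has_vector_derivative r powr (b - 1) *\<^sub>R (R (r + m) o\<^sub>L R (r + m)) +
        ((b - 1) * r powr (b - 1 - 1)) *\<^sub>R (R m - R (r + m))) (at r)"
      unfolding F_def
      using has_vector_derivative_scaleR[OF _ has_vector_derivative_diff[OF has_vector_derivative_const[of "R m"]],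
          of "\<lambda>r. r powr (b - 1)" "(b - 1) * r powr (b - 1 - 1)" r UNIV "\<lambda>r. R (r + m)"
          "- (R (r + m) o\<^sub>L R (r + m))"]
      by simp
    also have "((b - 1) * r powr (b - 1 - 1)) *\<^sub>R (R m - R (r + m)) = - h r"
    proof -
      have "R m - R (r + m) = r *\<^sub>R (R m o\<^sub>L R (r + m))"
        using resolvent_eq[of m "r + m"] r m by simp
      moreover have "r powr (b - 1 - 1) * r = r powr (b - 1)"
        using powr_mult_base[of r "b - 1 - 1"] r by (simp add: mult.commute)
      ultimately show ?thesis
        by (simp add: h_def blinfun_compose.scaleR_right mult.assoc flip: scaleR_minus_left)
          (simp add: algebra_simps)
    qed
    finally show "(F has_vector_derivative f r - h r) (at r)"
      by (simp add: f_def)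
  next
    have "\<forall>\<^sub>F r in at_right 0. norm (F r) \<le> r powr b * (M / m * (M / m))"
    proof (rule eventually_at_right_less[THEN eventually_mono])
      fix r :: real assume r: "0 < r"
      have "norm (R m o\<^sub>L R (r + m)) \<le> M / m * (M / (r + m))"
        using r m by (intro norm_resolvent_compose) auto
      also have "\<dots> \<le> M / m * (M / m)"
        using r m M_nonneg by (intro mult_left_mono divide_left_mono) auto
      finally have "r powr b * norm (R m o\<^sub>L R (r + m)) \<le> r powr b * (M / m * (M / m))"
        by (rule mult_left_mono) simp
      then show "norm (F r) \<le> r powr b * (M / m * (M / m))"
        using F_eq[OF r] by simp
    qed
    moreover have "((\<lambda>r::real. r powr b * (M / m * (M / m))) \<longlongrightarrow> 0 * (M / m * (M / m))) (at_right 0)"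
    proof (intro tendsto_mult tendsto_const tendsto_zero_powrI)
      show "((\<lambda>r::real. r) \<longlongrightarrow> 0) (at_right 0)"
        by (rule tendsto_ident_at)
      show "\<forall>\<^sub>F r in at_right 0. (0::real) \<le> r"
        by (rule eventually_at_right_less[THEN eventually_mono]) simp
    qed (rule tendsto_const b)+
    ultimately show "(F \<longlongrightarrow> 0) (at_right 0)"
      by (rule Lim_null_comparison[OF _ tendsto_eq_rhs]) simp
    have "\<forall>\<^sub>F r in at_top. norm (F r) \<le> r powr (b - 1) * (M / m + M / m)"
    proof (rule eventually_gt_at_top[of 0, THEN eventually_mono])
      fix r :: real assume r: "0 < r"
      have "M / (r + m) \<le> M / m"
        using r m M_nonneg by (intro divide_left_mono) auto
      then have "norm (R m - R (r + m)) \<le> M / m + M / m"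
        using norm_triangle_ineq4[of "R m" "R (r + m)"] norm_resolvent[of m] norm_resolvent[of "r + m"] r m
        by linarith
      from mult_left_mono[OF this, of "r powr (b - 1)"]
      show "norm (F r) \<le> r powr (b - 1) * (M / m + M / m)"
        by (simp add: F_def)
    qed
    moreover have "((\<lambda>r::real. r powr (b - 1) * (M / m + M / m)) \<longlongrightarrow> 0 * (M / m + M / m)) at_top"
      by (intro tendsto_mult tendsto_const tendsto_neg_powr filterlim_ident) (use b in auto)
    ultimately show "(F \<longlongrightarrow> 0) at_top"
      by (rule Lim_null_comparison[OF _ tendsto_eq_rhs]) simp
  qed
  moreover obtain K where "dominated h (\<lambda>r. K * (M * (r powr (b - 1) / (r + m))))"
    using dominated_linear[OF dominated_rpow lin, of b m] b m unfolding h_def by auto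
  ultimately have "half_integral f = half_integral h"
    using half_integral_diff[OF domf] by simp
  also have "\<dots> = (1 - b) *\<^sub>R (R m o\<^sub>L half_integral (\<lambda>r. r powr (b - 1) *\<^sub>R R (r + m)))"
    unfolding h_def by (rule half_integral_linear[OF dominated_rpow lin]) (use b m in auto)
  finally show ?thesis
    by (simp add: f_def)
qed

text \<open>The power rule: the derivative of \<open>(m + A) powr c\<close> is
  \<open>c (m + A) powr (c - 1)\<close>, for \<open>c = b - 1\<close>.\<close>

lemma rpow_has_vector_derivative:
  assumes "0 < b" "b < 1" "0 < m"
  shows "(rpow b has_vector_derivative (b - 1) *\<^sub>R (R m o\<^sub>L rpow b m)) (at m)"
proof -
  let ?I = "half_integral (\<lambda>r. r powr (b - 1) *\<^sub>R R (r + m))"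
  have "- ((sin (pi * b) / pi) *\<^sub>R ((1 - b) *\<^sub>R (R m o\<^sub>L ?I))) = (b - 1) *\<^sub>R (R m o\<^sub>L rpow b m)"
    unfolding rpow_def blinfun_compose.scaleR_right scaleR_scaleR scaleR_minus_left[symmetric]
    by (rule arg_cong[where f = "\<lambda>c. c *\<^sub>R _"]) (simp add: field_simps)
  then show ?thesis
    using rpow_has_vector_derivative_integral[OF assms]
    unfolding half_integral_resolvent_square[OF assms] by simp
qed

section \<open>Behaviour for large shifts and the semigroup law\<close>

text \<open>The initial condition at infinity for \<open>ode_unique\<close>. The factor
  \<open>R 1\<close> is there because for unbounded \<open>A\<close> a rate for
  \<open>(m + A) powr e\<close> near \<open>m powr e\<close> can be expected only on regularised
  vectors.\<close>

definition power_asymptotics :: "real \<Rightarrow> (real \<Rightarrow> 'a \<Rightarrow>\<^sub>L 'a) \<Rightarrow> bool" where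
  "power_asymptotics e W \<longleftrightarrow>
     (\<exists>K. \<forall>m\<ge>1. norm ((W m o\<^sub>L R 1) - m powr e *\<^sub>R R 1) \<le> K * m powr (e - 1))"

text \<open>The difference is \<open>- (1 / t) (t + A)\<^sup>-\<^sup>1 A R 1\<close>, where
  \<open>A R 1 = 1 - R 1\<close> is bounded; the explicit factor and the resolvent contribute
  \<open>1 / t\<close> each.\<close>

lemma norm_resolvent_minus_inverse:
  assumes "0 < t"
  shows "norm ((R t o\<^sub>L R 1) - (1 / t) *\<^sub>R R 1) \<le> M * (1 + M) / t * (1 / t)"
proof -
  have "R t - R 1 = (1 - t) *\<^sub>R (R t o\<^sub>L R 1)"
    using resolvent_eq[of t 1] assms by simp
  then have "R 1 = R t - (R t o\<^sub>L R 1) + t *\<^sub>R (R t o\<^sub>L R 1)"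
    by (simp add: algebra_simps)
  from arg_cong[OF this, of "scaleR (1 / t)"]
  have "(1 / t) *\<^sub>R R 1 = (1 / t) *\<^sub>R (R t - (R t o\<^sub>L R 1)) + (R t o\<^sub>L R 1)"
    using assms by (simp add: scaleR_add_right)
  then have "(R t o\<^sub>L R 1) - (1 / t) *\<^sub>R R 1 = - ((1 / t) *\<^sub>R (R t - (R t o\<^sub>L R 1)))"
    by simp
  then have "norm ((R t o\<^sub>L R 1) - (1 / t) *\<^sub>R R 1) = (1 / t) * norm (R t - (R t o\<^sub>L R 1))"
    using assms by simp
  also have "\<dots> \<le> (1 / t) * (M / t + M / t * (M / 1))"
    using assms by (intro mult_left_mono order_trans[OF norm_triangle_ineq4] add_mono
        norm_resolvent norm_resolvent_compose) auto
  also have "M / t + M / t * (M / 1) = M * (1 + M) / t"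
    by (simp add: add_divide_distrib distrib_left)
  also have "1 / t * (M * (1 + M) / t) = M * (1 + M) / t * (1 / t)"
    by (rule mult.commute)
  finally show ?thesis .
qed

lemma power_asymptotics_resolvent: "power_asymptotics (- 1) R"
  unfolding power_asymptotics_def
proof (intro exI allI impI)
  fix m :: real assume m: "1 \<le> m"
  have "m powr (- 1 - 1) = 1 / m * (1 / m)"
    using m powr_add[of m "- 1" "- 1"] by (simp add: powr_minus_divide)
  then show "norm ((R m o\<^sub>L R 1) - m powr (- 1) *\<^sub>R R 1) \<le> (M * (1 + M)) * m powr (- 1 - 1)"
    using norm_resolvent_minus_inverse[of m] m by (simp add: powr_minus_divide)
qed

text \<open>With the scalar \<open>1 / (r + m)\<close> in place of \<open>R (r + m)\<close> the
  integral is exactly \<open>m powr (b - 1)\<close>; the preceding estimate bounds the error under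
  the integral.\<close>

lemma power_asymptotics_rpow:
  assumes b: "0 < b" "b < 1"
  shows "power_asymptotics (b - 1) (rpow b)"
  unfolding power_asymptotics_def
proof (intro exI allI impI)
  fix m :: real assume m1: "1 \<le> m"
  then have m: "0 < m"
    by simp
  define c where "c = sin (pi * b) / pi"
  have c: "0 < c"
    using b by (auto simp: c_def intro!: divide_pos_pos sin_gt_zero)
  define f where "f = (\<lambda>r. (r powr (b - 1) *\<^sub>R R (r + m)) o\<^sub>L R 1)"
  define h where "h = (\<lambda>r. (r powr (b - 1) / (r + m)) *\<^sub>R R 1)"
  obtain K where K: "dominated f (\<lambda>r. K * (M * (r powr (b - 1) / (r + m))))"
    using dominated_linear[OF dominated_rpow[OF b m]
        blinfun_compose.bounded_linear_left[of "R 1"]] unfolding f_def by blast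
  have H: "dominated h (\<lambda>r. norm (R 1) * (r powr (b - 1) / (r + m)))"
    unfolding h_def by (rule dominatedI[OF b m])
      (use m in \<open>auto intro!: continuous_intros simp: mult.commute\<close>)
  have "half_integral f = half_integral (\<lambda>r. r powr (b - 1) *\<^sub>R R (r + m)) o\<^sub>L R 1"
    unfolding f_def
    by (rule half_integral_linear[OF dominated_rpow[OF b m] blinfun_compose.bounded_linear_left])
  then have "rpow b m o\<^sub>L R 1 = c *\<^sub>R half_integral f"
    by (simp add: rpow_def c_def blinfun_compose.scaleR_left)
  moreover have "m powr (b - 1) *\<^sub>R R 1 = c *\<^sub>R half_integral h"
    unfolding h_def c_def using half_integral_stieltjes_kernel[OF b m, of "R 1"] by simp
  ultimately have "(rpow b m o\<^sub>L R 1) - m powr (b - 1) *\<^sub>R R 1 = c *\<^sub>R half_integral (\<lambda>r. f r - h r)"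
    unfolding half_integral_diff[OF K H] by (simp add: scaleR_diff_right)
  then have "norm ((rpow b m o\<^sub>L R 1) - m powr (b - 1) *\<^sub>R R 1) = c * norm (half_integral (\<lambda>r. f r - h r))"
    using c by simp
  also have "\<dots> \<le> (M * (1 + M) / m) * m powr (b - 1)"
    unfolding c_def
  proof (rule norm_half_integral_stieltjes[OF b m])
    show "continuous_on {0<..} (\<lambda>r. f r - h r)"
      using K H by (auto simp: dominated_def intro!: continuous_intros)
    fix r :: real assume r: "0 < r"
    have "f r - h r = r powr (b - 1) *\<^sub>R ((R (r + m) o\<^sub>L R 1) - (1 / (r + m)) *\<^sub>R R 1)"
      by (simp add: f_def h_def blinfun_compose.scaleR_left scaleR_diff_right)
    then have "norm (f r - h r) = r powr (b - 1) * norm ((R (r + m) o\<^sub>L R 1) - (1 / (r + m)) *\<^sub>R R 1)"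
      by simp
    also have "\<dots> \<le> r powr (b - 1) * (M * (1 + M) / m * (1 / (r + m)))"
    proof (rule mult_left_mono)
      \<comment> \<open>One factor \<open>1 / (r + m)\<close> is weakened to \<open>1 / m\<close>,
        the gain in the rate; the other is kept to form the integrable kernel.\<close>
      have "M * (1 + M) / (r + m) * (1 / (r + m)) \<le> M * (1 + M) / m * (1 / (r + m))"
        using r m M_nonneg by (intro mult_right_mono divide_left_mono) auto
      then show "norm ((R (r + m) o\<^sub>L R 1) - (1 / (r + m)) *\<^sub>R R 1) \<le> M * (1 + M) / m * (1 / (r + m))"
        using norm_resolvent_minus_inverse[of "r + m"] r m by linarith
    qed simp
    finally show "norm (f r - h r) \<le> M * (1 + M) / m * (r powr (b - 1) / (r + m))"
      by (simp add: mult_ac)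
  qed
  also have "M * (1 + M) / m * m powr (b - 1) = M * (1 + M) * m powr (b - 1 - 1)"
    using m powr_add[of m "b - 1" "- 1"] by (simp add: powr_minus_divide)
  finally show "norm ((rpow b m o\<^sub>L R 1) - m powr (b - 1) *\<^sub>R R 1) \<le> M * (1 + M) * m powr (b - 1 - 1)" .
qed

lemma power_asymptotics_compose:
  assumes b: "0 < b" "b < 1" and W: "power_asymptotics e W"
  shows "power_asymptotics (b - 1 + e) (\<lambda>m. rpow b m o\<^sub>L W m)"
proof -
  obtain K where K: "\<And>m. 1 \<le> m \<Longrightarrow> norm ((W m o\<^sub>L R 1) - m powr e *\<^sub>R R 1) \<le> K * m powr (e - 1)"
    using W unfolding power_asymptotics_def by blast
  obtain L where L: "\<And>m. 1 \<le> m \<Longrightarrow> norm ((rpow b m o\<^sub>L R 1) - m powr (b - 1) *\<^sub>R R 1) \<le> L * m powr (b - 1 - 1)"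
    using power_asymptotics_rpow[OF b] unfolding power_asymptotics_def by blast
  show ?thesis
    unfolding power_asymptotics_def
  proof (intro exI allI impI)
    fix m :: real assume m: "1 \<le> m"
    \<comment> \<open>Adding and subtracting \<open>m powr e\<close> times
      \<open>rpow b m o\<^sub>L R 1\<close> leaves two errors, one damped by
      \<open>norm_rpow\<close>, the other by the scalar factor.\<close>
    have "((rpow b m o\<^sub>L W m) o\<^sub>L R 1) - m powr (b - 1 + e) *\<^sub>R R 1 =
        (rpow b m o\<^sub>L ((W m o\<^sub>L R 1) - m powr e *\<^sub>R R 1)) +
        m powr e *\<^sub>R ((rpow b m o\<^sub>L R 1) - m powr (b - 1) *\<^sub>R R 1)"
      by (simp add: blinfun_compose.diff_right blinfun_compose.scaleR_right blinfun_compose_assoc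
          scaleR_diff_right powr_add mult.commute)
    also have "norm \<dots> \<le> (M * m powr (b - 1)) * (K * m powr (e - 1)) +
        m powr e * (L * m powr (b - 1 - 1))"
    proof (intro order_trans[OF norm_triangle_ineq] add_mono)
      show "norm (rpow b m o\<^sub>L ((W m o\<^sub>L R 1) - m powr e *\<^sub>R R 1)) \<le> (M * m powr (b - 1)) * (K * m powr (e - 1))"
        using b m M_nonneg by (intro order_trans[OF norm_blinfun_compose] mult_mono norm_rpow K) auto
      show "norm (m powr e *\<^sub>R ((rpow b m o\<^sub>L R 1) - m powr (b - 1) *\<^sub>R R 1)) \<le> m powr e * (L * m powr (b - 1 - 1))"
        using mult_left_mono[OF L[OF m], of "m powr e"] by simp
    qed
    also have "\<dots> = M * K * (m powr (b - 1) * m powr (e - 1)) + L * (m powr e * m powr (b - 1 - 1))"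
      by (simp only: mult_ac)
    also have "\<dots> = M * K * m powr (b - 1 + e - 1) + L * m powr (b - 1 + e - 1)"
      unfolding powr_add[symmetric] by (simp add: algebra_simps)
    also have "\<dots> = (M * K + L) * m powr (b - 1 + e - 1)"
      by (simp add: distrib_right)
    finally show "norm (((rpow b m o\<^sub>L W m) o\<^sub>L R 1) - m powr (b - 1 + e) *\<^sub>R R 1)
      \<le> (M * K + L) * m powr (b - 1 + e - 1)" .
  qed
qed

text \<open>Both families solve \<open>V' = - R V\<close>. For a solution \<open>V\<close>, \<open>(m + A) R(n) V(m)\<close> does not depend
  on \<open>m\<close>; it equals \<open>V(n)\<close> at \<open>m = n\<close> and the asymptotics determine its limit as \<open>m\<close> grows.\<close>

lemma ode_unique:
  assumes V: "\<And>m. 0 < m \<Longrightarrow> (V has_vector_derivative - (R m o\<^sub>L V m)) (at m)" "power_asymptotics (- 1) V"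
    and W: "\<And>m. 0 < m \<Longrightarrow> (W has_vector_derivative - (R m o\<^sub>L W m)) (at m)" "power_asymptotics (- 1) W"
    and com: "\<And>m. 0 < m \<Longrightarrow> R 1 o\<^sub>L V m = V m o\<^sub>L R 1" "\<And>m. 0 < m \<Longrightarrow> R 1 o\<^sub>L W m = W m o\<^sub>L R 1"
    and n: "0 < n"
  shows "V n = W n"
proof -
  define S where "S m = V m - W m" for m
  \<comment> \<open>Since \<open>(m + A) R n = 1 + (m - n) R n\<close>, the conserved quantity can
    be written without \<open>A\<close>.\<close>
  define h where "h m = S m + (m - n) *\<^sub>R (R n o\<^sub>L S m)" for m
  have dS: "(S has_vector_derivative - (R m o\<^sub>L S m)) (at m)" if "0 < m" for m
    unfolding S_def using has_vector_derivative_diff[OF V(1)[OF that] W(1)[OF that]]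
    by (simp add: blinfun_compose.diff_right)
  have dh: "(h has_vector_derivative 0) (at m within {0<..})" if m: "m \<in> {0<..}" for m
  proof -
    have "0 < m"
      using m by simp
    have "((\<lambda>m. m - n) has_real_derivative 1) (at m)"
      by (auto intro!: derivative_eq_intros)
    moreover have "((\<lambda>m. R n o\<^sub>L S m) has_vector_derivative R n o\<^sub>L - (R m o\<^sub>L S m)) (at m)"
      by (rule bounded_linear.has_vector_derivative[OF blinfun_compose.bounded_linear_right dS[OF \<open>0 < m\<close>]])
    ultimately have "((\<lambda>m. (m - n) *\<^sub>R (R n o\<^sub>L S m)) has_vector_derivative
        (m - n) *\<^sub>R (R n o\<^sub>L - (R m o\<^sub>L S m)) + 1 *\<^sub>R (R n o\<^sub>L S m)) (at m)"
      by (rule has_vector_derivative_scaleR)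
    then have "(h has_vector_derivative - (R m o\<^sub>L S m) +
        ((m - n) *\<^sub>R (R n o\<^sub>L - (R m o\<^sub>L S m)) + 1 *\<^sub>R (R n o\<^sub>L S m))) (at m)"
      unfolding h_def by (intro has_vector_derivative_add dS \<open>0 < m\<close>)
    also have "- (R m o\<^sub>L S m) + ((m - n) *\<^sub>R (R n o\<^sub>L - (R m o\<^sub>L S m)) + 1 *\<^sub>R (R n o\<^sub>L S m)) =
        ((R n - R m) - (m - n) *\<^sub>R (R n o\<^sub>L R m)) o\<^sub>L S m"
      by (simp add: blinfun_compose.diff_left blinfun_compose.minus_right blinfun_compose.scaleR_left
          blinfun_compose_assoc)
    also have "\<dots> = 0"
      using resolvent_eq[OF n \<open>0 < m\<close>] by simp
    finally show ?thesis
      by (rule has_vector_derivative_at_within)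
  qed
  obtain c where "\<And>m. m \<in> {0<..} \<Longrightarrow> h m = c"
    using has_vector_derivative_zero_constant[OF _ dh] convex_real_interval by blast
  then have h_const: "h m = S n" if "0 < m" for m
    using that n by (metis add.right_neutral diff_self greaterThan_iff h_def scaleR_zero_left)
  obtain K where K: "\<And>m. 1 \<le> m \<Longrightarrow> norm ((V m o\<^sub>L R 1) - m powr (- 1) *\<^sub>R R 1) \<le> K * m powr (- 1 - 1)"
    using V(2) unfolding power_asymptotics_def by blast
  obtain L where L: "\<And>m. 1 \<le> m \<Longrightarrow> norm ((W m o\<^sub>L R 1) - m powr (- 1) *\<^sub>R R 1) \<le> L * m powr (- 1 - 1)"
    using W(2) unfolding power_asymptotics_def by blast
  have bound: "norm (S m o\<^sub>L R 1) \<le> (K + L) * m powr (- 2)" if m: "1 \<le> m" for m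
  proof -
    have "S m o\<^sub>L R 1 = ((V m o\<^sub>L R 1) - m powr (- 1) *\<^sub>R R 1) - ((W m o\<^sub>L R 1) - m powr (- 1) *\<^sub>R R 1)"
      by (simp add: S_def blinfun_compose.diff_left)
    also have "norm \<dots> \<le> K * m powr (- 1 - 1) + L * m powr (- 1 - 1)"
      by (intro order_trans[OF norm_triangle_ineq4] add_mono K L m)
    finally show ?thesis
      by (simp add: distrib_right)
  qed
  \<comment> \<open>An error of order \<open>m powr (- 2)\<close> survives multiplication by the
    factor \<open>m - n\<close> in \<open>h\<close>; the constant value \<open>S n\<close>, composed
    with \<open>R 1\<close>, is therefore 0.\<close>
  have "norm (S n o\<^sub>L R 1) \<le> (K + L) * m powr (- 2) + m * norm (R n) * ((K + L) * m powr (- 2))"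
    if m: "max 1 n \<le> m" for m
  proof -
    have "S n o\<^sub>L R 1 = h m o\<^sub>L R 1"
      using h_const[of m] m by simp
    also have "\<dots> = (S m o\<^sub>L R 1) + (m - n) *\<^sub>R (R n o\<^sub>L (S m o\<^sub>L R 1))"
      by (simp add: h_def blinfun_compose.add_left blinfun_compose.scaleR_left blinfun_compose_assoc)
    also have "norm \<dots> \<le> (K + L) * m powr (- 2) + m * norm (R n) * ((K + L) * m powr (- 2))"
    proof (intro order_trans[OF norm_triangle_ineq] add_mono)
      have "norm ((m - n) *\<^sub>R (R n o\<^sub>L (S m o\<^sub>L R 1))) \<le> (m - n) * (norm (R n) * norm (S m o\<^sub>L R 1))"
        using m by (auto intro: mult_left_mono norm_blinfun_compose)
      also have "\<dots> \<le> m * (norm (R n) * ((K + L) * m powr (- 2)))"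
        using m n bound[of m] by (intro mult_mono) auto
      finally show "norm ((m - n) *\<^sub>R (R n o\<^sub>L (S m o\<^sub>L R 1))) \<le> m * norm (R n) * ((K + L) * m powr (- 2))"
        by (simp add: mult.assoc)
    qed (use bound m in auto)
    finally show ?thesis .
  qed
  moreover have "((\<lambda>m. (K + L) * m powr (- 2) + m * norm (R n) * ((K + L) * m powr (- 2))) \<longlongrightarrow> 0) at_top"
  proof -
    have "((\<lambda>m. (K + L) * m powr (- 2) + norm (R n) * (K + L) * m powr (- 1)) \<longlongrightarrow>
        (K + L) * 0 + norm (R n) * (K + L) * 0) at_top"
      by (intro tendsto_add tendsto_mult tendsto_const tendsto_neg_powr filterlim_ident) auto
    moreover have "\<forall>\<^sub>F m in at_top. (K + L) * m powr (- 2) + norm (R n) * (K + L) * m powr (- 1) =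
        (K + L) * m powr (- 2) + m * norm (R n) * ((K + L) * m powr (- 2))"
    proof (rule eventually_gt_at_top[of 0, THEN eventually_mono])
      fix m :: real assume "0 < m"
      then have "m powr (- 1) = m * m powr (- 2)"
        using powr_mult_base[of m "- 2"] by simp
      then show "(K + L) * m powr (- 2) + norm (R n) * (K + L) * m powr (- 1) =
          (K + L) * m powr (- 2) + m * norm (R n) * ((K + L) * m powr (- 2))"
        by (simp add: algebra_simps)
    qed
    ultimately show ?thesis
      using tendsto_cong by fastforce
  qed
  ultimately have "norm (S n o\<^sub>L R 1) \<le> 0"
    by (intro tendsto_lowerbound[of _ 0 at_top]) (auto intro: eventually_mono[OF eventually_ge_at_top[of "max 1 n"]])
  then have *: "S n o\<^sub>L R 1 = 0"
    by simp
  \<comment> \<open>Commutation moves \<open>R 1\<close> to the left, where its injectivity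
    applies.\<close>
  have "R 1 (S n x) = (S n o\<^sub>L R 1) x" for x
    using com[OF n] by (simp add: S_def blinfun.diff_left blinfun.diff_right)
      (metis blinfun_apply_blinfun_compose)
  then have "S n x = 0" for x
    using * resolvent_inj[of 1 "S n x"] by simp
  then have "S n = 0"
    by (intro blinfun_eqI) simp
  then show ?thesis
    by (simp add: S_def)
qed

lemma resolvent_commutes_compose:
  assumes "R t o\<^sub>L V = V o\<^sub>L R t" "R t o\<^sub>L W = W o\<^sub>L R t"
  shows "R t o\<^sub>L (V o\<^sub>L W) = (V o\<^sub>L W) o\<^sub>L R t"
  using assms by (metis blinfun_compose_assoc)

lemma rpow_compose_has_vector_derivative:
  assumes b: "0 < b" "b < 1" and m: "0 < m"
    and W: "(W has_vector_derivative k *\<^sub>R (R m o\<^sub>L W m)) (at m)"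
  shows "((\<lambda>m. rpow b m o\<^sub>L W m) has_vector_derivative (b - 1 + k) *\<^sub>R (R m o\<^sub>L (rpow b m o\<^sub>L W m))) (at m)"
proof -
  have "((\<lambda>m. rpow b m o\<^sub>L W m) has_vector_derivative
      (rpow b m o\<^sub>L (k *\<^sub>R (R m o\<^sub>L W m))) + (((b - 1) *\<^sub>R (R m o\<^sub>L rpow b m)) o\<^sub>L W m)) (at m)"
    by (rule bounded_bilinear.has_vector_derivative[OF bounded_bilinear_blinfun_compose
          rpow_has_vector_derivative[OF b m] W])
  moreover have "rpow b m o\<^sub>L (R m o\<^sub>L W m) = R m o\<^sub>L (rpow b m o\<^sub>L W m)"
    using resolvent_rpow[OF b m m] by (metis blinfun_compose_assoc)
  ultimately show ?thesis
    by (simp add: blinfun_compose.scaleR_left blinfun_compose.scaleR_right blinfun_compose_assoc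
        scaleR_left_distrib add.commute)
qed

text \<open>The exponents \<open>a - 1\<close> and \<open>- a\<close> add up to -1, so both sides
  solve the equation of \<open>ode_unique\<close>.\<close>

lemma rpow_complement:
  assumes a: "0 < a" "a < 1" and n: "0 < n"
  shows "rpow a n o\<^sub>L rpow (1 - a) n = R n"
proof (rule ode_unique[of "\<lambda>m. rpow a m o\<^sub>L rpow (1 - a) m" R])
  have b: "0 < 1 - a" "1 - a < 1"
    using a by auto
  show "((\<lambda>m. rpow a m o\<^sub>L rpow (1 - a) m) has_vector_derivative
      - (R m o\<^sub>L (rpow a m o\<^sub>L rpow (1 - a) m))) (at m)" if "0 < m" for m
    using rpow_compose_has_vector_derivative[OF a that rpow_has_vector_derivative[OF b that]] by simp
  show "power_asymptotics (- 1) (\<lambda>m. rpow a m o\<^sub>L rpow (1 - a) m)"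
    using power_asymptotics_compose[OF a power_asymptotics_rpow[OF b]] by simp
  show "R 1 o\<^sub>L (rpow a m o\<^sub>L rpow (1 - a) m) = rpow a m o\<^sub>L rpow (1 - a) m o\<^sub>L R 1" if "0 < m" for m
    using a b that by (intro resolvent_commutes_compose resolvent_rpow) auto
qed (auto intro: resolvent_has_vector_derivative power_asymptotics_resolvent resolvent_commute_compose n)

lemma rpow_compose:
  assumes a: "0 < a" "a < 1" and b: "0 < b" "b < 1" and ab: "1 < a + b" and n: "0 < n"
  shows "rpow a n o\<^sub>L rpow b n = rpow (a + b - 1) n"
proof -
  \<comment> \<open>Chosen so that \<open>(a - 1) + (b - 1) + (d - 1) = - 1\<close>, where
    \<open>ode_unique\<close> applies. The auxiliary factor is then cancelled by its complement
    \<open>rpow (1 - d) n\<close>, and \<open>1 - d = a + b - 1\<close>.\<close>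
  define d where "d = 2 - a - b"
  have d: "0 < d" "d < 1" "0 < 1 - d" "1 - d < 1"
    using a b ab by (auto simp: d_def)
  have eq: "rpow d n o\<^sub>L (rpow a n o\<^sub>L rpow b n) = R n"
  proof (rule ode_unique[of "\<lambda>m. rpow d m o\<^sub>L (rpow a m o\<^sub>L rpow b m)" R])
    show "((\<lambda>m. rpow d m o\<^sub>L (rpow a m o\<^sub>L rpow b m)) has_vector_derivative
        - (R m o\<^sub>L (rpow d m o\<^sub>L (rpow a m o\<^sub>L rpow b m)))) (at m)" if "0 < m" for m
      using rpow_compose_has_vector_derivative[OF d(1,2) that
          rpow_compose_has_vector_derivative[OF a that rpow_has_vector_derivative[OF b that]]]
      by (simp add: d_def)
    show "power_asymptotics (- 1) (\<lambda>m. rpow d m o\<^sub>L (rpow a m o\<^sub>L rpow b m))"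
      using power_asymptotics_compose[OF d(1,2) power_asymptotics_compose[OF a power_asymptotics_rpow[OF b]]]
      by (simp add: d_def)
    show "R 1 o\<^sub>L (rpow d m o\<^sub>L (rpow a m o\<^sub>L rpow b m)) = rpow d m o\<^sub>L (rpow a m o\<^sub>L rpow b m) o\<^sub>L R 1"
      if "0 < m" for m
      using a b d that by (intro resolvent_commutes_compose resolvent_rpow) auto
  qed (auto intro: resolvent_has_vector_derivative power_asymptotics_resolvent resolvent_commute_compose n)
  show ?thesis
  proof (rule blinfun_eqI)
    fix x
    have sym: "rpow d n (rpow (1 - d) n y) = R n y" "rpow (1 - d) n (rpow d n y) = R n y" for y
      using rpow_complement[OF d(1,2) n] rpow_complement[OF d(3,4) n]
      by (metis blinfun_apply_blinfun_compose diff_diff_eq2 add_diff_cancel_left')+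
    have "rpow d n (rpow a n (rpow b n x)) = R n x"
      using eq by (metis blinfun_apply_blinfun_compose)
    then have "rpow d n (rpow a n (rpow b n x) - rpow (1 - d) n x) = 0"
      using sym(1) by (simp add: blinfun.diff_right)
    then have "R n (rpow a n (rpow b n x) - rpow (1 - d) n x) = 0"
      by (metis sym(2) blinfun.zero_right)
    then show "(rpow a n o\<^sub>L rpow b n) x = rpow (a + b - 1) n x"
      using resolvent_inj[OF n, of "rpow a n (rpow b n x) - rpow (1 - d) n x"]
      by (simp add: d_def algebra_simps)
  qed
qed

text \<open>The total exponent \<open>a + b - 2\<close> lies below -1, outside the range of
  \<open>rpow\<close>, so a full resolvent is split off.\<close>

lemma rpow_compose':
  assumes a: "0 < a" and b: "0 < b" and ab: "a + b < 1" and n: "0 < n"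
  shows "rpow a n o\<^sub>L rpow b n = R n o\<^sub>L rpow (a + b) n"
proof -
  have "rpow (1 - a) n o\<^sub>L rpow (a + b) n = rpow b n"
    using rpow_compose[of "1 - a" "a + b" n] assms by simp
  then have "rpow a n o\<^sub>L rpow b n = (rpow a n o\<^sub>L rpow (1 - a) n) o\<^sub>L rpow (a + b) n"
    by (simp add: blinfun_compose_assoc)
  then show ?thesis
    using rpow_complement[of a n] assms by simp
qed

section \<open>Positive powers regularised by the resolvent at 1\<close>

text \<open>For the family of \<open>A\<close>, these are \<open>A (1 + A)\<^sup>-\<^sup>1\<close>, \<open>A\<^sup>b (1 + A)\<^sup>-\<^sup>1\<close> and
  \<open>(m + A)\<^sup>b (1 + A)\<^sup>-\<^sup>1\<close>.\<close>

definition cores :: "'a \<Rightarrow>\<^sub>L 'a" where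
  "cores = id_blinfun - R 1"

definition apow :: "real \<Rightarrow> 'a \<Rightarrow>\<^sub>L 'a" where
  "apow b = (sin (pi * b) / pi) *\<^sub>R half_integral (\<lambda>r. r powr (b - 1) *\<^sub>R (R r o\<^sub>L cores))"

definition apow_shift :: "real \<Rightarrow> real \<Rightarrow> 'a \<Rightarrow>\<^sub>L 'a" where
  "apow_shift b m = rpow b m o\<^sub>L (cores + m *\<^sub>R R 1)"

lemma cores_apply: "cores x = x - R 1 x"
  by (simp add: cores_def blinfun.diff_left)

text \<open>As \<open>cores + m *\<^sub>R R 1\<close> is \<open>(m + A) R 1\<close>, this is
  \<open>(r + m + A)\<^sup>-\<^sup>1 (m + A) = 1 - r (r + m + A)\<^sup>-\<^sup>1\<close>,
  regularised.\<close>

lemma resolvent_cores_shift: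
  assumes "0 < r + m"
  shows "R (r + m) o\<^sub>L (cores + m *\<^sub>R R 1) = R 1 - r *\<^sub>R (R (r + m) o\<^sub>L R 1)"
proof -
  have "R (r + m) - R 1 = (1 - m) *\<^sub>R (R (r + m) o\<^sub>L R 1) - r *\<^sub>R (R (r + m) o\<^sub>L R 1)"
    using resolvent_eq[OF assms, of 1] by (simp flip: scaleR_diff_left)
  moreover have "x - y = p - q \<Longrightarrow> x - p = y - q" for x y p q :: "'a \<Rightarrow>\<^sub>L 'a"
    by (simp add: algebra_simps)
  ultimately have "R (r + m) - (1 - m) *\<^sub>R (R (r + m) o\<^sub>L R 1) = R 1 - r *\<^sub>R (R (r + m) o\<^sub>L R 1)"
    by blast
  moreover have "R (r + m) o\<^sub>L (cores + m *\<^sub>R R 1) = R (r + m) - (1 - m) *\<^sub>R (R (r + m) o\<^sub>L R 1)"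
    by (simp add: cores_def blinfun_compose.diff_right blinfun_compose.add_right
        blinfun_compose.scaleR_right scaleR_diff_left)
  ultimately show ?thesis
    by simp
qed

lemma resolvent_cores_shift0: "0 < m \<Longrightarrow> R m o\<^sub>L (cores + m *\<^sub>R R 1) = R 1"
  using resolvent_cores_shift[of 0 m] by simp

text \<open>Uniform in \<open>m\<close>, for the passage of \<open>m\<close> to 0. The form in
  \<open>resolvent_cores_shift\<close> is bounded near \<open>r = 0\<close>, and expanding
  \<open>cores\<close> shows the decay \<open>1 / r\<close>.\<close>

lemma norm_resolvent_cores_shift:
  assumes "0 < r" "0 \<le> m" "m \<le> 1"
  shows "norm (R (r + m) o\<^sub>L (cores + m *\<^sub>R R 1)) \<le> 2 * (M + M * M) * (1 / (r + 1))"
proof -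
  let ?T = "R (r + m) o\<^sub>L (cores + m *\<^sub>R R 1)"
  have t: "0 < r + m"
    using assms by simp
  have RR: "r * norm (R (r + m) o\<^sub>L R 1) \<le> M * M"
  proof -
    have "r * norm (R (r + m) o\<^sub>L R 1) \<le> r * (M / (r + m) * (M / 1))"
      using assms t by (intro mult_left_mono norm_resolvent_compose) auto
    also have "\<dots> = r / (r + m) * (M * M)"
      by simp
    also have "\<dots> \<le> 1 * (M * M)"
      using assms t by (intro mult_right_mono) auto
    finally show ?thesis
      by simp
  qed
  have Rr: "r * norm (R (r + m)) \<le> M"
  proof -
    have "r * norm (R (r + m)) \<le> r * (M / (r + m))"
      using assms t by (intro mult_left_mono norm_resolvent) auto
    also have "\<dots> = r / (r + m) * M"
      by simp
    also have "\<dots> \<le> 1 * M"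
      using assms t M_nonneg by (intro mult_right_mono) auto
    finally show ?thesis
      by simp
  qed
  have "norm ?T \<le> norm (R 1) + r * norm (R (r + m) o\<^sub>L R 1)"
    unfolding resolvent_cores_shift[OF t] using norm_triangle_ineq4[of "R 1" "r *\<^sub>R (R (r + m) o\<^sub>L R 1)"] assms
    by simp
  also have "\<dots> \<le> M + M * M"
    using norm_resolvent[of 1] RR by simp
  finally have 1: "norm ?T \<le> M + M * M" .
  have "?T = R (r + m) - (1 - m) *\<^sub>R (R (r + m) o\<^sub>L R 1)"
    by (simp add: cores_def blinfun_compose.diff_right blinfun_compose.add_right
        blinfun_compose.scaleR_right scaleR_diff_left)
  then have "norm ?T \<le> norm (R (r + m)) + (1 - m) * norm (R (r + m) o\<^sub>L R 1)"
    using norm_triangle_ineq4[of "R (r + m)" "(1 - m) *\<^sub>R (R (r + m) o\<^sub>L R 1)"] assms by simp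
  also have "\<dots> \<le> norm (R (r + m)) + 1 * norm (R (r + m) o\<^sub>L R 1)"
    using assms by (intro add_left_mono mult_right_mono) auto
  finally have "r * norm ?T \<le> r * (norm (R (r + m)) + 1 * norm (R (r + m) o\<^sub>L R 1))"
    using assms by (intro mult_left_mono) auto
  also have "\<dots> \<le> M + M * M"
    using Rr RR by (simp add: distrib_left)
  finally have "(r + 1) * norm ?T \<le> 2 * (M + M * M)"
    using 1 by (simp add: distrib_right)
  then show ?thesis
    using assms by (simp add: field_simps)
qed

lemma dominated_apow_shift:
  assumes b: "0 < b" "b < 1" and m: "0 \<le> m" "m \<le> 1"
  shows "dominated (\<lambda>r. r powr (b - 1) *\<^sub>R (R (r + m) o\<^sub>L (cores + m *\<^sub>R R 1)))
    (\<lambda>r. 2 * (M + M * M) * (r powr (b - 1) / (r + 1)))"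
proof (rule dominatedI[OF b])
  show "continuous_on {0<..} (\<lambda>r. r powr (b - 1) *\<^sub>R (R (r + m) o\<^sub>L (cores + m *\<^sub>R R 1)))"
    using m by (intro continuous_intros blinfun_compose.continuous_on continuous_on_resolvent') auto
  show "norm (r powr (b - 1) *\<^sub>R (R (r + m) o\<^sub>L (cores + m *\<^sub>R R 1)))
      \<le> 2 * (M + M * M) * (r powr (b - 1) / (r + 1))" if "0 < r" for r
    using mult_left_mono[OF norm_resolvent_cores_shift[OF that m], of "r powr (b - 1)"]
    by (simp add: mult.commute)
qed simp

lemma dominated_apow:
  assumes "0 < b" "b < 1"
  shows "dominated (\<lambda>r. r powr (b - 1) *\<^sub>R (R r o\<^sub>L cores)) (\<lambda>r. 2 * (M + M * M) * (r powr (b - 1) / (r + 1)))"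
  using dominated_apow_shift[OF assms, of 0] by simp

lemma apow_shift_eq:
  assumes "0 < b" "b < 1" "0 < m"
  shows "apow_shift b m =
    (sin (pi * b) / pi) *\<^sub>R half_integral (\<lambda>r. r powr (b - 1) *\<^sub>R (R (r + m) o\<^sub>L (cores + m *\<^sub>R R 1)))"
  unfolding apow_shift_def rpow_def blinfun_compose.scaleR_left
    half_integral_linear[OF dominated_rpow[OF assms]
      blinfun_compose.bounded_linear_left[of "cores + m *\<^sub>R R 1"], symmetric]
  by (simp add: blinfun_compose.scaleR_left)

text \<open>The removal of the shift: convergence in operator norm carries the laws for
  \<open>m + A\<close> over to \<open>A\<close>, which need not be invertible.\<close>

lemma apow_shift_tendsto:
  assumes b: "0 < b" "b < 1"
  shows "(apow_shift b \<longlongrightarrow> apow b) (at_right 0)"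
  unfolding tendsto_at_iff_sequentially
proof (intro allI impI)
  fix X :: "nat \<Rightarrow> real"
  assume X: "\<forall>i. X i \<in> {0<..} - {0}" "X \<longlonglongrightarrow> 0"
  define f where "f m r = r powr (b - 1) *\<^sub>R (R (r + m) o\<^sub>L (cores + m *\<^sub>R R 1))" for m r
  obtain K where K: "\<And>n. K \<le> n \<Longrightarrow> X n < 1"
    using order_tendstoD(2)[OF X(2), of 1] unfolding eventually_sequentially by auto
  have "(\<lambda>n. half_integral (f (X (n + K)))) \<longlonglongrightarrow> half_integral (f 0)"
  proof (rule half_integral_dominated_convergence)
    show "dominated (f (X (n + K))) (\<lambda>r. 2 * (M + M * M) * (r powr (b - 1) / (r + 1)))" for n
      unfolding f_def using K[of "n + K"] X(1)
      by (intro dominated_apow_shift b) (auto intro: less_imp_le)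
    show "dominated (f 0) (\<lambda>r. 2 * (M + M * M) * (r powr (b - 1) / (r + 1)))"
      unfolding f_def by (intro dominated_apow_shift b) auto
    fix r :: real assume r: "0 < r"
    have X': "(\<lambda>n. X (n + K)) \<longlonglongrightarrow> 0"
      by (rule LIMSEQ_ignore_initial_segment[OF X(2)])
    have "(\<lambda>n. R (r + X (n + K))) \<longlonglongrightarrow> R (r + 0)"
      using r by (intro resolvent_tendsto tendsto_add X' tendsto_const) auto
    then show "(\<lambda>n. f (X (n + K)) r) \<longlonglongrightarrow> f 0 r"
      unfolding f_def by (intro tendsto_scaleR blinfun_compose.tendsto tendsto_add X' tendsto_const)
  qed
  then have "(\<lambda>n. (sin (pi * b) / pi) *\<^sub>R half_integral (f (X n))) \<longlonglongrightarrow> (sin (pi * b) / pi) *\<^sub>R half_integral (f 0)"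
    by (intro tendsto_scaleR tendsto_const) (rule LIMSEQ_offset)
  moreover have "(sin (pi * b) / pi) *\<^sub>R half_integral (f (X n)) = (apow_shift b \<circ> X) n" for n
    using apow_shift_eq[OF b, of "X n"] X(1) by (auto simp: f_def[abs_def])
  moreover have "(sin (pi * b) / pi) *\<^sub>R half_integral (f 0) = apow b"
    by (simp add: apow_def f_def[abs_def])
  ultimately show "(apow_shift b \<circ> X) \<longlonglongrightarrow> apow b"
    by (simp add: comp_def)
qed

lemma apow_commute:
  assumes b: "0 < b" "b < 1" and T: "\<And>t. 0 < t \<Longrightarrow> T o\<^sub>L R t = R t o\<^sub>L T"
  shows "T o\<^sub>L apow b = apow b o\<^sub>L T"
proof -
  have "T o\<^sub>L cores = cores o\<^sub>L T"
    using T[of 1] by (simp add: cores_def blinfun_compose.diff_left blinfun_compose.diff_right)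
  then have com: "T o\<^sub>L (R r o\<^sub>L cores) = (R r o\<^sub>L cores) o\<^sub>L T" if "0 < r" for r
    using T[OF that] by (metis blinfun_compose_assoc)
  have "T o\<^sub>L half_integral (\<lambda>r. r powr (b - 1) *\<^sub>R (R r o\<^sub>L cores)) =
      half_integral (\<lambda>r. T o\<^sub>L (r powr (b - 1) *\<^sub>R (R r o\<^sub>L cores)))"
    by (rule half_integral_linear[OF dominated_apow[OF b] blinfun_compose.bounded_linear_right, symmetric])
  also have "\<dots> = half_integral (\<lambda>r. (r powr (b - 1) *\<^sub>R (R r o\<^sub>L cores)) o\<^sub>L T)"
    by (intro half_integral_cong) (simp only: com blinfun_compose.scaleR_left blinfun_compose.scaleR_right)
  also have "\<dots> = half_integral (\<lambda>r. r powr (b - 1) *\<^sub>R (R r o\<^sub>L cores)) o\<^sub>L T"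
    by (rule half_integral_linear[OF dominated_apow[OF b] blinfun_compose.bounded_linear_left])
  finally show ?thesis
    by (simp add: apow_def blinfun_compose.scaleR_left blinfun_compose.scaleR_right)
qed

lemma apow_apply:
  assumes b: "0 < b" "b < 1"
  shows "apow b x = (sin (pi * b) / pi) *\<^sub>R half_integral (\<lambda>r. r powr (b - 1) *\<^sub>R R r (cores x))"
proof -
  have "half_integral (\<lambda>r. (r powr (b - 1) *\<^sub>R (R r o\<^sub>L cores)) x) =
      half_integral (\<lambda>r. r powr (b - 1) *\<^sub>R (R r o\<^sub>L cores)) x"
    by (rule half_integral_linear[OF dominated_apow[OF b] blinfun.bounded_linear_left])
  then show ?thesis
    by (simp add: apow_def blinfun.scaleR_left)
qed

lemma resolvent_apow: "\<lbrakk>0 < b; b < 1; 0 < t\<rbrakk> \<Longrightarrow> R t (apow b x) = apow b (R t x)"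
  using apow_commute[of b "R t"] resolvent_commute_compose[of t] by (metis blinfun_apply_blinfun_compose)

lemma cores_apow: "\<lbrakk>0 < b; b < 1\<rbrakk> \<Longrightarrow> cores (apow b x) = apow b (cores x)"
  by (simp add: cores_apply resolvent_apow blinfun.diff_right)

lemma resolvent_cores: "0 < t \<Longrightarrow> R t (cores x) = cores (R t x)"
  by (simp add: cores_apply blinfun.diff_right resolvent_commute)

lemma apow_apow_commute:
  assumes "0 < a" "a < 1" "0 < b" "b < 1"
  shows "apow a (apow b x) = apow b (apow a x)"
proof -
  have "apow a o\<^sub>L apow b = apow b o\<^sub>L apow a"
    using assms by (intro apow_commute blinfun_eqI) (auto simp: resolvent_apow)
  then show ?thesis
    by (metis blinfun_apply_blinfun_compose)
qed

lemma apow_shift_compose: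
  assumes "0 < a" "a < 1" "0 < b" "b < 1" "0 < m"
  shows "apow_shift a m o\<^sub>L apow_shift b m =
    (rpow a m o\<^sub>L rpow b m) o\<^sub>L ((cores + m *\<^sub>R R 1) o\<^sub>L (cores + m *\<^sub>R R 1))"
proof -
  have "(cores + m *\<^sub>R R 1) o\<^sub>L R t = R t o\<^sub>L (cores + m *\<^sub>R R 1)" if "0 < t" for t
    using that by (intro blinfun_eqI)
      (simp add: blinfun.add_left blinfun.add_right blinfun.scaleR_left blinfun.scaleR_right
        resolvent_cores resolvent_commute)
  then have "(cores + m *\<^sub>R R 1) o\<^sub>L rpow b m = rpow b m o\<^sub>L (cores + m *\<^sub>R R 1)"
    using assms by (intro rpow_commute) auto
  then show ?thesis
    unfolding apow_shift_def by (metis blinfun_compose_assoc)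
qed

text \<open>\<open>rpow (1 - b) m\<close> is \<open>(m + A) powr (- b)\<close>, the inverse of the
  power inside \<open>apow_shift b m\<close>; only the regularisation remains.\<close>

lemma apow_shift_rpow:
  assumes "0 < b" "b < 1" "0 < m"
  shows "apow_shift b m (rpow (1 - b) m x) = R 1 x"
proof -
  have "R t o\<^sub>L (cores + m *\<^sub>R R 1) = (cores + m *\<^sub>R R 1) o\<^sub>L R t" if "0 < t" for t
    using that by (intro blinfun_eqI)
      (simp add: blinfun.add_left blinfun.add_right blinfun.scaleR_left blinfun.scaleR_right
        resolvent_cores resolvent_commute)
  then have "(cores + m *\<^sub>R R 1) o\<^sub>L rpow (1 - b) m = rpow (1 - b) m o\<^sub>L (cores + m *\<^sub>R R 1)"
    using assms by (intro rpow_commute) auto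
  then have "apow_shift b m o\<^sub>L rpow (1 - b) m = (rpow b m o\<^sub>L rpow (1 - b) m) o\<^sub>L (cores + m *\<^sub>R R 1)"
    unfolding apow_shift_def by (metis blinfun_compose_assoc)
  also have "\<dots> = R 1"
    using assms by (simp add: rpow_complement resolvent_cores_shift0)
  finally show ?thesis
    by (metis blinfun_apply_blinfun_compose)
qed

lemma apow_shift_compose_tendsto:
  assumes "0 < a" "a < 1" "0 < b" "b < 1"
  shows "((\<lambda>m. apow_shift a m o\<^sub>L apow_shift b m) \<longlongrightarrow> apow a o\<^sub>L apow b) (at_right 0)"
  using assms by (intro blinfun_compose.tendsto apow_shift_tendsto)

lemma cores_shift_tendsto: "((\<lambda>m. cores + m *\<^sub>R R 1) \<longlongrightarrow> cores) (at_right 0)"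
  using tendsto_add[OF tendsto_const[of cores] tendsto_scaleR[OF tendsto_ident_at[of 0 "{0<..}"] tendsto_const[of "R 1"]]]
  by simp

text \<open>Exact for \<open>m > 0\<close> by the law for \<open>rpow\<close>, with one
  \<open>R m\<close> absorbed by \<open>cores + m *\<^sub>R R 1\<close>; then \<open>m\<close> tends
  to 0. The surplus \<open>R 1\<close> balances the second regularisation on the left.\<close>

lemma apow_apow:
  assumes a: "0 < a" and b: "0 < b" and ab: "a + b < 1"
  shows "apow a (apow b x) = apow (a + b) (R 1 x)"
proof -
  have "((\<lambda>m. apow_shift (a + b) m o\<^sub>L R 1) \<longlongrightarrow> apow (a + b) o\<^sub>L R 1) (at_right 0)"
    using assms by (intro blinfun_compose.tendsto apow_shift_tendsto tendsto_const) auto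
  moreover have "\<forall>\<^sub>F m in at_right 0. apow_shift (a + b) m o\<^sub>L R 1 = apow_shift a m o\<^sub>L apow_shift b m"
  proof (rule eventually_at_right_less[THEN eventually_mono])
    fix m :: real assume m: "0 < m"
    have "apow_shift a m o\<^sub>L apow_shift b m =
        (rpow (a + b) m o\<^sub>L R m) o\<^sub>L ((cores + m *\<^sub>R R 1) o\<^sub>L (cores + m *\<^sub>R R 1))"
      using assms m by (simp add: apow_shift_compose rpow_compose' resolvent_rpow)
    also have "\<dots> = rpow (a + b) m o\<^sub>L ((R m o\<^sub>L (cores + m *\<^sub>R R 1)) o\<^sub>L (cores + m *\<^sub>R R 1))"
      by (simp only: blinfun_compose_assoc)
    also have "\<dots> = rpow (a + b) m o\<^sub>L (R 1 o\<^sub>L (cores + m *\<^sub>R R 1))"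
      using m by (simp only: resolvent_cores_shift0)
    also have "R 1 o\<^sub>L (cores + m *\<^sub>R R 1) = (cores + m *\<^sub>R R 1) o\<^sub>L R 1"
      by (intro blinfun_eqI) (simp add: blinfun.add_left blinfun.add_right blinfun.scaleR_left
          blinfun.scaleR_right resolvent_cores)
    finally show "apow_shift (a + b) m o\<^sub>L R 1 = apow_shift a m o\<^sub>L apow_shift b m"
      by (simp add: apow_shift_def blinfun_compose_assoc)
  qed
  ultimately have "((\<lambda>m. apow_shift a m o\<^sub>L apow_shift b m) \<longlongrightarrow> apow (a + b) o\<^sub>L R 1) (at_right 0)"
    by (rule Lim_transform_eventually)
  then have "apow a o\<^sub>L apow b = apow (a + b) o\<^sub>L R 1"
    using assms by (intro tendsto_unique[OF trivial_limit_at_right_real apow_shift_compose_tendsto]) auto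
  then show ?thesis
    by (metis blinfun_apply_blinfun_compose)
qed

lemma apow_complement:
  assumes a: "0 < a" "a < 1"
  shows "apow a (apow (1 - a) x) = cores (R 1 x)"
proof -
  have "((\<lambda>m. R 1 o\<^sub>L (cores + m *\<^sub>R R 1)) \<longlongrightarrow> R 1 o\<^sub>L cores) (at_right 0)"
    by (intro blinfun_compose.tendsto cores_shift_tendsto tendsto_const)
  moreover have "\<forall>\<^sub>F m in at_right 0. R 1 o\<^sub>L (cores + m *\<^sub>R R 1) = apow_shift a m o\<^sub>L apow_shift (1 - a) m"
  proof (rule eventually_at_right_less[THEN eventually_mono])
    fix m :: real assume m: "0 < m"
    have "apow_shift a m o\<^sub>L apow_shift (1 - a) m = R m o\<^sub>L ((cores + m *\<^sub>R R 1) o\<^sub>L (cores + m *\<^sub>R R 1))"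
      using assms m by (simp add: apow_shift_compose rpow_complement)
    also have "\<dots> = (R m o\<^sub>L (cores + m *\<^sub>R R 1)) o\<^sub>L (cores + m *\<^sub>R R 1)"
      by (simp only: blinfun_compose_assoc)
    finally show "R 1 o\<^sub>L (cores + m *\<^sub>R R 1) = apow_shift a m o\<^sub>L apow_shift (1 - a) m"
      using m by (simp only: resolvent_cores_shift0)
  qed
  ultimately have "((\<lambda>m. apow_shift a m o\<^sub>L apow_shift (1 - a) m) \<longlongrightarrow> R 1 o\<^sub>L cores) (at_right 0)"
    by (rule Lim_transform_eventually)
  then have "apow a o\<^sub>L apow (1 - a) = R 1 o\<^sub>L cores"
    using assms by (intro tendsto_unique[OF trivial_limit_at_right_real apow_shift_compose_tendsto]) auto
  then show ?thesis
    using resolvent_cores[of 1 x] by (metis blinfun_apply_blinfun_compose zero_less_one)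
qed

text \<open>Beyond total exponent 1 a full power of \<open>A\<close> splits off and joins the
  surplus \<open>R 1\<close> to form \<open>cores\<close>.\<close>

lemma apow_apow':
  assumes a: "0 < a" "a < 1" and b: "0 < b" "b < 1" and ab: "1 < a + b"
  shows "apow a (apow b x) = apow (a + b - 1) (cores x)"
proof -
  have "((\<lambda>m. apow_shift (a + b - 1) m o\<^sub>L (cores + m *\<^sub>R R 1)) \<longlongrightarrow> apow (a + b - 1) o\<^sub>L cores) (at_right 0)"
    using assms by (intro blinfun_compose.tendsto apow_shift_tendsto cores_shift_tendsto) auto
  moreover have "\<forall>\<^sub>F m in at_right 0.
      apow_shift (a + b - 1) m o\<^sub>L (cores + m *\<^sub>R R 1) = apow_shift a m o\<^sub>L apow_shift b m"
  proof (rule eventually_at_right_less[THEN eventually_mono])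
    fix m :: real assume m: "0 < m"
    show "apow_shift (a + b - 1) m o\<^sub>L (cores + m *\<^sub>R R 1) = apow_shift a m o\<^sub>L apow_shift b m"
      unfolding apow_shift_compose[OF a b m] rpow_compose[OF a b ab m]
      by (simp only: apow_shift_def blinfun_compose_assoc)
  qed
  ultimately have "((\<lambda>m. apow_shift a m o\<^sub>L apow_shift b m) \<longlongrightarrow> apow (a + b - 1) o\<^sub>L cores) (at_right 0)"
    by (rule Lim_transform_eventually)
  then have "apow a o\<^sub>L apow b = apow (a + b - 1) o\<^sub>L cores"
    using assms by (intro tendsto_unique[OF trivial_limit_at_right_real apow_shift_compose_tendsto]) auto
  then show ?thesis
    by (metis blinfun_apply_blinfun_compose)
qed

lemma continuous_on_apow: "continuous_on {0<..<1} apow"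
  unfolding continuous_on_sequentially
proof (intro allI ballI impI, elim conjE)
  fix y :: "nat \<Rightarrow> real" and b :: real
  assume b: "b \<in> {0<..<1}" and y: "\<forall>n. y n \<in> {0<..<1}" "y \<longlonglongrightarrow> b"
  \<comment> \<open>For exponents \<open>z\<close> between \<open>c\<close> and \<open>d\<close>,
    \<open>r powr (z - 1)\<close> is at most its value for \<open>c\<close> when
    \<open>r \<le> 1\<close> and for \<open>d\<close> when \<open>r > 1\<close>; the two kernels
    together form one majorant near \<open>b\<close>.\<close>
  define c d where "c = b / 2" and "d = (b + 1) / 2"
  have cd: "0 < c" "c < b" "b < d" "d < 1"
    using b by (auto simp: c_def d_def)
  define L where "L = 2 * (M + M * M)"
  define f where "f z r = r powr (z - 1) *\<^sub>R (R r o\<^sub>L cores)" for z r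
  define g where "g r = L * (r powr (c - 1) / (r + 1)) + L * (r powr (d - 1) / (r + 1))" for r
  have L: "0 \<le> L"
    using M_nonneg by (simp add: L_def)
  have dom: "dominated (f z) g" if z: "c < z" "z < d" for z
  proof -
    have z01: "0 < z" "z < 1"
      using z cd by auto
    have le: "r powr (z - 1) \<le> r powr (c - 1) + r powr (d - 1)" if "0 < r" for r :: real
    proof (cases "r \<le> 1")
      case True
      then have "r powr (z - 1) \<le> r powr (c - 1)"
        using that z by (intro powr_mono') auto
      then show ?thesis
        by (simp add: add_increasing2)
    next
      case False
      then have "r powr (z - 1) \<le> r powr (d - 1)"
        using z by (intro powr_mono) auto
      then show ?thesis
        by (simp add: add_increasing)
    qed
    show ?thesis
      unfolding dominated_def
    proof (intro conjI allI impI)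
      show "continuous_on {0<..} (f z)"
        using dominated_apow[OF z01] by (simp add: dominated_def f_def[abs_def])
      show "continuous_on {0<..} g"
        unfolding g_def by (intro continuous_on_add continuous_on_mult_left continuous_on_stieltjes_kernel) auto
      show "g integrable_on {0<..}"
        unfolding g_def using cd
        by (intro integrable_add integrable_on_mult_right
            has_integral_integrable[OF has_integral_stieltjes_kernel]) auto
      fix r :: real assume r: "0 < r"
      have "norm (f z r) \<le> L * (r powr (z - 1) / (r + 1))"
        using dominated_apow[OF z01] r by (simp add: dominated_def f_def L_def)
      also have "\<dots> \<le> L * ((r powr (c - 1) + r powr (d - 1)) / (r + 1))"
        using L r le[OF r] by (intro mult_left_mono divide_right_mono) auto
      also have "\<dots> = g r"
        by (simp add: g_def add_divide_distrib distrib_left)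
      finally show "norm (f z r) \<le> g r" .
    qed
  qed
  obtain K where K: "\<And>n. K \<le> n \<Longrightarrow> c < y n \<and> y n < d"
    using eventually_conj[OF order_tendstoD(1)[OF y(2) cd(2)] order_tendstoD(2)[OF y(2) cd(3)]]
    unfolding eventually_sequentially by blast
  have "(\<lambda>n. half_integral (f (y (n + K)))) \<longlonglongrightarrow> half_integral (f b)"
  proof (rule half_integral_dominated_convergence)
    show "dominated (f (y (n + K))) g" for n
      using K[of "n + K"] by (intro dom) auto
    show "dominated (f b) g"
      using cd by (intro dom) auto
    show "(\<lambda>n. f (y (n + K)) r) \<longlonglongrightarrow> f b r" if "0 < r" for r
      unfolding f_def using that
      by (intro tendsto_scaleR tendsto_const tendsto_powr tendsto_diff LIMSEQ_ignore_initial_segment[OF y(2)]) auto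
  qed
  then have "(\<lambda>n. half_integral (f (y n))) \<longlonglongrightarrow> half_integral (f b)"
    by (rule LIMSEQ_offset)
  then have "(\<lambda>n. (sin (pi * y n) / pi) *\<^sub>R half_integral (f (y n))) \<longlonglongrightarrow> (sin (pi * b) / pi) *\<^sub>R half_integral (f b)"
    by (intro tendsto_scaleR tendsto_divide tendsto_sin tendsto_mult tendsto_const y(2)) auto
  then show "(apow \<circ> y) \<longlonglongrightarrow> apow b"
    by (simp add: apow_def[abs_def] f_def[abs_def] comp_def)
qed

end

section \<open>Periodic orbits\<close>

text \<open>The powers of \<open>(1 + cos x) / 2\<close> concentrate at \<open>0\<close>.\<close>

lemma fourier_cos_coefficients_zero:
  fixes z :: "real \<Rightarrow> 'b::banach"
  assumes h: "0 < h" and cont: "continuous_on {-h..h} z"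
    and coeff: "\<And>k::nat. integral {-h..h} (\<lambda>x. cos (k * pi / h * x) *\<^sub>R z x) = 0"
  shows "z 0 = 0"
proof (rule ccontr)
  assume z0: "z 0 \<noteq> 0"
  define w where "w = pi / h"
  define q where "q x = (1 + cos (w * x)) / 2" for x
  have w: "0 < w" "w * h = pi"
    using h by (auto simp: w_def)
  have cq: "continuous_on S q" for S
    unfolding q_def by (intro continuous_intros) auto
  have q01: "0 \<le> q x" "q x \<le> 1" for x
  proof -
    have "-1 \<le> c \<Longrightarrow> c \<le> 1 \<Longrightarrow> 0 \<le> (1 + c) / 2 \<and> (1 + c) / 2 \<le> 1" for c :: real
      by simp
    from this[OF cos_ge_minus_one cos_le_one] show "0 \<le> q x" "q x \<le> 1"
      unfolding q_def by blast+
  qed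
  have qabs: "q x = q \<bar>x\<bar>" for x
    by (auto simp: q_def abs_if)
  have qmono: "q y < q x" if "0 \<le> x" "x < y" "y \<le> h" for x y
  proof -
    have "w * y \<le> w * h" "w * x < w * y" "0 \<le> w * x"
      using that w(1) by auto
    then have "cos (w * y) < cos (w * x)"
      using w by (intro cos_monotone_0_pi) auto
    then show ?thesis
      by (simp add: q_def)
  qed
  \<comment> \<open>Product-to-sum: a factor \<open>q\<close> mixes frequency \<open>k\<close> with
    \<open>k + 1\<close> and \<open>k - 1\<close>. Integer frequencies keep the induction closed at
    \<open>k = 0\<close>.\<close>
  have "integral {-h..h} (\<lambda>x. (q x ^ n * cos (of_int k * (w * x))) *\<^sub>R z x) = 0" for n and k :: int
  proof (induction n arbitrary: k)
    case 0
    have "cos (of_int k * (w * x)) = cos (real (nat \<bar>k\<bar>) * pi / h * x)" for x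
      by (cases "0 \<le> k") (simp_all add: w_def mult.assoc)
    then show ?case
      using coeff[of "nat \<bar>k\<bar>"] by simp
  next
    case (Suc n)
    define f where "f k x = (q x ^ n * cos (of_int k * (w * x))) *\<^sub>R z x" for k :: int and x
    have f: "f k integrable_on {-h..h}" "integral {-h..h} (f k) = 0" for k
    proof -
      show "f k integrable_on {-h..h}"
        unfolding f_def by (intro integrable_continuous_real continuous_intros cont cq)
      show "integral {-h..h} (f k) = 0"
        using Suc.IH[of k] by (simp add: f_def[abs_def])
    qed
    have "(q x ^ Suc n * cos (of_int k * (w * x))) *\<^sub>R z x =
        (1 / 2) *\<^sub>R f k x + (1 / 4) *\<^sub>R (f (k + 1) x + f (k - 1) x)" for x
    proof -
      have *: "cos (of_int (k + 1) * (w * x)) + cos (of_int (k - 1) * (w * x)) =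
          2 * (cos (of_int k * (w * x)) * cos (w * x))"
        by (simp add: distrib_right left_diff_distrib cos_add cos_diff)
      have "q x * cos (of_int k * (w * x)) = 1 / 2 * cos (of_int k * (w * x)) +
          1 / 4 * (cos (of_int (k + 1) * (w * x)) + cos (of_int (k - 1) * (w * x)))"
        unfolding * q_def by (simp add: field_simps)
      then have "q x ^ Suc n * cos (of_int k * (w * x)) = q x ^ n * (1 / 2 * cos (of_int k * (w * x)) +
          1 / 4 * (cos (of_int (k + 1) * (w * x)) + cos (of_int (k - 1) * (w * x))))"
        by (simp add: mult.commute mult.left_commute)
      then show ?thesis
        unfolding f_def by (simp only: flip: scaleR_add_left scaleR_scaleR) (simp add: algebra_simps)
    qed
    moreover have "integral {-h..h} (\<lambda>x. (1 / 2) *\<^sub>R f k x + (1 / 4) *\<^sub>R (f (k + 1) x + f (k - 1) x)) =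
        (1 / 2) *\<^sub>R 0 + (1 / 4) *\<^sub>R (0 + 0)"
      by (intro integral_unique has_integral_add has_integral_cmul)
        (use f in \<open>auto simp: has_integral_iff\<close>)
    ultimately show ?case
      by simp
  qed
  from this[of _ 0] have qz: "integral {-h..h} (\<lambda>x. q x ^ n *\<^sub>R z x) = 0" for n
    by simp
  define e where "e = norm (z 0) / 2"
  have e: "0 < e"
    using z0 by (simp add: e_def)
  have "0 \<in> {-h..h}"
    using h by simp
  then obtain d0 where d0: "0 < d0" "\<And>x. \<lbrakk>x \<in> {-h..h}; dist x 0 < d0\<rbrakk> \<Longrightarrow> dist (z x) (z 0) < e"
    using cont e unfolding continuous_on_iff by blast
  define d where "d = min d0 h / 2"
  have d: "0 < d" "d < d0" "d < h"
    using d0(1) h by (auto simp: d_def)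
  have near: "norm (z x - z 0) \<le> e" if "\<bar>x\<bar> < d" for x
    using d0(2)[of x] that d by (auto simp: dist_norm abs_less_iff)
  have "compact (z ` {-h..h})"
    using cont by (intro compact_continuous_image) auto
  then obtain B where B: "\<And>x. x \<in> {-h..h} \<Longrightarrow> norm (z x) \<le> B"
    using compact_imp_bounded[of "z ` {-h..h}"] unfolding bounded_iff by blast
  have "0 \<le> B"
    using order_trans[OF norm_ge_zero B[OF \<open>0 \<in> {-h..h}\<close>]] .
  have pos: "0 < q (d / 2)" "0 \<le> q d" "q d < q (d / 2)"
    using qmono[of "d / 2" d] d q01[of d] by auto
  \<comment> \<open>The mass of \<open>q ^ n\<close> within distance \<open>d / 2\<close> of 0 is at
    least \<open>d * q (d / 2) ^ n\<close>, while outside distance \<open>d\<close> the integrand is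
    of order \<open>q d ^ n\<close>. Vanishing of the weighted integral of \<open>z\<close> bounds
    the first by the second, and their ratio decays geometrically.\<close>
  have main: "e * d \<le> 4 * B * h * (q d / q (d / 2)) ^ n" for n
  proof -
    have I: "(\<lambda>x. q x ^ n) integrable_on {-h..h}"
      by (intro integrable_continuous_real continuous_intros cq)
    have cz: "continuous_on {-h..h} (\<lambda>x. q x ^ n *\<^sub>R (z 0 - z x))"
      by (intro continuous_intros cq cont)
    have "integral {-h..h} (\<lambda>x. q x ^ n *\<^sub>R (z 0 - z x)) = integral {-h..h} (\<lambda>x. q x ^ n) *\<^sub>R z 0 - 0"
      unfolding scaleR_diff_right
    proof (intro integral_unique has_integral_diff has_integral_scaleR_left integrable_integral I)
      show "((\<lambda>x. q x ^ n *\<^sub>R z x) has_integral 0) {-h..h}"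
        using qz[of n] by (auto simp: has_integral_iff intro!: integrable_continuous_real continuous_intros cq cont)
    qed
    then have "norm (integral {-h..h} (\<lambda>x. q x ^ n) *\<^sub>R z 0) =
        norm (integral {-h..h} (\<lambda>x. q x ^ n *\<^sub>R (z 0 - z x)))"
      by simp
    also have "\<dots> \<le> integral {-h..h} (\<lambda>x. q x ^ n * e + q d ^ n * (2 * B))"
    proof (rule integral_norm_bound_integral)
      show "(\<lambda>x. q x ^ n *\<^sub>R (z 0 - z x)) integrable_on {-h..h}"
        by (rule integrable_continuous_real[OF cz])
      show "(\<lambda>x. q x ^ n * e + q d ^ n * (2 * B)) integrable_on {-h..h}"
        by (intro integrable_continuous_real continuous_intros cq)
      fix x assume x: "x \<in> {-h..h}"
      show "norm (q x ^ n *\<^sub>R (z 0 - z x)) \<le> q x ^ n * e + q d ^ n * (2 * B)"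
      proof (cases "\<bar>x\<bar> < d")
        case True
        have "q x ^ n * norm (z 0 - z x) \<le> q x ^ n * e"
          using near[OF True] q01[of x] by (intro mult_left_mono) (auto simp: norm_minus_commute)
        then show ?thesis
          using q01[of x] pos \<open>0 \<le> B\<close> by (simp add: add_increasing2)
      next
        case False
        have "q x \<le> q d"
          using qmono[of d "\<bar>x\<bar>"] qabs[of x] False x d
          by (cases "\<bar>x\<bar> = d") (auto simp: abs_le_iff intro: less_imp_le)
        then have "q x ^ n \<le> q d ^ n"
          using q01[of x] by (intro power_mono) auto
        moreover have "norm (z 0 - z x) \<le> 2 * B"
          using norm_triangle_ineq4[of "z 0" "z x"] B[of 0] B[OF x] h by simp
        ultimately have "q x ^ n * norm (z 0 - z x) \<le> q d ^ n * (2 * B)"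
          using q01[of d] by (intro mult_mono) auto
        then show ?thesis
          using q01[of x] e by (simp add: add_increasing)
      qed
    qed
    also have "\<dots> = integral {-h..h} (\<lambda>x. q x ^ n) * e + (2 * h) * (q d ^ n * (2 * B))"
    proof (intro integral_unique has_integral_add)
      show "((\<lambda>x. q x ^ n * e) has_integral integral {-h..h} (\<lambda>x. q x ^ n) * e) {-h..h}"
        by (intro has_integral_mult_left integrable_integral I)
      show "((\<lambda>x. q d ^ n * (2 * B)) has_integral 2 * h * (q d ^ n * (2 * B))) {-h..h}"
        using has_integral_const_real[of "q d ^ n * (2 * B)" "-h" h] h by simp
    qed
    finally have "integral {-h..h} (\<lambda>x. q x ^ n) * (2 * e) \<le>
        integral {-h..h} (\<lambda>x. q x ^ n) * e + (2 * h) * (q d ^ n * (2 * B))"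
      using integral_nonneg[OF I] q01 by (simp add: e_def)
    then have 1: "integral {-h..h} (\<lambda>x. q x ^ n) * e \<le> 4 * B * h * q d ^ n"
      by (simp add: algebra_simps)
    have "d * q (d / 2) ^ n = integral {-d/2..d/2} (\<lambda>x. q (d / 2) ^ n)"
      using d by simp
    also have "\<dots> \<le> integral {-d/2..d/2} (\<lambda>x. q x ^ n)"
    proof (rule integral_le)
      fix x assume x: "x \<in> {-d/2..d/2}"
      have "q (d / 2) \<le> q x"
      proof (cases "\<bar>x\<bar> = d / 2")
        case False
        then have "\<bar>x\<bar> < d / 2"
          using x by auto
        then show ?thesis
          using qmono[of "\<bar>x\<bar>" "d / 2"] qabs[of x] d by simp
      qed (metis qabs order_refl)
      then show "q (d / 2) ^ n \<le> q x ^ n"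
        using pos by (intro power_mono) auto
    qed (intro integrable_continuous_real continuous_intros cq)+
    also have "\<dots> \<le> integral {-h..h} (\<lambda>x. q x ^ n)"
    proof (rule integral_subset_le)
      show "(\<lambda>x. q x ^ n) integrable_on {-d/2..d/2}"
        by (intro integrable_continuous_real continuous_intros cq)
    qed (use d q01 I in auto)
    finally have "d * q (d / 2) ^ n * e \<le> 4 * B * h * q d ^ n"
      using 1 e by (meson less_imp_le mult_right_mono order_trans)
    then show ?thesis
      using pos by (simp add: power_divide field_simps)
  qed
  have "(\<lambda>n. 4 * B * h * (q d / q (d / 2)) ^ n) \<longlonglongrightarrow> 4 * B * h * 0"
    using pos by (intro tendsto_mult tendsto_const LIMSEQ_power_zero) auto
  then have "e * d \<le> 4 * B * h * 0"
    by (rule LIMSEQ_le_const) (use main in blast)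
  then show False
    using e d by (simp add: mult_le_0_iff)
qed

lemma integral_shift_Icc:
  fixes f :: "real \<Rightarrow> 'b::banach"
  shows "integral {a..b} (\<lambda>x. f (x + c)) = integral {a + c..b + c} f"
proof -
  have "((\<lambda>x. f (x + c)) has_integral I) {a..b} \<longleftrightarrow> (f has_integral I) {a + c..b + c}" for I
    using has_integral_affinity_iff[of 1 f c I "a + c" "b + c"] by (simp add: cbox_interval)
  then show ?thesis
    by (metis has_integral_integrable_integral integral_unique not_integrable_integral integrable_integral)
qed

lemma integral_periodic:
  fixes g :: "real \<Rightarrow> 'b::banach"
  assumes p: "0 \<le> p" and cont: "continuous_on {a..b + p} g" and ab: "a \<le> b"
    and per: "\<And>x. \<lbrakk>a \<le> x; x \<le> b\<rbrakk> \<Longrightarrow> g (x + p) = g x"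
  shows "integral {b..b + p} g = integral {a..a + p} g"
proof -
  have sub: "g integrable_on {c..d}" if "a \<le> c" "d \<le> b + p" for c d
    using that cont by (intro integrable_continuous_real continuous_on_subset[OF cont]) auto
  have "integral {a..a + p} g + integral {a + p..b + p} g = integral {a..b + p} g"
    using p ab by (intro Henstock_Kurzweil_Integration.integral_combine sub) auto
  moreover have "integral {a..b} g + integral {b..b + p} g = integral {a..b + p} g"
    using p ab by (intro Henstock_Kurzweil_Integration.integral_combine sub) auto
  moreover have "integral {a + p..b + p} g = integral {a..b} (\<lambda>x. g (x + p))"
    by (simp add: integral_shift_Icc)
  moreover have "integral {a..b} (\<lambda>x. g (x + p)) = integral {a..b} g"
    by (rule Henstock_Kurzweil_Integration.integral_cong) (use per in auto)
  ultimately show ?thesis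
    by (metis add.commute add_right_cancel)
qed

section \<open>Excluding rotations by more than a half turn\<close>

lemma half_integral_nonneg:
  fixes f :: "real \<Rightarrow> real"
  assumes "dominated f g" "\<And>r. 0 < r \<Longrightarrow> 0 \<le> f r"
  shows "0 \<le> half_integral f"
proof (rule LIMSEQ_le_const[OF half_integral_tendsto[OF assms(1)]], intro exI allI impI)
  show "0 \<le> integral (window n) f" for n
    using assms window_pos by (intro integral_nonneg integrable_on_window) (auto simp: dominated_def)
qed

text \<open>Kernel bound for the scalar analogue of \<open>A (r + A)\<^sup>-\<^sup>1\<close>;
  \<open>d\<close> is a lower bound for the distance of \<open>- z\<close> from the positive
  half-line.\<close>

lemma norm_complex_divide_shift:
  fixes z :: complex
  assumes "0 < d" "\<And>r. 0 < r \<Longrightarrow> d \<le> norm (of_real r + z)" "0 < r"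
  shows "norm (z / (of_real r + z)) \<le> norm z * (1 + (1 + norm z) / d) * (1 / (r + 1))"
proof -
  define n where "n = norm (of_real r + z)"
  have n: "d \<le> n" "0 < n"
    using assms(2)[OF assms(3)] assms(1) by (simp_all add: n_def del: zero_less_norm_iff)
  have "r \<le> n + norm z"
    using norm_triangle_ineq4[of "of_real r + z" z] assms(3) by (simp add: n_def)
  moreover have "(1 + norm z) \<le> (1 + norm z) / d * n"
  proof -
    have "(1 + norm z) / d * d \<le> (1 + norm z) / d * n"
      using n(1) assms(1) by (intro mult_left_mono) auto
    then show ?thesis
      using assms(1) by simp
  qed
  ultimately have "r + 1 \<le> (1 + (1 + norm z) / d) * n"
    by (simp add: distrib_right)
  then have "1 / n \<le> (1 + (1 + norm z) / d) * (1 / (r + 1))"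
    using n assms(3) by (simp add: divide_simps mult.commute)
  from mult_left_mono[OF this norm_ge_zero[of z]] show ?thesis
    by (simp add: norm_divide n_def mult.assoc)
qed

lemma funpow_commute_apply:
  "(\<And>x. f (g x) = g (f x)) \<Longrightarrow> (f ^^ n) (g x) = g ((f ^^ n) x)"
  by (induction n) auto

lemma funpow_compose_apply:
  assumes "\<And>x. f (g x) = g (f x)"
  shows "(f ^^ n) ((g ^^ n) x) = ((\<lambda>x. f (g x)) ^^ n) x"
proof (induction n)
  case (Suc n)
  have "(f ^^ Suc n) ((g ^^ Suc n) x) = f ((f ^^ n) (g ((g ^^ n) x)))"
    by simp
  also have "\<dots> = f (g ((f ^^ n) ((g ^^ n) x)))"
    using funpow_commute_apply[of f g n] assms by simp
  finally show ?case
    using Suc by simp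
qed simp

context resolvent_family
begin

text \<open>If the powers of \<open>A\<close> act on the image of \<open>\<psi>\<close> as multiplication by
  \<open>lam\<^sup>b exp (i \<theta> b)\<close>, then \<open>A\<close> acts as multiplication by \<open>\<zeta> = lam exp (i \<theta>)\<close>, so by the
  integral formula \<open>A\<^sup>b\<close> acts as multiplication by a number whose imaginary part has the sign of
  \<open>Im \<zeta>\<close>.  For \<open>\<theta> > pi\<close> some \<open>b < 1\<close> contradicts this.\<close>

lemma rotation_trivial:
  fixes \<psi> :: "complex \<Rightarrow> 'a"
  assumes lin: "bounded_linear \<psi>" and \<theta>: "pi < \<theta>" and lam: "0 < lam"
    and apow: "\<And>b c. \<lbrakk>0 < b; b < 1\<rbrakk> \<Longrightarrow> apow b (\<psi> c) = R 1 (\<psi> (of_real (lam powr b) * cis (\<theta> * b) * c))"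
    and cores: "\<And>c. cores (\<psi> c) = R 1 (\<psi> (of_real lam * cis \<theta> * c))"
  shows "\<psi> c = 0"
proof -
  interpret \<psi>: bounded_linear \<psi>
    by fact
  define \<zeta> where "\<zeta> = of_real lam * cis \<theta>"
  have \<theta>0: "0 < \<theta>"
    using \<theta> pi_gt_zero by linarith
  \<comment> \<open>The action of \<open>A\<close> determines that of every resolvent:
    \<open>R t\<close> divides by \<open>t + \<zeta>\<close> in the argument of
    \<open>\<psi>\<close>.\<close>
  have res: "R t (\<psi> ((of_real t + \<zeta>) * c)) = \<psi> c" if t: "0 < t" for t c
  proof -
    define x where "x = \<psi> ((1 + \<zeta>) * c)"
    have "R 1 x = R 1 (\<psi> c) + R 1 (\<psi> (\<zeta> * c))"
      by (simp add: x_def distrib_right \<psi>.add blinfun.add_right)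
    also have "\<dots> = \<psi> c"
      using cores[of c] by (simp add: \<zeta>_def cores_apply diff_eq_eq add.commute)
    finally have x: "R 1 x = \<psi> c" .
    have "R t x - R 1 x = (1 - t) *\<^sub>R R t (R 1 x)"
      using resolvent_eq_apply[OF t, of 1] by simp
    then have "R t (x - (1 - t) *\<^sub>R \<psi> c) = \<psi> c"
      by (simp add: x blinfun.diff_right blinfun.scaleR_right diff_eq_eq)
    also have "x - (1 - t) *\<^sub>R \<psi> c = \<psi> ((1 + \<zeta>) * c - (1 - t) *\<^sub>R c)"
      by (simp add: x_def \<psi>.diff \<psi>.scaleR)
    also have "(1 + \<zeta>) * c - (1 - t) *\<^sub>R c = (of_real t + \<zeta>) * c"
      by (simp add: scaleR_conv_of_real algebra_simps)
    finally show ?thesis .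
  qed
  show ?thesis
  \<comment> \<open>If \<open>\<zeta>\<close> is a negative real, the resolvent at
    \<open>- \<zeta>\<close> maps \<open>\<psi> 0 = 0\<close> to \<open>\<psi> c\<close>.\<close>
  proof (cases "\<exists>t>0. of_real t + \<zeta> = 0")
    case True
    then obtain t where t: "0 < t" "of_real t + \<zeta> = 0"
      by blast
    then show ?thesis
      using res[OF t(1), of c] by (simp add: t(2) \<psi>.zero)
  next
    case False
    have im: "Im \<zeta> = lam * sin \<theta>"
      by (simp add: \<zeta>_def)
    \<comment> \<open>Keeps the integrand away from its pole. When \<open>\<zeta>\<close> is real,
      the remaining possibility is \<open>\<zeta> = lam\<close>.\<close>
    obtain d where d: "0 < d" "\<And>r. 0 < r \<Longrightarrow> d \<le> norm (of_real r + \<zeta>)"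
    proof (cases "Im \<zeta> = 0")
      case True
      have "0 \<le> Re \<zeta>"
      proof (rule ccontr)
        assume "\<not> 0 \<le> Re \<zeta>"
        then have "0 < - Re \<zeta> \<and> of_real (- Re \<zeta>) + \<zeta> = 0"
          using True by (auto simp: complex_eq_iff)
        with False show False
          by blast
      qed
      moreover have "norm \<zeta> = lam"
        using lam by (simp add: \<zeta>_def norm_mult)
      ultimately have "Re \<zeta> = lam"
        using True by (simp add: cmod_def)
      then have "lam \<le> norm (of_real r + \<zeta>)" if "0 < r" for r
        using complex_Re_le_cmod[of "of_real r + \<zeta>"] that by simp
      then show ?thesis
        using that lam by blast
    next
      case False
      have "\<bar>Im \<zeta>\<bar> \<le> norm (of_real r + \<zeta>)" for r
        using abs_Im_le_cmod[of "of_real r + \<zeta>"] by simp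
      then show ?thesis
        using that[of "\<bar>Im \<zeta>\<bar>"] False by simp
    qed
    \<comment> \<open>As \<open>\<theta> > pi\<close>, a positive \<open>sin \<theta>\<close> forces
      \<open>\<theta> \<ge> 2 * pi\<close>, and \<open>\<theta> * b = 3 / 2 * pi\<close> is possible
      with \<open>b < 1\<close>; otherwise \<open>\<theta> * b = pi / 2\<close> is taken.\<close>
    obtain b where b: "0 < b" "b < 1" and sign: "sin (\<theta> * b) * sin \<theta> < 0 \<or> sin \<theta> = 0 \<and> sin (\<theta> * b) \<noteq> 0"
    proof (cases "0 < sin \<theta>")
      case True
      have "2 * pi \<le> \<theta>"
      proof (rule ccontr)
        assume "\<not> 2 * pi \<le> \<theta>"
        then have "sin \<theta> < 0"
          using \<theta> by (intro sin_lt_zero) auto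
        with True show False
          by simp
      qed
      then have "3 / 2 * pi / \<theta> < 1"
        using pi_gt_zero \<theta>0 by (simp add: divide_less_eq)
      moreover have "0 < 3 / 2 * pi / \<theta>"
        using \<theta>0 by simp
      moreover have "\<theta> * (3 / 2 * pi / \<theta>) = 3 / 2 * pi"
        using \<theta>0 by simp
      then have "sin (\<theta> * (3 / 2 * pi / \<theta>)) = - 1"
        by (simp only: sin_3over2_pi)
      ultimately show ?thesis
        using that[of "3 / 2 * pi / \<theta>"] True by simp
    next
      case False
      have "pi / 2 < \<theta>"
        using \<theta> pi_gt_zero by linarith
      then have "sin (\<theta> * (pi / 2 / \<theta>)) = 1" "pi / 2 / \<theta> < 1" "0 < pi / 2 / \<theta>"
        using \<theta>0 by (auto simp: divide_less_eq)
      then show ?thesis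
        using that[of "pi / 2 / \<theta>"] False by (cases "sin \<theta> = 0") auto
    qed
    define K where "K = norm \<zeta> * (1 + (1 + norm \<zeta>) / d)"
    define f where "f r = (r powr (b - 1)) *\<^sub>R (\<zeta> / (of_real r + \<zeta>))" for r
    have dom: "dominated f (\<lambda>r. K * (r powr (b - 1) / (r + 1)))"
    proof (rule dominatedI[OF b])
      have "of_real r + \<zeta> \<noteq> 0" if "0 < r" for r
        using d that by force
      then show "continuous_on {0<..} f"
        unfolding f_def by (intro continuous_intros) auto
      show "norm (f r) \<le> K * (r powr (b - 1) / (r + 1))" if "0 < r" for r
        using mult_left_mono[OF norm_complex_divide_shift[OF d that], of "r powr (b - 1)"]
        by (simp add: f_def K_def mult_ac)
    qed simp
    \<comment> \<open>The integral formula for \<open>apow\<close> with the number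
      \<open>\<zeta>\<close> in place of \<open>A\<close>.\<close>
    define p where "p = (sin (pi * b) / pi) *\<^sub>R half_integral f"
    have act: "apow b (\<psi> c) = R 1 (\<psi> (p * c))" for c
    proof -
      have blT: "bounded_linear (\<lambda>z. R 1 (\<psi> (z * c)))"
        by (intro blinfun.bounded_linear_right bounded_linear_compose[OF _ lin, unfolded comp_def]
            bounded_linear_compose[OF blinfun.bounded_linear_right bounded_linear_compose[OF lin bounded_linear_mult_left]])
      have "apow b (\<psi> c) = (sin (pi * b) / pi) *\<^sub>R half_integral (\<lambda>r. R 1 (\<psi> (f r * c)))"
        unfolding apow_apply[OF b]
      proof (intro arg_cong2[where f = scaleR] refl half_integral_cong)
        fix r :: real assume r: "0 < r"
        then have r0: "of_real r + \<zeta> \<noteq> 0"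
          using False by blast
        have "R r (cores (\<psi> c)) = R 1 (R r (\<psi> (\<zeta> * c)))"
          using cores[of c] r by (simp add: \<zeta>_def resolvent_commute)
        also have "R r (\<psi> (\<zeta> * c)) = \<psi> (\<zeta> / (of_real r + \<zeta>) * c)"
          using res[OF r, of "\<zeta> / (of_real r + \<zeta>) * c"] r0 by simp
        finally show "r powr (b - 1) *\<^sub>R R r (cores (\<psi> c)) = R 1 (\<psi> (f r * c))"
          by (simp only: f_def mult_scaleR_left \<psi>.scaleR blinfun.scaleR_right)
      qed
      also have "half_integral (\<lambda>r. R 1 (\<psi> (f r * c))) = R 1 (\<psi> (half_integral f * c))"
        by (rule half_integral_linear[OF dom blT])
      finally show ?thesis
        by (simp only: p_def mult_scaleR_left \<psi>.scaleR blinfun.scaleR_right)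
    qed
    define \<zeta>b where "\<zeta>b = of_real (lam powr b) * cis (\<theta> * b)"
    \<comment> \<open>After multiplication by \<open>sin \<theta>\<close> the imaginary part of the
      integrand is nonnegative, whereas that of \<open>\<zeta>b\<close> is negative by the choice of
      \<open>b\<close>. If \<open>sin \<theta> = 0\<close>, then \<open>p\<close> is real and
      \<open>\<zeta>b\<close> is not.\<close>
    have "p \<noteq> \<zeta>b"
    proof
      assume eq: "p = \<zeta>b"
      have s: "0 < sin (pi * b) / pi"
        using b by (intro divide_pos_pos sin_gt_zero) auto
      have Imp: "Im p = sin (pi * b) / pi * half_integral (\<lambda>r. Im (f r))"
        using half_integral_linear[OF dom bounded_linear_Im] by (simp add: p_def)
      have Imf: "Im (f r) = r powr (b - 1) * r / ((r + Re \<zeta>)\<^sup>2 + (Im \<zeta>)\<^sup>2) * lam * sin \<theta>" for r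
        by (simp add: f_def Im_divide im algebra_simps)
      obtain L where domIm: "dominated (\<lambda>r. Im (f r)) L"
        using dominated_linear[OF dom bounded_linear_Im] by blast
      have "0 \<le> half_integral (\<lambda>r. sin \<theta> * Im (f r))"
      proof -
        obtain L' where "dominated (\<lambda>r. sin \<theta> * Im (f r)) L'"
          using dominated_linear[OF domIm bounded_linear_mult_right[of "sin \<theta>"]] by blast
        moreover have "0 \<le> sin \<theta> * Im (f r)" if "0 < r" for r
        proof -
          have "sin \<theta> * Im (f r) = r powr (b - 1) * r / ((r + Re \<zeta>)\<^sup>2 + (Im \<zeta>)\<^sup>2) * lam * (sin \<theta>)\<^sup>2"
            unfolding Imf by (simp add: power2_eq_square)
          also have "0 \<le> \<dots>"
            using that lam by (intro mult_nonneg_nonneg divide_nonneg_nonneg) auto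
          finally show ?thesis .
        qed
        ultimately show ?thesis
          by (rule half_integral_nonneg)
      qed
      also have "half_integral (\<lambda>r. sin \<theta> * Im (f r)) = sin \<theta> * half_integral (\<lambda>r. Im (f r))"
        by (rule half_integral_linear[OF domIm bounded_linear_mult_right])
      finally have "0 \<le> sin (pi * b) / pi * (sin \<theta> * half_integral (\<lambda>r. Im (f r)))"
        by (rule mult_nonneg_nonneg[OF less_imp_le[OF s]])
      also have "\<dots> = sin \<theta> * Im p"
        by (simp add: Imp)
      also have "Im p = lam powr b * sin (\<theta> * b)"
        by (simp add: eq \<zeta>b_def)
      also have "sin \<theta> * (lam powr b * sin (\<theta> * b)) = lam powr b * (sin (\<theta> * b) * sin \<theta>)"
        by (simp add: mult_ac)
      finally have "0 \<le> sin (\<theta> * b) * sin \<theta>"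
        using lam by (simp add: zero_le_mult_iff)
      with sign have "sin \<theta> = 0" "sin (\<theta> * b) \<noteq> 0"
        by auto
      moreover have "Im p = 0"
      proof -
        have "half_integral (\<lambda>r. Im (f r)) = half_integral (\<lambda>r. 0 :: real)"
          by (rule half_integral_cong) (simp add: Imf \<open>sin \<theta> = 0\<close>)
        also have "\<dots> = 0"
          by (rule half_integral_eqI) simp
        finally show ?thesis
          by (simp add: Imp)
      qed
      ultimately show False
        using lam by (simp add: eq \<zeta>b_def)
    qed
    \<comment> \<open>Both descriptions of \<open>apow b\<close> on the image of
      \<open>\<psi>\<close> must agree, so \<open>\<psi>\<close> kills every multiple of the nonzero
      number \<open>p - \<zeta>b\<close>.\<close>
    have "\<psi> ((p - \<zeta>b) * c') = 0" for c'
    proof -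
      have "R 1 (\<psi> (p * c')) = R 1 (\<psi> (\<zeta>b * c'))"
        using act[of c'] apow[OF b, of c'] by (simp add: \<zeta>b_def)
      then have "R 1 (\<psi> ((p - \<zeta>b) * c')) = 0"
        by (simp add: left_diff_distrib \<psi>.diff blinfun.diff_right)
      then show ?thesis
        by (rule resolvent_inj[rotated]) simp
    qed
    from this[of "c / (p - \<zeta>b)"] show ?thesis
      using \<open>p \<noteq> \<zeta>b\<close> by simp
  qed
qed

end

lemma bounded_linear_funpow:
  fixes f :: "'b::real_normed_vector \<Rightarrow> 'b"
  shows "bounded_linear f \<Longrightarrow> bounded_linear (f ^^ n)"
  by (induction n) (auto simp: id_def comp_def intro: bounded_linear_ident bounded_linear_compose)

section \<open>The orbit of powers and its Fourier coefficients\<close>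

context resolvent_family
begin

lemma resolvent_funpow_inj:
  assumes "(blinfun_apply (R 1) ^^ n) x = (blinfun_apply (R 1) ^^ n) y"
  shows "x = y"
  using assms
proof (induction n)
  case (Suc n)
  have "R 1 ((blinfun_apply (R 1) ^^ n) x - (blinfun_apply (R 1) ^^ n) y) = 0"
    using Suc.prems by (simp add: blinfun.diff_right)
  from resolvent_inj[OF zero_less_one this] show ?case
    using Suc.IH by simp
qed simp

text \<open>The power \<open>A\<^sup>a (1 + A)\<^sup>-\<^sup>8\<close> for \<open>0 < a < 8\<close>.\<close>

definition apow8 :: "real \<Rightarrow> 'a \<Rightarrow> 'a" where
  "apow8 a = (blinfun_apply (apow (a / 8)) ^^ 8)"

lemma bounded_linear_apow8: "bounded_linear (apow8 a)"
  unfolding apow8_def by (intro bounded_linear_funpow blinfun.bounded_linear_right)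

lemma apow8_commute:
  assumes "\<And>x. T (apow (a / 8) x) = apow (a / 8) (T x)"
  shows "T (apow8 a x) = apow8 a (T x)"
  unfolding apow8_def by (rule funpow_commute_apply[symmetric]) (simp add: assms)

lemma apow8_resolvent:
  assumes "0 < a" "a < 8"
  shows "(blinfun_apply (R 1) ^^ n) (apow8 a x) = apow8 a ((blinfun_apply (R 1) ^^ n) x)"
proof (rule funpow_commute_apply[where f = "blinfun_apply (R 1)" and g = "apow8 a"])
  show "R 1 (apow8 a x) = apow8 a (R 1 x)" for x
    using assms by (intro apow8_commute) (simp add: resolvent_apow)
qed

lemma apow8_add:
  assumes "0 < a" "0 < b" "a + b < 8"
  shows "apow8 a (apow8 b x) = apow8 (a + b) ((blinfun_apply (R 1) ^^ 8) x)"
proof -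
  have "apow (a / 8) (apow (b / 8) z) = apow ((a + b) / 8) (R 1 z)" for z
    using apow_apow[of "a / 8" "b / 8"] assms by (simp add: add_divide_distrib)
  moreover have "apow8 a (apow8 b x) = ((\<lambda>x. apow (a / 8) (apow (b / 8) x)) ^^ 8) x"
    unfolding apow8_def
    by (rule funpow_compose_apply) (use assms in \<open>simp add: apow_apow_commute\<close>)
  moreover have "apow8 (a + b) ((blinfun_apply (R 1) ^^ 8) x) = ((\<lambda>x. apow ((a + b) / 8) (R 1 x)) ^^ 8) x"
    unfolding apow8_def
    by (rule funpow_compose_apply) (use assms in \<open>simp add: resolvent_apow\<close>)
  ultimately show ?thesis
    by simp
qed

text \<open>The eight factors are paired, then paired again, each pair becoming one power and one
  \<open>R 1\<close>: four such factors, then two. This stops at \<open>b / 2\<close>, which is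
  below 1 for all \<open>b < 2\<close>.\<close>

lemma apow8_halves:
  assumes b: "0 < b" "b < 2"
  shows "apow8 b x = apow (b / 2) (apow (b / 2) ((blinfun_apply (R 1) ^^ 6) x))"
proof -
  have 1: "apow (b / 8) (apow (b / 8) z) = apow (b / 4) (R 1 z)" for z
    using apow_apow[of "b / 8" "b / 8" z] b by simp
  have 2: "apow (b / 4) (apow (b / 4) z) = apow (b / 2) (R 1 z)" for z
    using apow_apow[of "b / 4" "b / 4" z] b by simp
  have 3: "R 1 (apow (b / 4) z) = apow (b / 4) (R 1 z)" "R 1 (apow (b / 2) z) = apow (b / 2) (R 1 z)" for z
    using b by (simp_all add: resolvent_apow)
  show ?thesis
    by (simp add: apow8_def numeral_eq_Suc 1[simplified] 2[simplified] 3[simplified])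
qed

lemma apow8_eq_apow:
  assumes b: "0 < b" "b < 1"
  shows "apow8 b x = apow b ((blinfun_apply (R 1) ^^ 7) x)"
  using apow_apow[of "b / 2" "b / 2" "(blinfun_apply (R 1) ^^ 6) x"] b
  by (simp add: apow8_halves numeral_eq_Suc)

lemma apow8_one: "apow8 1 x = cores ((blinfun_apply (R 1) ^^ 7) x)"
  using apow_complement[of "1 / 2" "(blinfun_apply (R 1) ^^ 6) x"]
  by (simp add: apow8_halves numeral_eq_Suc)

lemma continuous_on_apow8: "continuous_on {0<..<8} (\<lambda>a. apow8 a x)"
proof -
  have "continuous_on {0<..<8} (\<lambda>a. (blinfun_apply (apow (a / 8)) ^^ n) x)" for n
  proof (induction n)
    case (Suc n)
    have "continuous_on {0<..<8} (\<lambda>a. apow (a / 8))"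
      by (rule continuous_on_compose2[OF continuous_on_apow]) (auto intro!: continuous_intros)
    then show ?case
      using Suc by (auto intro!: blinfun.continuous_on)
  qed simp
  then show ?thesis
    by (simp add: apow8_def)
qed

text \<open>Composition with the complementary power turns \<open>apow b x = 0\<close> into
  \<open>R 1 (cores x) = 0\<close>, and \<open>R 1\<close> is injective; the rest is
  iteration.\<close>

lemma apow_eq_0_imp:
  assumes "0 < b" "b < 1" "(blinfun_apply (apow b) ^^ n) x = 0"
  shows "(blinfun_apply cores ^^ n) x = 0"
  using assms(3)
proof (induction n arbitrary: x)
  case (Suc n)
  have "apow b ((blinfun_apply (apow b) ^^ n) x) = 0"
    using Suc.prems by simp
  then have "R 1 (cores ((blinfun_apply (apow b) ^^ n) x)) = 0"
    using apow_complement[of "1 - b" "(blinfun_apply (apow b) ^^ n) x"] assms(1,2)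
    by (simp add: resolvent_cores blinfun.zero_right)
  then have "cores ((blinfun_apply (apow b) ^^ n) x) = 0"
    using resolvent_inj[OF zero_less_one] by blast
  also have "cores ((blinfun_apply (apow b) ^^ n) x) = (blinfun_apply (apow b) ^^ n) (cores x)"
    using assms(1,2) by (intro funpow_commute_apply[symmetric]) (simp add: cores_apow)
  finally have "(blinfun_apply cores ^^ n) (cores x) = 0"
    by (rule Suc.IH)
  then show ?case
    by (simp add: funpow_swap1)
qed simp

lemma apow_cores_0:
  assumes "0 < b" "b < 1" "cores x = 0"
  shows "apow b x = 0"
proof -
  have "half_integral (\<lambda>r. r powr (b - 1) *\<^sub>R R r (cores x)) = 0"
    by (rule half_integral_eqI) (simp add: assms(3) blinfun.zero_right)
  then show ?thesis
    using apow_apply[OF assms(1,2)] by simp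
qed

text \<open>Here \<open>s\<close> is half the exponent of the fractional power, so the orbit has
  period \<open>2 * s < 2\<close>.\<close>

lemma apow_apow_eigen:
  assumes s: "0 < s" "s < 1" and lam: "0 < lam"
    and eq: "apow s (apow s u) = lam powr (2 * s) *\<^sub>R R 1 (R 1 u)"
  shows "cores u = lam *\<^sub>R R 1 u"
proof -
  note linear = bounded_linear.linear[OF bounded_linear_apow8]
  define p where "p = 2 * s"
  have p: "0 < p" "p < 2"
    using s by (auto simp: p_def)
  \<comment> \<open>The orbit lives on the interval from 0 to 8, long enough for windows of one
    period together with all shifts used below.\<close>
  define y where "y a = lam powr (- a) *\<^sub>R apow8 a u" for a
  have apow8_p: "apow8 p x = apow s (apow s ((blinfun_apply (R 1) ^^ 6) x))" for x
    using apow8_halves[OF p] by (simp add: p_def)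
  have eq8: "apow8 p u = lam powr p *\<^sub>R (blinfun_apply (R 1) ^^ 8) u"
  proof -
    have "apow8 p u = (blinfun_apply (R 1) ^^ 6) (apow s (apow s u))"
      unfolding apow8_p
      by (rule funpow_commute_apply[symmetric, where f = "blinfun_apply (R 1)" and g = "\<lambda>x. apow s (apow s x)"])
        (simp add: resolvent_apow s)
    also have "\<dots> = lam powr p *\<^sub>R (blinfun_apply (R 1) ^^ 6) (R 1 (R 1 u))"
      unfolding eq p_def
      by (rule funpow_commute_apply[where g = "scaleR _"]) (simp add: blinfun.scaleR_right)
    also have "(blinfun_apply (R 1) ^^ 6) (R 1 (R 1 u)) = (blinfun_apply (R 1) ^^ 8) u"
      by (simp add: numeral_eq_Suc)
    finally show ?thesis .
  qed
  \<comment> \<open>\<open>T\<close> will be \<open>apow b\<close> or, for \<open>b = 1\<close>,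
    \<open>cores\<close>. Each agrees with \<open>apow8 b\<close> up to seven factors
    \<open>R 1\<close>, which injectivity cancels.\<close>
  have y_shift: "T (y a) = lam powr b *\<^sub>R R 1 (y (a + b))"
    if T: "linear T" "\<And>x. apow8 b x = T ((blinfun_apply (R 1) ^^ 7) x)"
      "\<And>x. R 1 (T x) = T (R 1 x)" and a: "0 < a" "0 < b" "a + b < 8" for T a b
  proof -
    have "(blinfun_apply (R 1) ^^ 7) (T (apow8 a u)) = T ((blinfun_apply (R 1) ^^ 7) (apow8 a u))"
      by (rule funpow_commute_apply) (rule T(3))
    also have "\<dots> = apow8 b (apow8 a u)"
      by (simp add: T(2))
    also have "\<dots> = apow8 (a + b) ((blinfun_apply (R 1) ^^ 8) u)"
      using apow8_add[of b a u] a by (simp add: add.commute)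
    also have "\<dots> = (blinfun_apply (R 1) ^^ 8) (apow8 (a + b) u)"
      using a by (simp add: apow8_resolvent)
    also have "\<dots> = (blinfun_apply (R 1) ^^ 7) (R 1 (apow8 (a + b) u))"
      by (simp add: numeral_eq_Suc)
    finally have "T (apow8 a u) = R 1 (apow8 (a + b) u)"
      by (rule resolvent_funpow_inj)
    moreover have "lam powr (- a) = lam powr b * lam powr (- (a + b))"
      by (simp flip: powr_add)
    ultimately show ?thesis
      using linear_scale[OF T(1)] by (simp add: y_def blinfun.scaleR_right)
  qed
  have y_apow: "apow b (y a) = lam powr b *\<^sub>R R 1 (y (a + b))" if "0 < b" "b < 1" "0 < a" "a + b < 8" for a b
    using that by (intro y_shift)
      (auto simp: apow8_eq_apow resolvent_apow intro: bounded_linear.linear blinfun.bounded_linear_right)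
  have y_cores: "cores (y a) = lam *\<^sub>R R 1 (y (a + 1))" if "0 < a" "a + 1 < 8" for a
    using y_shift[of cores 1 a] that lam
    by (simp add: apow8_one resolvent_cores bounded_linear.linear blinfun.bounded_linear_right)
  \<comment> \<open>The hypothesis in the form \<open>eq8\<close>, transported along the orbit by
    \<open>apow8 a\<close>.\<close>
  have y_per: "y (a + p) = y a" if a: "0 < a" "a + p < 8" for a
  proof -
    have "(blinfun_apply (R 1) ^^ 8) (apow8 (a + p) u) = apow8 a (apow8 p u)"
      using a p apow8_add[of a p u] by (simp add: apow8_resolvent)
    also have "\<dots> = lam powr p *\<^sub>R apow8 a ((blinfun_apply (R 1) ^^ 8) u)"
      unfolding eq8 by (rule linear_scale[OF linear])
    also have "\<dots> = lam powr p *\<^sub>R (blinfun_apply (R 1) ^^ 8) (apow8 a u)"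
      using a p by (simp add: apow8_resolvent)
    also have "\<dots> = (blinfun_apply (R 1) ^^ 8) (lam powr p *\<^sub>R apow8 a u)"
      by (rule funpow_commute_apply[where g = "scaleR _", symmetric]) (simp add: blinfun.scaleR_right)
    finally have "apow8 (a + p) u = lam powr p *\<^sub>R apow8 a u"
      by (rule resolvent_funpow_inj)
    then show ?thesis
      using lam by (simp add: y_def flip: powr_add)
  qed
  have y_cont: "continuous_on S y" if "S \<subseteq> {0<..<8}" for S
    unfolding y_def using lam that
    by (intro continuous_intros continuous_on_subset[OF continuous_on_apow8]) auto
  \<comment> \<open>The frequency is \<open>k * pi / s = 2 * pi * k / p\<close>. The window starts
    at 1 to stay inside the open interval on which the orbit is continuous.\<close>
  define I where "I k f = integral {1..1 + p} (\<lambda>x. f (k * pi / s * x) *\<^sub>R y x)" for k :: nat and f :: "real \<Rightarrow> real"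
  have trig_int: "(\<lambda>x. f (k * pi / s * x) *\<^sub>R y x) integrable_on {1..1 + p}" if "continuous_on UNIV f" for f k
    using p that s by (intro integrable_continuous_real continuous_intros y_cont continuous_on_compose2[OF that]) auto
  \<comment> \<open>By periodicity every window of length \<open>p\<close> gives the same integral;
    the phase \<open>b\<close> merely rotates the pair of coefficients.\<close>
  have window: "integral {t..t + p} (\<lambda>x. cos (k * pi / s * (x - b)) *\<^sub>R y x) =
      cos (k * pi / s * b) *\<^sub>R I k cos + sin (k * pi / s * b) *\<^sub>R I k sin"
    if t: "1 \<le> t" "t < 5" for t b and k :: nat
  proof -
    have trig: "(\<lambda>x. cos (k * pi / s * (x - b)) *\<^sub>R y x) =
        (\<lambda>x. cos (k * pi / s * b) *\<^sub>R (cos (k * pi / s * x) *\<^sub>R y x) +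
          sin (k * pi / s * b) *\<^sub>R (sin (k * pi / s * x) *\<^sub>R y x))"
    proof
      fix x
      have "cos (w * (x - b)) = cos (w * b) * cos (w * x) + sin (w * b) * sin (w * x)" for w
        by (simp add: right_diff_distrib cos_diff mult.commute)
      then show "cos (k * pi / s * (x - b)) *\<^sub>R y x =
          cos (k * pi / s * b) *\<^sub>R (cos (k * pi / s * x) *\<^sub>R y x) +
          sin (k * pi / s * b) *\<^sub>R (sin (k * pi / s * x) *\<^sub>R y x)"
        by (simp only: scaleR_left_distrib scaleR_scaleR)
    qed
    have "integral {t..t + p} (\<lambda>x. cos (k * pi / s * (x - b)) *\<^sub>R y x) =
        integral {1..1 + p} (\<lambda>x. cos (k * pi / s * (x - b)) *\<^sub>R y x)"
    proof (rule integral_periodic)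
      show "continuous_on {1..t + p} (\<lambda>x. cos (k * pi / s * (x - b)) *\<^sub>R y x)"
        using t p s by (intro continuous_intros y_cont) auto
      fix x assume x: "1 \<le> x" "x \<le> t"
      have "k * pi / s * (x + p - b) = k * pi / s * (x - b) + 2 * k * pi"
        using s by (simp add: p_def field_simps)
      then have "cos (k * pi / s * (x + p - b)) = cos (k * pi / s * (x - b))"
        by (simp only: cos_add) simp
      then show "cos (k * pi / s * (x + p - b)) *\<^sub>R y (x + p) = cos (k * pi / s * (x - b)) *\<^sub>R y x"
        using y_per[of x] x t p by simp
    qed (use t p in auto)
    also have "\<dots> = cos (k * pi / s * b) *\<^sub>R I k cos + sin (k * pi / s * b) *\<^sub>R I k sin"
      unfolding trig I_def
      by (intro integral_unique has_integral_add has_integral_cmul integrable_integral trig_int continuous_intros)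
    finally show ?thesis .
  qed
  have I_shift_cos: "integral {1..1 + p} (\<lambda>x. cos (k * pi / s * x) *\<^sub>R y (x + b)) =
      cos (k * pi / s * b) *\<^sub>R I k cos + sin (k * pi / s * b) *\<^sub>R I k sin" if b: "0 \<le> b" "b \<le> 1" for b k
    using integral_shift_Icc[of 1 "1 + p" "\<lambda>x. cos (k * pi / s * (x - b)) *\<^sub>R y x" b] window[of "1 + b" k b] b
    by (simp add: add_ac)
  have I_zero: "I k cos = 0 \<and> I k sin = 0" if k: "0 < k" for k
  proof -
    define \<theta> where "\<theta> = k * pi / s"
    have "pi * s < k * pi"
    proof -
      have "pi * s < pi * 1"
        using s by (intro mult_strict_left_mono) auto
      also have "\<dots> \<le> k * pi"
        using k by simp
      finally show ?thesis .
    qed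
    then have \<theta>: "pi < \<theta>"
      using s by (simp add: \<theta>_def less_divide_eq)
    \<comment> \<open>\<open>T\<close> translates the orbit by \<open>b\<close>, hence rotates the
      pair of coefficients by the angle \<open>\<theta> * b\<close>.\<close>
    have act: "T (I k cos) = \<kappa> *\<^sub>R R 1 (cos (\<theta> * b) *\<^sub>R I k cos + sin (\<theta> * b) *\<^sub>R I k sin) \<and>
        T (I k sin) = \<kappa> *\<^sub>R R 1 (cos (\<theta> * b) *\<^sub>R I k sin - sin (\<theta> * b) *\<^sub>R I k cos)"
      if T: "\<And>a. \<lbrakk>0 < a; a + b < 8\<rbrakk> \<Longrightarrow> T (y a) = \<kappa> *\<^sub>R R 1 (y (a + b))" and b: "0 < b" "b \<le> 1"
      for T :: "'a \<Rightarrow>\<^sub>L 'a" and \<kappa> b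
    proof -
      define S where "S = (\<lambda>z. \<kappa> *\<^sub>R R 1 z)"
      have S: "bounded_linear S"
        unfolding S_def by (intro bounded_linear_const_scaleR blinfun.bounded_linear_right)
      have shifted: "T (I k f) = S (integral {1..1 + p} (\<lambda>x. f (\<theta> * x) *\<^sub>R y (x + b)))"
        if f: "continuous_on UNIV f" for f
      proof -
        have "T (I k f) = integral {1..1 + p} (\<lambda>x. T (f (\<theta> * x) *\<^sub>R y x))"
          using integral_linear[OF trig_int[OF f, of k] blinfun.bounded_linear_right[of T]]
          by (simp add: I_def \<theta>_def comp_def)
        also have "\<dots> = integral {1..1 + p} (\<lambda>x. S (f (\<theta> * x) *\<^sub>R y (x + b)))"
          using T b p by (intro Henstock_Kurzweil_Integration.integral_cong)
            (simp add: S_def blinfun.scaleR_right)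
        also have "\<dots> = S (integral {1..1 + p} (\<lambda>x. f (\<theta> * x) *\<^sub>R y (x + b)))"
        proof (rule integral_linear[OF _ S, unfolded comp_def])
          have "continuous_on {1..1 + p} (\<lambda>x. y (x + b))"
            by (rule continuous_on_compose2[OF y_cont[of "{1..1 + p + b}"]])
              (use b p in \<open>auto intro!: continuous_intros\<close>)
          then show "(\<lambda>x. f (\<theta> * x) *\<^sub>R y (x + b)) integrable_on {1..1 + p}"
            by (intro integrable_continuous_real continuous_intros continuous_on_compose2[OF f]) auto
        qed
        finally show ?thesis .
      qed
      have 1: "integral {1..1 + p} (\<lambda>x. cos (\<theta> * x) *\<^sub>R y (x + b)) =
          cos (\<theta> * b) *\<^sub>R I k cos + sin (\<theta> * b) *\<^sub>R I k sin"
        using I_shift_cos[of b k] b by (simp add: \<theta>_def)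
      have 2: "integral {1..1 + p} (\<lambda>x. sin (\<theta> * x) *\<^sub>R y (x + b)) =
          cos (\<theta> * b) *\<^sub>R I k sin - sin (\<theta> * b) *\<^sub>R I k cos"
      proof -
        \<comment> \<open>A shift by a quarter period turns the sine into a cosine, so
          \<open>window\<close> applies again.\<close>
        define c where "c = pi / 2 / \<theta>"
        have c: "\<theta> * c = pi / 2"
          using \<theta> pi_gt_zero by (auto simp: c_def)
        have cc: "cos (\<theta> * c) = 0" "sin (\<theta> * c) = 1"
          by (simp_all only: c cos_pi_half sin_pi_half)
        have "integral {1..1 + p} (\<lambda>x. sin (\<theta> * x) *\<^sub>R y (x + b)) =
            integral {1..1 + p} (\<lambda>x. cos (\<theta> * (x + b - (b + c))) *\<^sub>R y (x + b))"
          by (simp add: right_diff_distrib cos_diff cc)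
        also have "\<dots> = integral {1 + b..1 + b + p} (\<lambda>x. cos (\<theta> * (x - (b + c))) *\<^sub>R y x)"
          using integral_shift_Icc[of 1 "1 + p" "\<lambda>x. cos (\<theta> * (x - (b + c))) *\<^sub>R y x" b]
          by (simp add: add_ac)
        also have "\<dots> = cos (\<theta> * (b + c)) *\<^sub>R I k cos + sin (\<theta> * (b + c)) *\<^sub>R I k sin"
          using window[of "1 + b" k "b + c"] b by (simp add: \<theta>_def)
        also have "\<dots> = cos (\<theta> * b) *\<^sub>R I k sin - sin (\<theta> * b) *\<^sub>R I k cos"
          by (simp add: distrib_left cos_add sin_add cc)
        finally show ?thesis .
      qed
      show ?thesis
        using shifted[of cos] shifted[of sin] unfolding 1 2 S_def
        by (simp add: continuous_on_cos continuous_on_sin continuous_on_id)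
    qed
    \<comment> \<open>The pair read as one complex coefficient: rotations become multiplication by
      \<open>cis (\<theta> * b)\<close> in the argument, without a complex structure on the
      space.\<close>
    define \<psi> where "\<psi> c = Re c *\<^sub>R I k cos + Im c *\<^sub>R I k sin" for c
    have \<psi>_zero: "\<psi> c = 0" for c
    proof (rule rotation_trivial[OF _ \<theta> lam])
      show "bounded_linear \<psi>"
        unfolding \<psi>_def by (intro bounded_linear_add bounded_linear_compose[OF bounded_linear_scaleR_left]
            bounded_linear_Re bounded_linear_Im)
      have *: "T (\<psi> c) = R 1 (\<psi> (of_real \<kappa> * cis (\<theta> * b) * c))"
        if "T (I k cos) = \<kappa> *\<^sub>R R 1 (cos (\<theta> * b) *\<^sub>R I k cos + sin (\<theta> * b) *\<^sub>R I k sin) \<and>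
        T (I k sin) = \<kappa> *\<^sub>R R 1 (cos (\<theta> * b) *\<^sub>R I k sin - sin (\<theta> * b) *\<^sub>R I k cos)"
        for T :: "'a \<Rightarrow>\<^sub>L 'a" and b \<kappa> c
      proof -
        have "T (\<psi> c) = Re c *\<^sub>R T (I k cos) + Im c *\<^sub>R T (I k sin)"
          by (simp add: \<psi>_def blinfun.add_right blinfun.scaleR_right)
        then show ?thesis
          unfolding conjunct1[OF that] conjunct2[OF that]
          by (simp add: \<psi>_def blinfun.add_right blinfun.diff_right blinfun.scaleR_right algebra_simps)
      qed
      show "apow b (\<psi> c) = R 1 (\<psi> (of_real (lam powr b) * cis (\<theta> * b) * c))" if "0 < b" "b < 1" for b c
        by (rule *[OF act]) (use that y_apow in auto)
      show "cores (\<psi> c) = R 1 (\<psi> (of_real lam * cis \<theta> * c))" for c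
        using *[OF act[of 1 cores lam]] y_cores by simp
    qed
    show ?thesis
      using \<psi>_zero[of 1] \<psi>_zero[of \<i>] by (simp add: \<psi>_def)
  qed
  \<comment> \<open>Subtracting the translate by 1 also removes the mean, the one coefficient not
    covered by \<open>I_zero\<close>. Then \<open>z 0 = 0\<close> says \<open>y 2 = y 3\<close>, and
    \<open>y_cores\<close> turns this into the eigen-equation for \<open>y 2\<close>.\<close>
  define z where "z x = y (x + 2) - y (x + 3)" for x
  have "z 0 = 0"
  proof (rule fourier_cos_coefficients_zero[OF s(1)])
    have y': "continuous_on {-s..s} (\<lambda>x. y (x + t))" if "t \<in> {2, 3}" for t
      by (rule continuous_on_compose2[OF y_cont[of "{1..4}"]]) (use s that in \<open>auto intro!: continuous_intros\<close>)
    then show "continuous_on {-s..s} z"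
      unfolding z_def by (intro continuous_on_diff) auto
    fix k :: nat
    have *: "integral {-s..s} (\<lambda>x. cos (k * pi / s * x) *\<^sub>R y (x + t)) =
        cos (k * pi / s * t) *\<^sub>R I k cos + sin (k * pi / s * t) *\<^sub>R I k sin" if t: "t \<in> {2, 3}" for t
    proof -
      have "integral {-s..s} (\<lambda>x. cos (k * pi / s * x) *\<^sub>R y (x + t)) =
          integral {t - s..t - s + p} (\<lambda>x. cos (k * pi / s * (x - t)) *\<^sub>R y x)"
        using integral_shift_Icc[of "-s" s "\<lambda>x. cos (k * pi / s * (x - t)) *\<^sub>R y x" t]
        by (simp add: p_def)
      then show ?thesis
        using window[of "t - s" k t] t s by auto
    qed
    have "integral {-s..s} (\<lambda>x. cos (k * pi / s * x) *\<^sub>R z x) =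
        integral {-s..s} (\<lambda>x. cos (k * pi / s * x) *\<^sub>R y (x + 2)) -
        integral {-s..s} (\<lambda>x. cos (k * pi / s * x) *\<^sub>R y (x + 3))"
      unfolding z_def scaleR_diff_right using s
      by (intro integral_diff integrable_continuous_real continuous_intros y') auto
    also have "\<dots> = 0"
      using *[of 2] *[of 3] I_zero[of k] by (cases "k = 0") (auto simp: I_def)
    finally show "integral {-s..s} (\<lambda>x. cos (k * pi / s * x) *\<^sub>R z x) = 0" .
  qed
  then have "cores (y 2) = lam *\<^sub>R R 1 (y 2)"
    using y_cores[of 2] by (simp add: z_def)
  then have "lam powr (- 2) *\<^sub>R cores (apow8 2 u) = lam powr (- 2) *\<^sub>R (lam *\<^sub>R R 1 (apow8 2 u))"
    by (simp add: y_def blinfun.scaleR_right mult.commute)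
  then have "cores (apow8 2 u) = lam *\<^sub>R R 1 (apow8 2 u)"
    using lam unfolding scaleR_cancel_left by simp
  \<comment> \<open>The defect of the eigen-equation for \<open>u\<close> itself. It is killed by
    \<open>apow8 2\<close>, hence by eight factors \<open>cores\<close>.\<close>
  define x where "x = cores u - lam *\<^sub>R R 1 u"
  have "apow8 2 x = cores (apow8 2 u) - lam *\<^sub>R R 1 (apow8 2 u)"
    using apow8_commute[of cores 2 u] apow8_commute[of "R 1" 2 u]
    by (simp add: x_def linear_diff[OF linear] linear_scale[OF linear] cores_apow resolvent_apow)
  then have "(blinfun_apply (apow (2 / 8)) ^^ 8) x = 0"
    using \<open>cores (apow8 2 u) = lam *\<^sub>R R 1 (apow8 2 u)\<close> by (simp add: apow8_def)
  then have "(blinfun_apply cores ^^ 8) x = 0"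
    by (rule apow_eq_0_imp[rotated 2]) auto
  moreover have "apow s (apow s x) = lam powr (2 * s) *\<^sub>R R 1 (R 1 x)"
  proof -
    have "apow s (apow s x) = cores (apow s (apow s u)) - lam *\<^sub>R R 1 (apow s (apow s u))"
      using s by (simp add: x_def blinfun.diff_right blinfun.scaleR_right cores_apow resolvent_apow)
    then show ?thesis
      by (simp add: eq x_def blinfun.diff_right blinfun.scaleR_right resolvent_cores scaleR_diff_right)
  qed
  \<comment> \<open>If \<open>cores\<close> kills \<open>x\<close>, so does \<open>apow s\<close>,
    and the power equation with its nonzero factor leaves \<open>R 1 (R 1 x) = 0\<close>. Since
    \<open>cores x\<close> satisfies the same equation, induction handles iterates.\<close>
  moreover have "x = 0" if "(blinfun_apply cores ^^ n) x = 0" "apow s (apow s x) = lam powr (2 * s) *\<^sub>R R 1 (R 1 x)" for n x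
    using that
  proof (induction n arbitrary: x)
    case (Suc n)
    have "(blinfun_apply cores ^^ n) (cores x) = 0"
      using Suc.prems(1) by (simp only: funpow_Suc_right comp_apply)
    moreover have "apow s (apow s (cores x)) = lam powr (2 * s) *\<^sub>R R 1 (R 1 (cores x))"
    proof -
      have "apow s (apow s (cores x)) = cores (apow s (apow s x))"
        using s by (simp add: cores_apow)
      also have "\<dots> = lam powr (2 * s) *\<^sub>R R 1 (R 1 (cores x))"
        unfolding Suc.prems(2) by (simp add: blinfun.scaleR_right resolvent_cores)
      finally show ?thesis .
    qed
    ultimately have "cores x = 0"
      by (rule Suc.IH)
    then have "apow s (apow s x) = 0"
      using apow_cores_0[OF s] by (simp add: blinfun.zero_right)
    then have "R 1 (R 1 x) = 0"
      using Suc.prems(2) lam by simp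
    then show ?case
      using resolvent_inj[OF zero_less_one] by blast
  qed simp
  ultimately have "x = 0"
    by blast
  then show ?thesis
    by (simp add: x_def)
qed

end

section \<open>Nonnegative operators\<close>

lemma maps_to_op_inverse_imp: "maps_to (op_inverse T) u v \<Longrightarrow> maps_to T v u"
  unfolding maps_to_def op_inverse_def op_range_def
  by (auto simp: inv_into_into f_inv_into_f)

lemma maps_to_op_inverse:
  assumes "inj_on (app T) (domn T)"
  shows "maps_to (op_inverse T) u v \<longleftrightarrow> maps_to T v u"
proof
  assume "maps_to T v u"
  then show "maps_to (op_inverse T) u v"
    using assms unfolding maps_to_def op_inverse_def op_range_def by (auto simp: inv_into_f_f)
qed (rule maps_to_op_inverse_imp)

lemma boundedly_invertible_inj: "boundedly_invertible A \<Longrightarrow> one_to_one A"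
  unfolding boundedly_invertible_def one_to_one_def by (blast intro: bij_betw_imp_inj_on)

lemma linear_operator_zero: "linear_operator A \<Longrightarrow> app A 0 = 0"
  unfolding linear_operator_def by (metis scaleR_zero_left subspace_0)

lemma linear_operator_scale:
  "\<lbrakk>linear_operator A; u \<in> domn A\<rbrakk> \<Longrightarrow> c *\<^sub>R u \<in> domn A \<and> app A (c *\<^sub>R u) = c *\<^sub>R app A u"
  unfolding linear_operator_def by (simp add: subspace_scale)

lemma linear_operator_add:
  "\<lbrakk>linear_operator A; u \<in> domn A; v \<in> domn A\<rbrakk> \<Longrightarrow> u + v \<in> domn A \<and> app A (u + v) = app A u + app A v"
  unfolding linear_operator_def by (simp add: subspace_add)

lemma linear_operator_diff:
  assumes "linear_operator A" "u \<in> domn A" "v \<in> domn A"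
  shows "u - v \<in> domn A \<and> app A (u - v) = app A u - app A v"
  using linear_operator_add[OF assms(1,2), of "- 1 *\<^sub>R v"] linear_operator_scale[OF assms(1,3), of "- 1"]
  by simp

lemma maps_to_scale:
  "\<lbrakk>linear_operator A; maps_to A u v\<rbrakk> \<Longrightarrow> maps_to A (c *\<^sub>R u) (c *\<^sub>R v)"
  unfolding maps_to_def using linear_operator_scale by auto

text \<open>An explicit two-sided inverse of \<open>t + A\<close> with the right bound both proves
  nonnegativity and identifies the resolvent; applied to shifts and inverses.\<close>

lemma nonnegative_operatorI:
  assumes lin: "linear_operator A"
    and right: "\<And>t x. 0 < t \<Longrightarrow> S t x \<in> domn A \<and> t *\<^sub>R S t x + app A (S t x) = x"
    and left: "\<And>t u. \<lbrakk>0 < t; u \<in> domn A\<rbrakk> \<Longrightarrow> S t (t *\<^sub>R u + app A u) = u"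
    and bound: "\<And>t x. 0 < t \<Longrightarrow> norm (S t x) \<le> M / t * norm x"
  shows "nonnegative_operator A" "0 < t \<Longrightarrow> resolvent A t x = S t x"
proof -
  have bij: "bij_betw (app (op_shift t A)) (domn (op_shift t A)) UNIV" if "0 < t" for t
    by (rule bij_betw_byWitness[where f' = "S t"]) (use left right that in \<open>auto simp: op_shift_def\<close>)
  have res: "resolvent A t x = S t x" if "0 < t" for t x
    unfolding resolvent_def op_inverse_def operator.sel
    by (rule inv_into_f_eq[OF bij_betw_imp_inj_on[OF bij[OF that]]])
      (use right[OF that] in \<open>auto simp: op_shift_def\<close>)
  then show "0 < t \<Longrightarrow> resolvent A t x = S t x" .
  have "boundedly_invertible (op_shift t A)" if "0 < t" for t
    unfolding boundedly_invertible_def bounded_operator_def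
    using bij[OF that] bound[OF that] res[OF that] by (auto simp: resolvent_def intro!: exI[of _ "M / t"])
  moreover have "onorm (\<lambda>x. t *\<^sub>R resolvent A t x) \<le> max M 0" if "0 < t" for t
  proof (rule onorm_bound)
    fix x
    have "t * norm (S t x) \<le> M * norm x"
      using mult_left_mono[OF bound[OF that, of x], of t] that by simp
    also have "\<dots> \<le> max M 0 * norm x"
      by (intro mult_right_mono) auto
    finally show "norm (t *\<^sub>R resolvent A t x) \<le> max M 0 * norm x"
      using that by (simp add: res)
  qed simp
  ultimately show "nonnegative_operator A"
    using lin unfolding nonnegative_operator_def by (auto intro!: bdd_aboveI2)
qed

context
  fixes A :: "'a::banach operator"
  assumes nonneg: "nonnegative_operator A"
begin

lemma nonnegative_linear: "linear_operator A"
  using nonneg by (simp add: nonnegative_operator_def)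

lemma resolvent_bij: "0 < t \<Longrightarrow> bij_betw (\<lambda>u. t *\<^sub>R u + app A u) (domn A) UNIV"
  using nonneg by (simp add: nonnegative_operator_def boundedly_invertible_def op_shift_def)

lemma resolvent_eq_inv: "resolvent A t x = inv_into (domn A) (\<lambda>u. t *\<^sub>R u + app A u) x"
  by (simp add: resolvent_def op_inverse_def op_shift_def)

lemma resolvent_domn: "0 < t \<Longrightarrow> resolvent A t x \<in> domn A"
  unfolding resolvent_eq_inv using resolvent_bij[of t] by (intro inv_into_into) (simp add: bij_betw_def)

lemma resolvent_right: "0 < t \<Longrightarrow> t *\<^sub>R resolvent A t x + app A (resolvent A t x) = x"
  unfolding resolvent_eq_inv using resolvent_bij[of t]
  using f_inv_into_f[of x "\<lambda>u. t *\<^sub>R u + app A u" "domn A"] by (simp add: bij_betw_def)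

lemma resolvent_left: "\<lbrakk>0 < t; u \<in> domn A\<rbrakk> \<Longrightarrow> resolvent A t (t *\<^sub>R u + app A u) = u"
  unfolding resolvent_eq_inv using resolvent_bij[of t]
  using inv_into_f_f[of "\<lambda>u. t *\<^sub>R u + app A u" "domn A" u] by (simp add: bij_betw_def)

lemma resolvent_eqI: "\<lbrakk>0 < t; u \<in> domn A; t *\<^sub>R u + app A u = x\<rbrakk> \<Longrightarrow> resolvent A t x = u"
  using resolvent_left by blast

lemma bounded_linear_resolvent:
  assumes t: "0 < t"
  shows "bounded_linear (resolvent A t)"
proof -
  have "boundedly_invertible (op_shift t A)"
    using nonneg t by (simp add: nonnegative_operator_def)
  then have bnd: "bounded_operator (op_inverse (op_shift t A))"
    by (simp add: boundedly_invertible_def)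
  have "domn (op_inverse (op_shift t A)) = UNIV"
    using \<open>boundedly_invertible _\<close>
    by (simp add: boundedly_invertible_def bij_betw_def op_inverse_def op_range_def)
  with bnd obtain C where "\<And>x. norm (resolvent A t x) \<le> C * norm x"
    unfolding bounded_operator_def resolvent_def by auto
  then have C: "norm (resolvent A t x) \<le> norm x * C" for x
    by (simp add: mult.commute)
  show ?thesis
  proof (rule bounded_linear_intro[OF _ _ C])
    fix x y
    show "resolvent A t (x + y) = resolvent A t x + resolvent A t y"
    proof (rule resolvent_eqI[OF t])
      note add = linear_operator_add[OF nonnegative_linear resolvent_domn[OF t, of x] resolvent_domn[OF t, of y]]
      then show "resolvent A t x + resolvent A t y \<in> domn A"
        by blast
      have "t *\<^sub>R (resolvent A t x + resolvent A t y) + app A (resolvent A t x + resolvent A t y) =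
          (t *\<^sub>R resolvent A t x + app A (resolvent A t x)) + (t *\<^sub>R resolvent A t y + app A (resolvent A t y))"
        using add by (simp add: scaleR_add_right)
      then show "t *\<^sub>R (resolvent A t x + resolvent A t y) + app A (resolvent A t x + resolvent A t y) = x + y"
        by (simp add: resolvent_right[OF t])
    qed
  next
    fix c x
    show "resolvent A t (c *\<^sub>R x) = c *\<^sub>R resolvent A t x"
    proof (rule resolvent_eqI[OF t])
      note scale = linear_operator_scale[OF nonnegative_linear resolvent_domn[OF t, of x], of c]
      then show "c *\<^sub>R resolvent A t x \<in> domn A"
        by blast
      have "t *\<^sub>R (c *\<^sub>R resolvent A t x) + app A (c *\<^sub>R resolvent A t x) =
          c *\<^sub>R (t *\<^sub>R resolvent A t x + app A (resolvent A t x))"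
        using scale by (simp add: scaleR_add_right mult.commute)
      then show "t *\<^sub>R (c *\<^sub>R resolvent A t x) + app A (c *\<^sub>R resolvent A t x) = c *\<^sub>R x"
        by (simp add: resolvent_right[OF t])
    qed
  qed
qed

text \<open>Bundled so that operator norms are available; the value is meaningful for
  \<open>t > 0\<close>, the only parameters in the axioms of
  \<open>resolvent_family\<close>.\<close>

definition res :: "real \<Rightarrow> 'a \<Rightarrow>\<^sub>L 'a" where
  "res t = Blinfun (resolvent A t)"

lemma res_apply: "0 < t \<Longrightarrow> res t x = resolvent A t x"
  by (simp add: res_def bounded_linear_Blinfun_apply bounded_linear_resolvent)

lemma resolvent_bound: "\<exists>M. \<forall>t>0. \<forall>x. norm (resolvent A t x) \<le> M / t * norm x"
proof -
  obtain M where M: "\<And>t. 0 < t \<Longrightarrow> onorm (\<lambda>x. t *\<^sub>R resolvent A t x) \<le> M"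
    using nonneg unfolding nonnegative_operator_def bdd_above_def by auto
  have "norm (resolvent A t x) \<le> M / t * norm x" if t: "0 < t" for t x
  proof -
    have "t * norm (resolvent A t x) = norm (t *\<^sub>R resolvent A t x)"
      using t by simp
    also have "\<dots> \<le> onorm (\<lambda>x. t *\<^sub>R resolvent A t x) * norm x"
      by (rule onorm[OF bounded_linear_const_scaleR[OF bounded_linear_resolvent[OF t]]])
    also have "\<dots> \<le> M * norm x"
      by (rule mult_right_mono[OF M[OF t]]) simp
    finally show ?thesis
      using t by (simp add: field_simps)
  qed
  then show ?thesis
    by blast
qed

lemma resolvent_family_res: "\<exists>M. resolvent_family res M"
proof -
  obtain M where M: "\<And>t x. 0 < t \<Longrightarrow> norm (resolvent A t x) \<le> M / t * norm x"
    using resolvent_bound by blast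
  have "resolvent_family res (max M 0)"
  proof
    fix s t :: real assume st: "0 < s" "0 < t"
    show "res s - res t = (t - s) *\<^sub>R (res s o\<^sub>L res t)"
    proof (rule blinfun_eqI)
      fix x
      define w where "w = resolvent A t x"
      have linear_add_scale: "resolvent A s (p + c *\<^sub>R q) = resolvent A s p + c *\<^sub>R resolvent A s q" for p q c
        using bounded_linear.linear[OF bounded_linear_resolvent[OF st(1)]]
        by (simp add: linear_add linear_scale)
      \<comment> \<open>\<open>x = (t + A) w\<close> is rewritten as
        \<open>(s + A) w + (t - s) w\<close>.\<close>
      have "resolvent A s x = resolvent A s ((s *\<^sub>R w + app A w) + (t - s) *\<^sub>R w)"
        using resolvent_right[OF st(2), of x] by (simp add: w_def algebra_simps)
      also have "\<dots> = resolvent A s (s *\<^sub>R w + app A w) + (t - s) *\<^sub>R resolvent A s w"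
        by (rule linear_add_scale)
      also have "resolvent A s (s *\<^sub>R w + app A w) = w"
        unfolding w_def by (intro resolvent_left resolvent_domn st)
      finally show "(res s - res t) x = ((t - s) *\<^sub>R (res s o\<^sub>L res t)) x"
        using st by (simp add: blinfun.diff_left blinfun.scaleR_left res_apply w_def)
    qed
  next
    fix t :: real assume t: "0 < t"
    show "norm (res t) \<le> max M 0 / t"
    proof (rule norm_blinfun_bound)
      show "norm (res t x) \<le> max M 0 / t * norm x" for x
      proof -
        have "M / t * norm x \<le> max M 0 / t * norm x"
          using t by (intro mult_right_mono divide_right_mono) auto
        then show ?thesis
          using M[OF t, of x] by (simp add: res_apply t)
      qed
    qed (use t in auto)
  next
    fix t x assume "0 < t" "res t x = 0"
    then show "x = 0"
      using resolvent_right[of t x] linear_operator_zero[OF nonnegative_linear] by (simp add: res_apply)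
  qed
  then show ?thesis ..
qed

end

lemma nonnegative_operator_shift:
  assumes A: "nonnegative_operator A" and e: "0 < e"
  shows "nonnegative_operator (op_shift e A)" "0 < t \<Longrightarrow> resolvent (op_shift e A) t x = resolvent A (t + e) x"
proof -
  obtain M where M: "\<And>t x. 0 < t \<Longrightarrow> norm (resolvent A t x) \<le> M / t * norm x"
    using resolvent_bound[OF A] by blast
  have lin: "linear_operator (op_shift e A)"
    using nonnegative_linear[OF A] unfolding linear_operator_def op_shift_def
    by (simp add: algebra_simps)
  have right: "resolvent A (t + e) x \<in> domn (op_shift e A) \<and>
      t *\<^sub>R resolvent A (t + e) x + app (op_shift e A) (resolvent A (t + e) x) = x" if "0 < t" for t x
    using resolvent_right[OF A, of "t + e" x] resolvent_domn[OF A, of "t + e" x] that e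
    by (simp add: op_shift_def scaleR_add_left add.assoc)
  have left: "resolvent A (t + e) (t *\<^sub>R u + app (op_shift e A) u) = u"
    if "0 < t" "u \<in> domn (op_shift e A)" for t u
    using resolvent_left[OF A, of "t + e" u] that e by (simp add: op_shift_def scaleR_add_left add.assoc)
  have bound: "norm (resolvent A (t + e) x) \<le> max M 0 / t * norm x" if "0 < t" for t x
  proof -
    have "M / (t + e) \<le> max M 0 / (t + e)" "max M 0 / (t + e) \<le> max M 0 / t"
      using that e by (auto intro!: divide_right_mono divide_left_mono)
    then have "M / (t + e) * norm x \<le> max M 0 / t * norm x"
      by (intro mult_right_mono) auto
    then show ?thesis
      using M[of "t + e" x] that e by simp
  qed
  show "nonnegative_operator (op_shift e A)"
    by (rule nonnegative_operatorI(1)[OF lin right left bound])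
  show "0 < t \<Longrightarrow> resolvent (op_shift e A) t x = resolvent A (t + e) x"
    by (rule nonnegative_operatorI(2)[OF lin right left bound])
qed

lemma nonnegative_operator_inverse:
  assumes A: "nonnegative_operator A" and inj: "one_to_one A"
  shows "nonnegative_operator (op_inverse A)"
    "0 < t \<Longrightarrow> resolvent (op_inverse A) t x = (1 / t) *\<^sub>R (x - (1 / t) *\<^sub>R resolvent A (1 / t) x)"
proof -
  obtain M where M: "\<And>t x. 0 < t \<Longrightarrow> norm (resolvent A t x) \<le> M / t * norm x"
    using resolvent_bound[OF A] by blast
  note lin = nonnegative_linear[OF A]
  \<comment> \<open>\<open>(t + A\<^sup>-\<^sup>1)\<^sup>-\<^sup>1 = A (1 + t
    A)\<^sup>-\<^sup>1\<close>, expressed by the resolvent of \<open>A\<close> at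
    \<open>1 / t\<close>.\<close>
  define S where "S t x = (1 / t) *\<^sub>R (x - (1 / t) *\<^sub>R resolvent A (1 / t) x)" for t x
  have inv: "app A u \<in> domn (op_inverse A) \<and> app (op_inverse A) (app A u) = u" if "u \<in> domn A" for u
    using that inj unfolding op_inverse_def op_range_def one_to_one_def by (auto simp: inv_into_f_f)
  have domE: "\<exists>w\<in>domn A. u = app A w" if "u \<in> domn (op_inverse A)" for u
    using that by (auto simp: op_inverse_def op_range_def)
  have linT: "linear_operator (op_inverse A)"
    unfolding linear_operator_def
  proof (intro conjI ballI allI)
    show "subspace (domn (op_inverse A))"
      unfolding subspace_def
    proof (intro conjI ballI allI)
      show "0 \<in> domn (op_inverse A)"
        using inv[of 0] linear_operator_zero[OF lin] lin by (simp add: linear_operator_def subspace_0)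
      fix u v assume "u \<in> domn (op_inverse A)" "v \<in> domn (op_inverse A)"
      then show "u + v \<in> domn (op_inverse A)"
        using domE inv linear_operator_add[OF lin] by metis
    next
      fix c u assume "u \<in> domn (op_inverse A)"
      then show "c *\<^sub>R u \<in> domn (op_inverse A)"
        using domE inv linear_operator_scale[OF lin] by metis
    qed
    fix u v assume "u \<in> domn (op_inverse A)" "v \<in> domn (op_inverse A)"
    then show "app (op_inverse A) (u + v) = app (op_inverse A) u + app (op_inverse A) v"
      using domE inv linear_operator_add[OF lin] by metis
  next
    fix c u assume "u \<in> domn (op_inverse A)"
    then show "app (op_inverse A) (c *\<^sub>R u) = c *\<^sub>R app (op_inverse A) u"
      using domE inv linear_operator_scale[OF lin] by metis
  qed
  have right: "S t x \<in> domn (op_inverse A) \<and> t *\<^sub>R S t x + app (op_inverse A) (S t x) = x" if t: "0 < t" for t x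
  proof -
    \<comment> \<open>The preimage of \<open>S t x\<close> under \<open>A\<close>, that is, the
      value of the inverse at \<open>S t x\<close>.\<close>
    define w where "w = (1 / t) *\<^sub>R resolvent A (1 / t) x"
    have w: "w \<in> domn A" "app A w = S t x"
    proof -
      have s: "w \<in> domn A \<and> app A w = (1 / t) *\<^sub>R app A (resolvent A (1 / t) x)"
        unfolding w_def using t by (intro linear_operator_scale[OF lin] resolvent_domn[OF A]) auto
      then show "w \<in> domn A"
        by blast
      have "app A (resolvent A (1 / t) x) = x - (1 / t) *\<^sub>R resolvent A (1 / t) x"
        using resolvent_right[OF A, of "1 / t" x] t by (simp add: eq_diff_eq add.commute)
      with s show "app A w = S t x"
        by (simp add: S_def)
    qed
    have "t *\<^sub>R S t x + w = x"
      using t by (simp add: S_def w_def)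
    then show ?thesis
      using inv[OF w(1)] by (simp add: w(2))
  qed
  have left: "S t (t *\<^sub>R u + app (op_inverse A) u) = u" if t: "0 < t" and u: "u \<in> domn (op_inverse A)" for t u
  proof -
    obtain w where w: "w \<in> domn A" "u = app A w"
      using domE[OF u] by blast
    have "t *\<^sub>R u + w = t *\<^sub>R ((1 / t) *\<^sub>R w + app A w)"
      using t by (simp add: w scaleR_add_right)
    then have "resolvent A (1 / t) (t *\<^sub>R u + w) = t *\<^sub>R w"
      using resolvent_left[OF A, of "1 / t" w] t w
        linear_scale[OF bounded_linear.linear[OF bounded_linear_resolvent[OF A, of "1 / t"]]] by simp
    then show ?thesis
      using t w inv[OF w(1)] by (simp add: S_def)
  qed
  have bound: "norm (S t x) \<le> (1 + M) / t * norm x" if t: "0 < t" for t x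
  proof -
    have "norm ((1 / t) *\<^sub>R resolvent A (1 / t) x) \<le> M * norm x"
      using M[of "1 / t" x] t by (simp add: field_simps)
    then have "norm (x - (1 / t) *\<^sub>R resolvent A (1 / t) x) \<le> (1 + M) * norm x"
      using norm_triangle_ineq4[of x "(1 / t) *\<^sub>R resolvent A (1 / t) x"] by (simp add: distrib_right)
    then have "(1 / t) * norm (x - (1 / t) *\<^sub>R resolvent A (1 / t) x) \<le> (1 / t) * ((1 + M) * norm x)"
      using t by (intro mult_left_mono) auto
    then show ?thesis
      using t by (simp add: S_def)
  qed
  show "nonnegative_operator (op_inverse A)"
    by (rule nonnegative_operatorI(1)[OF linT right left bound])
  show "0 < t \<Longrightarrow> resolvent (op_inverse A) t x = (1 / t) *\<^sub>R (x - (1 / t) *\<^sub>R resolvent A (1 / t) x)"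
    unfolding S_def[symmetric] by (rule nonnegative_operatorI(2)[OF linT right left bound])
qed

section \<open>The integral formulas for powers\<close>

lemma power_exponent_cases:
  assumes "0 < (s::real)"
  obtains n :: nat and b where "0 < b" "b \<le> 1" "s = b + real n"
proof -
  have "0 \<le> \<lceil>s\<rceil> - 1"
    using assms by simp
  then have "real (nat (\<lceil>s\<rceil> - 1)) = of_int \<lceil>s\<rceil> - 1"
    by simp
  then show ?thesis
    using that[of "s - real (nat (\<lceil>s\<rceil> - 1))" "nat (\<lceil>s\<rceil> - 1)"] by linarith
qed

lemma J_power_eq:
  assumes "0 < b" "b \<le> 1"
  shows "J_power A (b + real n) = Operator
    (if b < 1 then domn (op_power A (n + 1)) else domn (op_power A (n + 2)))
    (\<lambda>u. J_low A b (app (op_power A n) u))"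
proof -
  have "\<lceil>b + real n\<rceil> = int n + 1"
    using assms by (intro ceiling_unique) auto
  then have "nat (\<lceil>b + real n\<rceil> - 1) = n"
    by simp
  then show ?thesis
    unfolding J_power_def Let_def by simp
qed

lemma J_power_domn:
  assumes "0 < b" "b \<le> 1" "u \<in> domn (J_power A (b + real n))"
  shows "app (op_power A n) u \<in> domn A" "u \<in> domn (op_power A n)"
    "b = 1 \<Longrightarrow> app A (app (op_power A n) u) \<in> domn A"
  using assms by (auto simp: J_power_eq op_comp_def split: if_splits)

text \<open>At exponent 1 the factor \<open>sin (s * pi)\<close> is 0 and
  \<open>sin (s * pi / 2)\<close> is 1.\<close>

lemma J_low_one: "J_low A 1 u = app A u"
  by (simp add: J_low_def)

lemma op_power_eigenvector:
  assumes "linear_operator A" "maps_to A u (lam *\<^sub>R u)"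
  shows "maps_to (op_power A n) u (lam ^ n *\<^sub>R u)"
proof (induction n)
  case (Suc n)
  have "maps_to A (lam ^ n *\<^sub>R u) (lam ^ n *\<^sub>R (lam *\<^sub>R u))"
    by (rule maps_to_scale[OF assms])
  with Suc show ?case
    by (auto simp: maps_to_def op_comp_def mult.commute)
qed (simp add: maps_to_def)

context
  fixes A :: "'a::banach operator"
  assumes nonneg: "nonnegative_operator A"
begin

text \<open>For large \<open>r\<close> the resolvent decays like \<open>1 / r\<close>; near 0 the
  vector \<open>(r + A)\<^sup>-\<^sup>1 A u = u - r (r + A)\<^sup>-\<^sup>1 u\<close> stays bounded.
  Adding the two bounds produces the denominator \<open>r + 1\<close>.\<close>

lemma dominated_J_low:
  assumes u: "u \<in> domn A" and s: "0 < s" "s < 1"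
  shows "\<exists>g. dominated (\<lambda>r. r powr (s - 1) *\<^sub>R res A r (app A u)) g"
proof -
  obtain M where "resolvent_family (res A) M"
    using resolvent_family_res[OF nonneg] by blast
  then interpret resolvent_family "res A" M .
  define K where "K = M * norm (app A u) + (1 + M) * norm u"
  have "dominated (\<lambda>r. r powr (s - 1) *\<^sub>R res A r (app A u)) (\<lambda>r. K * (r powr (s - 1) / (r + 1)))"
  proof (rule dominatedI[OF s])
    show "continuous_on {0<..} (\<lambda>r. r powr (s - 1) *\<^sub>R res A r (app A u))"
      by (intro continuous_intros blinfun.continuous_on continuous_on_resolvent) auto
    fix r :: real assume r: "0 < r"
    have rR: "r * norm (res A r x) \<le> M * norm x" for x
    proof -
      have "norm (res A r x) \<le> M / r * norm x"
        by (rule order_trans[OF norm_blinfun mult_right_mono[OF norm_resolvent[OF r]]]) simp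
      then show ?thesis
        using r by (simp add: field_simps)
    qed
    have "res A r (app A u) = u - r *\<^sub>R res A r u"
    proof -
      have "res A r (r *\<^sub>R u + app A u) = u"
        using resolvent_left[OF nonneg r u] by (simp add: res_apply[OF nonneg r])
      then show ?thesis
        by (simp add: blinfun.add_right blinfun.scaleR_right eq_diff_eq add.commute)
    qed
    then have "norm (res A r (app A u)) \<le> norm u + r * norm (res A r u)"
      using norm_triangle_ineq4[of u "r *\<^sub>R res A r u"] r by simp
    then have "(r + 1) * norm (res A r (app A u)) \<le> K"
      using rR[of u] rR[of "app A u"] by (simp add: K_def distrib_right)
    then have "norm (res A r (app A u)) \<le> K * (1 / (r + 1))"
      using r by (simp add: field_simps)
    from mult_left_mono[OF this, of "r powr (s - 1)"]
    show "norm (r powr (s - 1) *\<^sub>R res A r (app A u)) \<le> K * (r powr (s - 1) / (r + 1))"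
      by (simp add: mult_ac)
  qed simp
  then show ?thesis
    by blast
qed

lemma J_low_eq:
  assumes u: "u \<in> domn A" and s: "0 < s" "s < 1"
  shows "J_low A s u = (sin (pi * s) / pi) *\<^sub>R half_integral (\<lambda>r. r powr (s - 1) *\<^sub>R res A r (app A u))"
proof -
  obtain g where g: "dominated (\<lambda>r. r powr (s - 1) *\<^sub>R res A r (app A u)) g"
    using dominated_J_low[OF assms] by blast
  define G where "G r = r powr (s - 1) *\<^sub>R resolvent A r (app A u)" for r
  have eq: "r powr (s - 1) *\<^sub>R res A r (app A u) = G r" if "0 < r" for r
    using that by (simp add: G_def res_apply[OF nonneg])
  have "dominated G g"
    using g dominated_cong[of _ G g, OF eq] by blast
  then have "halfline_integral G = half_integral (\<lambda>r. r powr (s - 1) *\<^sub>R res A r (app A u))"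
    using halfline_integral_eq[of G g] half_integral_cong[of _ G, OF eq] by simp
  then show ?thesis
    using s by (simp add: J_low_def G_def[abs_def] mult.commute)
qed

lemma J_low_eigenvector:
  assumes u: "maps_to A u (lam *\<^sub>R u)" and lam: "0 < lam" and s: "0 < s" "s \<le> 1"
  shows "J_low A s u = lam powr s *\<^sub>R u"
proof (cases "s = 1")
  case True
  then show ?thesis
    using u lam by (simp add: J_low_one maps_to_def)
next
  case False
  then have s: "0 < s" "s < 1"
    using s by auto
  have u': "u \<in> domn A" "app A u = lam *\<^sub>R u"
    using u by (auto simp: maps_to_def)
  have eq: "r powr (s - 1) *\<^sub>R res A r (app A u) = (r powr (s - 1) / (r + lam)) *\<^sub>R (lam *\<^sub>R u)" if r: "0 < r" for r
  proof -
    have "res A r ((r + lam) *\<^sub>R u) = u"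
      using resolvent_left[OF nonneg r u'(1)] by (simp add: res_apply[OF nonneg r] u' scaleR_add_left)
    then have "(1 / (r + lam)) *\<^sub>R ((r + lam) *\<^sub>R res A r u) = (1 / (r + lam)) *\<^sub>R u"
      by (simp only: blinfun.scaleR_right)
    then have "res A r u = (1 / (r + lam)) *\<^sub>R u"
      using r lam by simp
    then show ?thesis
      by (simp add: u' blinfun.scaleR_right)
  qed
  have "J_low A s u = (sin (pi * s) / pi) *\<^sub>R half_integral (\<lambda>r. (r powr (s - 1) / (r + lam)) *\<^sub>R (lam *\<^sub>R u))"
    unfolding J_low_eq[OF u'(1) s] by (intro arg_cong[where f = "scaleR _"] half_integral_cong eq)
  also have "\<dots> = lam powr (s - 1) *\<^sub>R (lam *\<^sub>R u)"
    by (rule half_integral_stieltjes_kernel[OF s lam])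
  also have "\<dots> = lam powr s *\<^sub>R u"
    using lam powr_mult_base[of lam "s - 1"] by (simp add: mult.commute)
  finally show ?thesis .
qed

lemma J_power_eigenvector:
  assumes u: "maps_to A u (lam *\<^sub>R u)" and lam: "0 < lam" and s: "0 < s"
  shows "maps_to (J_power A s) u (lam powr s *\<^sub>R u)"
proof -
  obtain n b where b: "0 < b" "b \<le> 1" "s = b + real n"
    using power_exponent_cases[OF s] by blast
  note lin = nonnegative_linear[OF nonneg]
  have pow: "maps_to (op_power A k) u (lam ^ k *\<^sub>R u)" for k
    by (rule op_power_eigenvector[OF lin u])
  have "maps_to A (lam ^ n *\<^sub>R u) (lam *\<^sub>R (lam ^ n *\<^sub>R u))"
    using maps_to_scale[OF lin u, of "lam ^ n"] by (simp add: mult.commute)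
  then have "J_low A b (lam ^ n *\<^sub>R u) = lam powr b *\<^sub>R (lam ^ n *\<^sub>R u)"
    by (rule J_low_eigenvector[OF _ lam b(1,2)])
  then have "J_low A b (app (op_power A n) u) = lam powr s *\<^sub>R u"
    using pow[of n] lam by (simp add: maps_to_def b(3) powr_add powr_realpow)
  then show ?thesis
    unfolding b(3) J_power_eq[OF b(1,2)]
    using pow[of "n + 1"] pow[of "n + 2"] by (simp add: maps_to_def)
qed

end

lemma (in resolvent_family) apow_shift_resolvent:
  assumes "0 < b" "b < 1" "0 < m"
  shows "apow_shift b m (R 1 x) = R 1 (apow_shift b m x)"
proof -
  have "(cores + m *\<^sub>R R 1) (R 1 x) = R 1 ((cores + m *\<^sub>R R 1) x)"
    by (simp add: blinfun.add_left blinfun.add_right blinfun.scaleR_left blinfun.scaleR_right resolvent_cores)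
  moreover have "rpow b m (R 1 z) = R 1 (rpow b m z)" for z
    using resolvent_rpow[OF assms, of 1] by (metis blinfun_apply_blinfun_compose zero_less_one)
  ultimately show ?thesis
    by (simp add: apow_shift_def)
qed

lemma one_to_one_op_inverse: "one_to_one (op_inverse A)"
  unfolding one_to_one_def
proof (rule inj_onI)
  fix x y assume "x \<in> domn (op_inverse A)" "y \<in> domn (op_inverse A)"
    "app (op_inverse A) x = app (op_inverse A) y"
  then show "x = y"
    using maps_to_op_inverse_imp[of A x "app (op_inverse A) x"]
      maps_to_op_inverse_imp[of A y "app (op_inverse A) y"] by (simp add: maps_to_def)
qed

section \<open>From powers back to the operator\<close>

context
  fixes A :: "'a::banach operator"
  assumes nonneg: "nonnegative_operator A"
begin

lemma cores_res:
  assumes "u \<in> domn A"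
  shows "resolvent_family.cores (res A) u = res A 1 (app A u)"
proof -
  obtain M where "resolvent_family (res A) M"
    using resolvent_family_res[OF nonneg] by blast
  then interpret resolvent_family "res A" M .
  have "res A 1 (u + app A u) = u"
    using resolvent_left[OF nonneg zero_less_one assms] by (simp add: res_apply[OF nonneg])
  then show ?thesis
    by (simp add: cores_apply blinfun.add_right diff_eq_eq add.commute)
qed

text \<open>With \<open>w = (1 + A)\<^sup>-\<^sup>1 u\<close> the hypothesis reads
  \<open>u = (1 + lam) w\<close>, which places \<open>u\<close> in the domain of
  \<open>A\<close>.\<close>

lemma eigenvector_if_cores:
  assumes eq: "resolvent_family.cores (res A) u = lam *\<^sub>R res A 1 u"
  shows "maps_to A u (lam *\<^sub>R u)"
proof -
  obtain M where "resolvent_family (res A) M"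
    using resolvent_family_res[OF nonneg] by blast
  then interpret resolvent_family "res A" M .
  define w where "w = resolvent A 1 u"
  have w: "w \<in> domn A" "w + app A w = u"
    using resolvent_domn[OF nonneg, of 1 u] resolvent_right[OF nonneg, of 1 u] by (simp_all add: w_def)
  have "u = (1 + lam) *\<^sub>R w"
    using eq by (simp add: cores_apply w_def res_apply[OF nonneg] diff_eq_eq scaleR_add_left add.commute)
  moreover from this w(2) have "app A w = lam *\<^sub>R w"
    by (simp add: scaleR_add_left)
  ultimately show ?thesis
    using linear_operator_scale[OF nonnegative_linear[OF nonneg] w(1), of "1 + lam"]
    by (simp add: maps_to_def mult.commute)
qed

text \<open>Under the integral \<open>R 1 A u\<close> becomes \<open>cores u\<close>, which is
  bounded in \<open>u\<close>.\<close>

lemma res_J_low: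
  assumes u: "u \<in> domn A" and s: "0 < s" "s < 1"
  shows "res A 1 (J_low A s u) = resolvent_family.apow (res A) s u"
proof -
  obtain M where "resolvent_family (res A) M"
    using resolvent_family_res[OF nonneg] by blast
  then interpret resolvent_family "res A" M .
  obtain g where g: "dominated (\<lambda>r. r powr (s - 1) *\<^sub>R res A r (app A u)) g"
    using dominated_J_low[OF nonneg u s] by blast
  have "res A 1 (half_integral (\<lambda>r. r powr (s - 1) *\<^sub>R res A r (app A u))) =
      half_integral (\<lambda>r. res A 1 (r powr (s - 1) *\<^sub>R res A r (app A u)))"
    by (rule half_integral_linear[OF g blinfun.bounded_linear_right, symmetric])
  also have "\<dots> = half_integral (\<lambda>r. r powr (s - 1) *\<^sub>R res A r (cores u))"
    by (rule half_integral_cong) (simp add: blinfun.scaleR_right resolvent_commute cores_res[OF u])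
  finally show ?thesis
    by (simp add: J_low_eq[OF nonneg u s] apow_apply[OF s] blinfun.scaleR_right)
qed

text \<open>The exponent is halved because \<open>apow\<close> covers exponents below 1. The three
  formulas for \<open>J_power\<close> below exponent 2 match the three composition laws of
  \<open>apow\<close>.\<close>

lemma apow_half_apow_half:
  assumes u: "maps_to (J_power A s) u w" and s: "0 < s" "s < 2"
  shows "resolvent_family.apow (res A) (s / 2) (resolvent_family.apow (res A) (s / 2) u) = res A 1 (res A 1 w)"
proof -
  obtain M where "resolvent_family (res A) M"
    using resolvent_family_res[OF nonneg] by blast
  then interpret resolvent_family "res A" M .
  consider "s < 1" | "s = 1" | "1 < s"
    by linarith
  then show ?thesis
  proof cases
    case 1
    have "J_power A s = Operator (domn (op_power A 1)) (J_low A s)"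
      using J_power_eq[of s A 0] s(1) 1 by simp
    then have "u \<in> domn A" "J_low A s u = w"
      using u by (auto simp: maps_to_def op_comp_def)
    then have "res A 1 w = apow s u"
      using res_J_low[of u s] s(1) 1 by simp
    then show ?thesis
      using apow_apow[of "s / 2" "s / 2" u] s(1) 1 by (simp add: resolvent_apow)
  next
    case 2
    have "J_power A 1 = Operator (domn (op_power A 2)) (J_low A 1)"
      using J_power_eq[of 1 A 0] by (simp add: numeral_2_eq_2)
    then have "u \<in> domn A" "app A u = w"
      using u 2 by (auto simp: maps_to_def op_comp_def J_low_one numeral_2_eq_2)
    then have "res A 1 w = cores u"
      using cores_res[of u] by simp
    then show ?thesis
      using apow_complement[of "1 / 2" u] 2 by (simp add: resolvent_cores)
  next
    case 3
    have "J_power A s = Operator (domn (op_power A 2)) (\<lambda>u. J_low A (s - 1) (app (op_power A 1) u))"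
      using J_power_eq[of "s - 1" A 1] s 3 by (simp add: numeral_2_eq_2)
    then have u': "u \<in> domn A" "app A u \<in> domn A" "J_low A (s - 1) (app A u) = w"
      using u by (auto simp: maps_to_def op_comp_def numeral_2_eq_2)
    then have "res A 1 w = apow (s - 1) (app A u)"
      using res_J_low[of "app A u" "s - 1"] s 3 by simp
    then have "res A 1 (res A 1 w) = apow (s - 1) (cores u)"
      using s 3 by (simp add: resolvent_apow cores_res[OF u'(1)])
    then show ?thesis
      using apow_apow'[of "s / 2" "s / 2" u] s 3 by simp
  qed
qed

lemma eigenvector_if_apow:
  assumes eq: "resolvent_family.apow (res A) (s / 2) (resolvent_family.apow (res A) (s / 2) u) =
      lam powr s *\<^sub>R res A 1 (res A 1 u)"
    and s: "0 < s" "s < 2" and lam: "0 < lam"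
  shows "maps_to A u (lam *\<^sub>R u)"
proof -
  obtain M where "resolvent_family (res A) M"
    using resolvent_family_res[OF nonneg] by blast
  then interpret resolvent_family "res A" M .
  have "cores u = lam *\<^sub>R res A 1 u"
    by (rule apow_apow_eigen[of "s / 2"]) (use eq s lam in auto)
  then show ?thesis
    by (rule eigenvector_if_cores)
qed

lemma eigenvector_if_J_power:
  assumes u: "maps_to (J_power A s) u (lam powr s *\<^sub>R u)" and s: "0 < s" "s < 2" and lam: "0 < lam"
  shows "maps_to A u (lam *\<^sub>R u)"
  using apow_half_apow_half[OF u s] s lam
  by (intro eigenvector_if_apow) (simp_all add: blinfun.scaleR_right)

text \<open>Required before \<open>op_inverse\<close> of a power acts as a true inverse. If two
  fractional powers agree, \<open>cores\<close> and hence \<open>A\<close> vanish on the difference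
  of the vectors.\<close>

lemma J_power_inj:
  assumes inj: "one_to_one A" and s: "0 < s"
  shows "inj_on (app (J_power A s)) (domn (J_power A s))"
proof (rule inj_onI)
  obtain M where "resolvent_family (res A) M"
    using resolvent_family_res[OF nonneg] by blast
  then interpret resolvent_family "res A" M .
  note lin = nonnegative_linear[OF nonneg]
  have injA: "u = v" if "u \<in> domn A" "v \<in> domn A" "app A u = app A v" for u v
    using inj that unfolding one_to_one_def by (blast dest: inj_onD)
  obtain n b where b: "0 < b" "b \<le> 1" "s = b + real n"
    using power_exponent_cases[OF s] by blast
  have inj_pow: "u = v" if "u \<in> domn (op_power A k)" "v \<in> domn (op_power A k)"
      "app (op_power A k) u = app (op_power A k) v" for k u v
    using that
  proof (induction k arbitrary: u v)
    case (Suc k)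
    then show ?case
      using injA by (simp add: op_comp_def)
  qed simp
  have inj_low: "u = v" if uv: "u \<in> domn A" "v \<in> domn A" "J_low A b u = J_low A b v" for u v
  proof (cases "b = 1")
    case True
    then show ?thesis
      using uv injA by (simp add: J_low_one)
  next
    case False
    then have b1: "b < 1"
      using b by simp
    have "apow b (u - v) = 0"
      using arg_cong[OF uv(3), of "res A 1"] uv(1,2) by (simp add: res_J_low b(1) b1 blinfun.diff_right)
    then have "cores (u - v) = 0"
      using apow_eq_0_imp[of b 1 "u - v"] b(1) b1 by simp
    then have "res A 1 (app A (u - v)) = 0"
      using cores_res[of "u - v"] linear_operator_diff[OF lin uv(1,2)] by simp
    then have "app A (u - v) = 0"
      by (rule resolvent_inj[OF zero_less_one])
    then show ?thesis
      using linear_operator_diff[OF lin uv(1,2)] injA[OF uv(1,2)] by simp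
  qed
  fix u v
  assume "u \<in> domn (J_power A s)" "v \<in> domn (J_power A s)" "app (J_power A s) u = app (J_power A s) v"
  then show "u = v"
    using J_power_domn[OF b(1,2), of u A n] J_power_domn[OF b(1,2), of v A n] inj_low inj_pow
    unfolding b(3) by (simp add: J_power_eq[OF b(1,2)])
qed

text \<open>With \<open>T = (e + A)\<^sup>-\<^sup>1\<close> the last claim is \<open>(t +
  T)\<^sup>-\<^sup>1 T = (1 / t) (1 / t + e + A)\<^sup>-\<^sup>1\<close>, which expresses the
  integrand of \<open>J_low T\<close> by resolvents of \<open>A\<close>.\<close>

lemma maps_to_inverse_shift:
  assumes e: "0 < e" and v: "maps_to (op_inverse (op_shift e A)) v w"
  shows "w = res A e v" "w \<in> domn A" "0 < t \<Longrightarrow> resolvent (op_inverse (op_shift e A)) t w = (1 / t) *\<^sub>R res A (1 / t + e) v"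
proof -
  have w: "w \<in> domn A" "e *\<^sub>R w + app A w = v"
    using maps_to_op_inverse_imp[OF v] by (auto simp: maps_to_def op_shift_def)
  then show "w = res A e v" "w \<in> domn A"
    using resolvent_eqI[OF nonneg e w] by (simp_all add: res_apply[OF nonneg e])
  assume t: "0 < t"
  have te: "0 < 1 / t + e"
    using t e by (simp add: add_pos_pos)
  note lin = bounded_linear.linear[OF bounded_linear_resolvent[OF nonneg te]]
  have S: "nonnegative_operator (op_shift e A)" "one_to_one (op_shift e A)"
    using nonnegative_operator_shift(1)[OF nonneg e] nonneg e boundedly_invertible_inj
    by (auto simp: nonnegative_operator_def)
  have "resolvent A (1 / t + e) ((1 / t) *\<^sub>R w + v) = w"
    using resolvent_left[OF nonneg te w(1)] by (simp add: w(2)[symmetric] scaleR_add_left add.assoc)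
  then have "(1 / t) *\<^sub>R resolvent A (1 / t + e) w + resolvent A (1 / t + e) v = w"
    by (simp only: linear_add[OF lin] linear_scale[OF lin])
  then have "w - (1 / t) *\<^sub>R resolvent A (1 / t + e) w = resolvent A (1 / t + e) v"
    by (simp only: diff_eq_eq add.commute)
  then show "resolvent (op_inverse (op_shift e A)) t w = (1 / t) *\<^sub>R res A (1 / t + e) v"
    using nonnegative_operator_inverse(2)[OF S t, of w] nonnegative_operator_shift(2)[OF nonneg e, of "1 / t" w] t te
    by (simp add: res_apply[OF nonneg])
qed

text \<open>Both sides are \<open>(e + A) powr (- s)\<close> applied to \<open>v\<close>: replacing
  \<open>r\<close> by \<open>1 / r\<close> turns the integral for the power of the inverse into the
  one defining \<open>rpow (1 - s) e\<close>.\<close>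

lemma J_low_inverse_shift:
  assumes e: "0 < e" and v: "maps_to (op_inverse (op_shift e A)) v w" and s: "0 < s" "s < 1"
  shows "J_low (op_inverse (op_shift e A)) s v = resolvent_family.rpow (res A) (1 - s) e v"
proof -
  obtain M where "resolvent_family (res A) M"
    using resolvent_family_res[OF nonneg] by blast
  then interpret resolvent_family "res A" M .
  define T where "T = op_inverse (op_shift e A)"
  have T: "nonnegative_operator T"
    unfolding T_def using nonneg e boundedly_invertible_inj
    by (intro nonnegative_operator_inverse(1) nonnegative_operator_shift(1))
      (auto simp: nonnegative_operator_def)
  have v': "v \<in> domn T" "app T v = w"
    using v by (auto simp: maps_to_def T_def)
  have b: "0 < 1 - s" "1 - s < 1"
    using s by auto
  define f where "f r = (r powr (1 - s - 1) *\<^sub>R res A (r + e)) v" for r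
  have "r powr (s - 1) *\<^sub>R res T r (app T v) = (1 / r\<^sup>2) *\<^sub>R f (1 / r)" if r: "0 < r" for r
  proof -
    have "r powr (s - 1) * (1 / r) = 1 / r\<^sup>2 * (1 / r) powr (1 - s - 1)"
    proof -
      have "(1 / r) powr (- s) = r powr s"
        using r by (simp add: powr_divide powr_minus_divide)
      moreover have "r powr s = r powr (s - 1) * r"
        using powr_mult_base[of r "s - 1"] r by (simp add: mult.commute)
      ultimately show ?thesis
        using r by (simp add: power2_eq_square)
    qed
    then show ?thesis
      using maps_to_inverse_shift(3)[OF e v r] r
      by (simp add: res_apply[OF T r] v'(2) T_def[symmetric] f_def blinfun.scaleR_left)
  qed
  then have "J_low T s v = (sin (pi * s) / pi) *\<^sub>R half_integral (\<lambda>r. (1 / r\<^sup>2) *\<^sub>R f (1 / r))"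
    unfolding J_low_eq[OF T v'(1) s] by (intro arg_cong[where f = "scaleR _"] half_integral_cong)
  also have "half_integral (\<lambda>r. (1 / r\<^sup>2) *\<^sub>R f (1 / r)) = half_integral f"
  proof (rule half_integral_inverse)
    show "continuous_on {0<..} f"
      unfolding f_def using continuous_on_rpow_integrand[OF e]
      by (intro blinfun.continuous_on continuous_on_const)
  qed
  also have "half_integral f = half_integral (\<lambda>r. r powr (1 - s - 1) *\<^sub>R res A (r + e)) v"
    unfolding f_def by (rule half_integral_linear[OF dominated_rpow[OF b e] blinfun.bounded_linear_left])
  also have "sin (pi * s) = sin (pi * (1 - s))"
    by (simp add: right_diff_distrib)
  finally show ?thesis
    by (simp add: T_def rpow_def blinfun.scaleR_left)
qed

text \<open>Here \<open>v\<close> is \<open>(e + A) powr s\<close> applied to \<open>u\<close>, so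
  this is \<open>apow_half_apow_half\<close> for the shifted operator, in a form that survives the
  limit of \<open>e\<close> to 0.\<close>

lemma apow_shift_half_apow_shift_half:
  assumes e: "0 < e" and s: "0 < s" "s < 2"
    and v: "maps_to (J_power (op_inverse (op_shift e A)) s) v u"
  shows "resolvent_family.apow_shift (res A) (s / 2) e (resolvent_family.apow_shift (res A) (s / 2) e u) =
    res A 1 (res A 1 v)"
proof -
  obtain M where "resolvent_family (res A) M"
    using resolvent_family_res[OF nonneg] by blast
  then interpret resolvent_family "res A" M .
  define T where "T = op_inverse (op_shift e A)"
  have Tv: "maps_to T x (res A e x)" if "x \<in> domn T" for x
    using maps_to_inverse_shift(1)[OF e, of x "app T x"] that by (auto simp: T_def maps_to_def)
  \<comment> \<open>\<open>rpow b e\<close> is \<open>(e + A) powr (- s / 2)\<close>; two such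
    factors give \<open>(e + A) powr (- s)\<close> in each of the three ranges of
    \<open>s\<close>.\<close>
  define b where "b = 1 - s / 2"
  have b: "0 < b" "b < 1" "0 < s / 2" "s / 2 < 1"
    using s by (auto simp: b_def)
  have "u = rpow b e (rpow b e v)"
  proof -
    consider "s < 1" | "s = 1" | "1 < s"
      by linarith
    then show ?thesis
    proof cases
      case 1
      have "J_power T s = Operator (domn (op_power T 1)) (J_low T s)"
        using J_power_eq[of s T 0] s(1) 1 by simp
      then have "v \<in> domn T" "J_low T s v = u"
        using v by (auto simp: maps_to_def op_comp_def T_def)
      then have "u = rpow (1 - s) e v"
        using J_low_inverse_shift[OF e Tv[unfolded T_def] s(1) 1, of v] by (simp add: T_def)
      also have "\<dots> = (rpow b e o\<^sub>L rpow b e) v"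
        using rpow_compose[OF b(1,2) b(1,2) _ e] s 1 by (simp add: b_def)
      finally show ?thesis
        by simp
    next
      case 2
      have "J_power T 1 = Operator (domn (op_power T 2)) (J_low T 1)"
        using J_power_eq[of 1 T 0] by (simp add: numeral_2_eq_2)
      then have "v \<in> domn T" "app T v = u"
        using v 2 by (auto simp: maps_to_def op_comp_def J_low_one numeral_2_eq_2 T_def)
      then have "u = res A e v"
        using Tv[of v] by (simp add: maps_to_def)
      also have "\<dots> = (rpow b e o\<^sub>L rpow b e) v"
        using rpow_complement[OF b(1,2) e] 2 by (simp add: b_def)
      finally show ?thesis
        by simp
    next
      case 3
      have "J_power T s = Operator (domn (op_power T 2)) (\<lambda>u. J_low T (s - 1) (app (op_power T 1) u))"
        using J_power_eq[of "s - 1" T 1] s 3 by (simp add: numeral_2_eq_2)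
      then have v': "v \<in> domn T" "app T v \<in> domn T" "J_low T (s - 1) (app T v) = u"
        using v by (auto simp: maps_to_def op_comp_def numeral_2_eq_2 T_def)
      then have "u = rpow (1 - (s - 1)) e (app T v)"
        using J_low_inverse_shift[OF e Tv[unfolded T_def], of "app T v" "s - 1"] s 3 by (simp add: T_def)
      also have "\<dots> = (res A e o\<^sub>L rpow (b + b) e) v"
        using Tv[OF v'(1)] resolvent_rpow[of "b + b" e e] s 3 e by (simp add: maps_to_def b_def)
      also have "\<dots> = (rpow b e o\<^sub>L rpow b e) v"
        using rpow_compose'[OF b(1,1) _ e] s 3 by (simp add: b_def)
      finally show ?thesis
        by simp
    qed
  qed
  then have "apow_shift (s / 2) e (apow_shift (s / 2) e u) =
      apow_shift (s / 2) e (apow_shift (s / 2) e (rpow (1 - s / 2) e (rpow (1 - s / 2) e v)))"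
    by (simp add: b_def)
  also have "\<dots> = res A 1 (res A 1 v)"
    by (simp add: apow_shift_rpow[OF b(3,4) e] apow_shift_resolvent[OF b(3,4) e])
  finally show ?thesis .
qed

end

section \<open>The cases in the definition of fractional powers\<close>

text \<open>Guarantees that \<open>regular_power\<close> of every shift goes through the inverse
  when \<open>A\<close> is unbounded.\<close>

lemma not_bounded_operator_shift:
  fixes A :: "'a::banach operator"
  assumes "\<not> bounded_operator A"
  shows "\<not> bounded_operator (op_shift e A)"
proof
  assume "bounded_operator (op_shift e A)"
  then obtain C where C: "\<And>u. u \<in> domn A \<Longrightarrow> norm (e *\<^sub>R u + app A u) \<le> C * norm u"
    by (auto simp: bounded_operator_def op_shift_def)
  have "norm (app A u) \<le> (C + \<bar>e\<bar>) * norm u" if "u \<in> domn A" for u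
    using C[OF that] norm_triangle_ineq4[of "e *\<^sub>R u + app A u" "e *\<^sub>R u"] by (simp add: distrib_right)
  with assms show False
    by (auto simp: bounded_operator_def)
qed

lemma regular_power_eigenvector:
  assumes A: "nonnegative_operator A" and inj: "one_to_one A"
    and u: "maps_to A u (lam *\<^sub>R u)" and lam: "0 < lam" and s: "0 < s"
  shows "maps_to (op_inverse (J_power (op_inverse A) s)) u (lam powr s *\<^sub>R u)"
proof -
  have inv: "maps_to (op_inverse A) (lam *\<^sub>R u) u"
    using inj u by (simp add: maps_to_op_inverse one_to_one_def)
  have T: "nonnegative_operator (op_inverse A)"
    by (rule nonnegative_operator_inverse[OF A inj])
  \<comment> \<open>The power of the inverse has to send \<open>lam powr s *\<^sub>R u\<close> to
    \<open>u\<close>, so this multiple is the eigenvector to start from.\<close>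
  have "maps_to (op_inverse A) (lam powr s *\<^sub>R u) ((1 / lam) *\<^sub>R (lam powr s *\<^sub>R u))"
    using maps_to_scale[OF nonnegative_linear[OF T] inv, of "lam powr s / lam"] lam by simp
  from J_power_eigenvector[OF T this _ s]
  have "maps_to (J_power (op_inverse A) s) (lam powr s *\<^sub>R u) u"
    using lam by (simp add: powr_divide)
  then show ?thesis
    by (simp add: maps_to_op_inverse[OF J_power_inj[OF T one_to_one_op_inverse s]])
qed

lemma op_shift_eigenvector: "maps_to A u (lam *\<^sub>R u) \<Longrightarrow> maps_to (op_shift e A) u ((lam + e) *\<^sub>R u)"
  by (auto simp: maps_to_def op_shift_def scaleR_add_left add.commute)

lemma boundedly_invertible_shift: "\<lbrakk>nonnegative_operator A; 0 < e\<rbrakk> \<Longrightarrow> boundedly_invertible (op_shift e A)"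
  by (simp add: nonnegative_operator_def)

lemma frac_power_eigenvector:
  assumes A: "nonnegative_operator A" and u: "maps_to A u (lam *\<^sub>R u)" and lam: "0 < lam" and s: "0 < s"
  shows "maps_to (frac_power A s) u (lam powr s *\<^sub>R u)"
proof -
  consider "bounded_operator A" | "\<not> bounded_operator A" "boundedly_invertible A"
    | "\<not> bounded_operator A" "\<not> boundedly_invertible A"
    by blast
  then show ?thesis
  proof cases
    case 1
    then show ?thesis
      using J_power_eigenvector[OF A u lam s] by (simp add: frac_power_def regular_power_def)
  next
    case 2
    then show ?thesis
      using regular_power_eigenvector[OF A boundedly_invertible_inj u lam s]
      by (simp add: frac_power_def regular_power_def)
  next
    case 3
    have reg: "maps_to (regular_power (op_shift e A) s) u ((lam + e) powr s *\<^sub>R u)" if e: "0 < e" for e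
      using regular_power_eigenvector[OF nonnegative_operator_shift(1)[OF A e]
          boundedly_invertible_inj[OF boundedly_invertible_shift[OF A e]] op_shift_eigenvector[OF u], of s]
        not_bounded_operator_shift[OF 3(1)] lam e s
      by (simp add: regular_power_def)
    have ev: "\<forall>\<^sub>F e in at_right 0. u \<in> domn (regular_power (op_shift e A) s)"
      by (rule eventually_mono[OF eventually_at_right_less]) (use reg in \<open>simp add: maps_to_def\<close>)
    have "((\<lambda>e. (lam + e) powr s *\<^sub>R u) \<longlongrightarrow> (lam + 0) powr s *\<^sub>R u) (at_right 0)"
      by (intro tendsto_scaleR tendsto_powr tendsto_add tendsto_const tendsto_ident_at) (use lam in auto)
    moreover have "\<forall>\<^sub>F e in at_right 0. (lam + e) powr s *\<^sub>R u = app (regular_power (op_shift e A) s) u"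
      by (rule eventually_mono[OF eventually_at_right_less]) (use reg in \<open>simp add: maps_to_def\<close>)
    ultimately have lim: "((\<lambda>e. app (regular_power (op_shift e A) s) u) \<longlongrightarrow> lam powr s *\<^sub>R u) (at_right 0)"
      using Lim_transform_eventually by fastforce
    with ev 3 show ?thesis
      by (auto simp: frac_power_def maps_to_def intro!: tendsto_Lim)
  qed
qed

lemma eigenvector_if_frac_power:
  assumes A: "nonnegative_operator A" and lam: "0 < lam" and s: "0 < s" "s < 2"
    and u: "maps_to (frac_power A s) u (lam powr s *\<^sub>R u)"
  shows "maps_to A u (lam *\<^sub>R u)"
proof -
  consider "bounded_operator A" | "\<not> bounded_operator A" "boundedly_invertible A"
    | "\<not> bounded_operator A" "\<not> boundedly_invertible A"
    by blast
  then show ?thesis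
  proof cases
    case 1
    then have "maps_to (J_power A s) u (lam powr s *\<^sub>R u)"
      using u by (simp add: frac_power_def regular_power_def)
    then show ?thesis
      by (rule eigenvector_if_J_power[OF A _ s lam])
  next
    case 2
    have T: "nonnegative_operator (op_inverse A)"
      by (rule nonnegative_operator_inverse(1)[OF A]) (rule boundedly_invertible_inj[OF 2(2)])
    have "maps_to (J_power (op_inverse A) s) (lam powr s *\<^sub>R u) u"
      by (rule maps_to_op_inverse_imp) (use u 2 in \<open>simp add: frac_power_def regular_power_def\<close>)
    \<comment> \<open>Rewritten as a power equation for the inverse, with eigenvalue
      \<open>1 / lam\<close> and eigenvector \<open>lam powr s *\<^sub>R u\<close>.\<close>
    then have "maps_to (J_power (op_inverse A) s) (lam powr s *\<^sub>R u) ((1 / lam) powr s *\<^sub>R (lam powr s *\<^sub>R u))"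
      using lam by (simp add: powr_divide)
    then have "maps_to (op_inverse A) (lam powr s *\<^sub>R u) ((1 / lam) *\<^sub>R (lam powr s *\<^sub>R u))"
      by (rule eigenvector_if_J_power[OF T _ s]) (use lam in simp)
    then have "maps_to A ((1 / lam) *\<^sub>R (lam powr s *\<^sub>R u)) (lam powr s *\<^sub>R u)"
      by (rule maps_to_op_inverse_imp)
    from maps_to_scale[OF nonnegative_linear[OF A] this, of "lam / lam powr s"] show ?thesis
      using lam by simp
  next
    case 3
    obtain M where "resolvent_family (res A) M"
      using resolvent_family_res[OF A] by blast
    then interpret resolvent_family "res A" M .
    define v where "v e = app (regular_power (op_shift e A) s) u" for e
    \<comment> \<open>Membership in the domain includes existence of the limit, so
      \<open>Lim\<close> is a genuine limit here and not a default value.\<close>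
    have dom: "\<forall>\<^sub>F e in at_right 0. u \<in> domn (regular_power (op_shift e A) s)"
      and ex: "\<exists>w. (v \<longlongrightarrow> w) (at_right 0)" and Lim: "Lim (at_right 0) v = lam powr s *\<^sub>R u"
      using u 3 by (auto simp: frac_power_def maps_to_def v_def[abs_def])
    from ex obtain w where w: "(v \<longlongrightarrow> w) (at_right 0)"
      by blast
    then have "w = lam powr s *\<^sub>R u"
      using Lim tendsto_Lim[OF trivial_limit_at_right_real w] by simp
    with w have v: "(v \<longlongrightarrow> lam powr s *\<^sub>R u) (at_right 0)"
      by simp
    have b: "0 < s / 2" "s / 2 < 1"
      using s by auto
    \<comment> \<open>Varying domains cause no trouble in the limit: bounded operators converge in
      norm on one side, the vectors \<open>v e\<close> on the other.\<close>
    have "((\<lambda>e. apow_shift (s / 2) e (apow_shift (s / 2) e u)) \<longlongrightarrow> apow (s / 2) (apow (s / 2) u)) (at_right 0)"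
      by (intro blinfun.tendsto apow_shift_tendsto tendsto_const b)
    moreover have "\<forall>\<^sub>F e in at_right 0. apow_shift (s / 2) e (apow_shift (s / 2) e u) = res A 1 (res A 1 (v e))"
      using dom eventually_at_right_less[of 0]
    proof eventually_elim
      case (elim e)
      have "maps_to (op_inverse (J_power (op_inverse (op_shift e A)) s)) u (v e)"
        using elim(1) not_bounded_operator_shift[OF 3(1)] by (simp add: maps_to_def regular_power_def v_def)
      then show ?case
        by (rule apow_shift_half_apow_shift_half[OF A elim(2) s maps_to_op_inverse_imp])
    qed
    ultimately have "((\<lambda>e. res A 1 (res A 1 (v e))) \<longlongrightarrow> apow (s / 2) (apow (s / 2) u)) (at_right 0)"
      by (rule Lim_transform_eventually)
    moreover have "((\<lambda>e. res A 1 (res A 1 (v e))) \<longlongrightarrow> res A 1 (res A 1 (lam powr s *\<^sub>R u))) (at_right 0)"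
      by (intro blinfun.tendsto tendsto_const v)
    ultimately have "apow (s / 2) (apow (s / 2) u) = res A 1 (res A 1 (lam powr s *\<^sub>R u))"
      by (rule tendsto_unique[OF trivial_limit_at_right_real])
    then have "apow (s / 2) (apow (s / 2) u) = lam powr s *\<^sub>R res A 1 (res A 1 u)"
      by (simp add: blinfun.scaleR_right)
    then show ?thesis
      by (rule eigenvector_if_apow[OF A _ s lam])
  qed
qed

lemma frac_power_eigenvector_iff:
  assumes "nonnegative_operator A" "0 < lam" "0 < s" "s < 2"
  shows "maps_to (frac_power A s) u (lam powr s *\<^sub>R u) \<longleftrightarrow> maps_to A u (lam *\<^sub>R u)"
  using eigenvector_if_frac_power frac_power_eigenvector assms by blast

lemma op_inverse_eigenvector_iff:
  assumes A: "nonnegative_operator A" and inj: "one_to_one A" and lam: "0 < lam"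
  shows "maps_to (op_inverse A) u ((1 / lam) *\<^sub>R u) \<longleftrightarrow> maps_to A u (lam *\<^sub>R u)"
proof -
  have "maps_to A ((1 / lam) *\<^sub>R u) u \<longleftrightarrow> maps_to A u (lam *\<^sub>R u)"
    using maps_to_scale[OF nonnegative_linear[OF A], of "(1 / lam) *\<^sub>R u" u lam]
      maps_to_scale[OF nonnegative_linear[OF A], of u "lam *\<^sub>R u" "1 / lam"] lam by auto
  then show ?thesis
    using inj by (simp add: maps_to_op_inverse one_to_one_def)
qed

theorem theorem2p1:
  fixes A :: "'a::banach operator" and lam :: real and u :: 'a
  assumes "nonnegative_operator A" and "lam > 0"
  shows
    "((\<exists>s. 0 < s \<and> s < 2 \<and> maps_to (frac_power A s) u ((lam powr s) *\<^sub>R u)) \<longleftrightarrow>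
      (\<forall>s>0. maps_to (frac_power A s) u ((lam powr s) *\<^sub>R u)))
     \<and>
     (one_to_one A \<longrightarrow>
      ((\<exists>s. 0 < s \<and> s < 2 \<and> maps_to (frac_power A s) u ((lam powr s) *\<^sub>R u)) \<longleftrightarrow>
       (\<exists>s. 0 < s \<and> s < 2 \<and> maps_to (neg_frac_power A s) u ((lam powr (-s)) *\<^sub>R u)))
      \<and>
      ((\<exists>s. 0 < s \<and> s < 2 \<and> maps_to (frac_power A s) u ((lam powr s) *\<^sub>R u)) \<longleftrightarrow>
       (\<forall>s>0. maps_to (neg_frac_power A s) u ((lam powr (-s)) *\<^sub>R u))))"
proof -
  \<comment> \<open>From the universal statement the instance \<open>s = 1\<close> leads back to the
    eigen-equation.\<close>
  have some: "(\<exists>s. 0 < s \<and> s < 2 \<and> maps_to (frac_power B s) u (k powr s *\<^sub>R u)) \<longleftrightarrow> maps_to B u (k *\<^sub>R u)"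
    and all: "(\<forall>s>0. maps_to (frac_power B s) u (k powr s *\<^sub>R u)) \<longleftrightarrow> maps_to B u (k *\<^sub>R u)"
    if "nonnegative_operator B" "0 < k" for B :: "'a operator" and k
    using frac_power_eigenvector_iff[OF that] frac_power_eigenvector[OF that(1) _ that(2)]
    by (metis one_less_numeral_iff semiring_norm(76) zero_less_one)+
  \<comment> \<open>With this, statements (3) and (4) are (1) and (2) for the inverse operator and
    \<open>1 / lam\<close>.\<close>
  have neg: "lam powr (- s) = (1 / lam) powr s" for s
    using assms(2) by (simp add: powr_divide powr_minus_divide)
  show ?thesis
    unfolding neg_frac_power_def neg
    using some[OF assms] all[OF assms] some[OF nonnegative_operator_inverse(1)[OF assms(1)], of "1 / lam"]
      all[OF nonnegative_operator_inverse(1)[OF assms(1)], of "1 / lam"]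
      op_inverse_eigenvector_iff[OF assms(1) _ assms(2)] assms(2)
    by simp
qed

end
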